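(* Let $0<q<1$ and let $s_0,s_1,s_2,s_3\in\mathbb C$ with $s_0\ne0$ and $s_0s_1s_2s_3\notin q^{\mathbb Z}$. Write $\Phi^{qR}_\lambda=\Phi^{qR}_\lambda(\cdot;q;s_0,s_1,s_2,s_3)$ for the $q$-Racah symmetric functions; they form a basis of $\mathrm{Sym}$. Let $\mathbb E:\mathrm{Sym}\to\mathbb C$ be the linear functional with $\mathbb E(\Phi^{qR}_\lambda)=\delta_{\lambda,\emptyset}$ for all partitions $\lambda$, and put $(F,G):=\mathbb E(FG)$. Then for all partitions $\lambda,\mu$, $$(\Phi^{qR}_\lambda,\Phi^{qR}_\mu)=\delta_{\lambda,\mu}\,h^{qR}_\lambda(q;s_0,s_1,s_2,s_3),$$ where $$h^{qR}_\lambda(q;s_0,s_1,s_2,s_3)=q^{n(\lambda')-n(\lambda)}\,\frac{\prod_{0\le i<j\le3}(-s_is_j;q)_\lambda}{(s_0s_1s_2s_3;q)_{\widehat\lambda}}\left(\frac{s_0s_1s_2s_3}q\right)^{|\lambda|}.$$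
   Context: Notation: $(x;q)_n=\prod_{k=0}^{n-1}(1-xq^k)$ for $n\ge0$, $(x_1,\dots,x_m;q)_n=\prod_j(x_j;q)_n$; for a partition $\mu$, $(x;q)_\mu=\prod_{i=1}^{\ell(\mu)}(xq^{1-i};q)_{\mu_i}$. $\widehat\lambda=(2\lambda_1,2\lambda_1,2\lambda_2,2\lambda_2,\dots)$; $\lambda'$ is the transposed partition; $n(\lambda)=\sum_i(i-1)\lambda_i$, so $n(\lambda')=\sum_i\binom{\lambda_i}2$; $\ell(\lambda)$ is the number of nonzero parts and $|\lambda|=\sum\lambda_i$. $\mathbb Y(N)$ is the set of partitions with at most $N$ nonzero parts. $\mathrm{Sym}$ is the algebra of symmetric functions over $\mathbb C$, $\mathrm{Sym}(N)$ the symmetric polynomials in $N$ variables, the subscript $\le d$ means degree at most $d$. $V(x_1,\dots,x_N)=\prod_{i<j}(x_i-x_j)$. Convergence: $F_N\in\mathrm{Sym}(N)$ converges to $F\in\mathrm{Sym}$ if $\sup_N\deg F_N<\infty$ and, for every sufficiently large $d$, $\iota_{d,N}(F_N)\to F$ in the finite-dimensional space $\mathrm{Sym}_{\le d}$, where for $N\ge d$, $\iota_{d,N}:\mathrm{Sym}_{\le d}(N)\to\mathrm{Sym}_{\le d}$ is the inverse of the isomorphism $F\mapsto F(x_1,\dots,x_N,0,0,\dots)$. Interpolation functions: $(x\mid c_0,c_1,\dots)^m=\prod_{i=0}^{m-1}(x-c_i)$; for $\mu\in\mathbb Y(N)$, $s_{\mu|N}(x_1,\dots,x_N\mid c_0,c_1,\dots)=\det[(x_j\mid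 c_0,c_1,\dots)^{\mu_i+N-i}]_{i,j=1}^N/V(x_1,\dots,x_N)$. For $s\ne0$, $I^{BC}_\mu(\cdot;q;s)\in\mathrm{Sym}$ is the limit as $N\to\infty$ (which exists) of $s_{\mu|N}(\cdot\mid c^{(N)}_0,c^{(N)}_1,\dots)$ with $c_i^{(N)}=sq^i+s^{-1}q^{N-i-1}$. $q$-Racah symmetric functions: $\Phi^{qR}_\lambda(\cdot;q;s_0,s_1,s_2,s_3)=\sum_{\mu\subseteq\lambda}\sigma^{qR}(\lambda,\mu;q;s_0,s_1,s_2,s_3)\,I^{BC}_\mu(\cdot;q;s_0)$, where $$\sigma^{qR}(\lambda,\mu;q;s_0,s_1,s_2,s_3)=s_0^{|\mu|-|\lambda|}\det\left[\frac{(-s_0s_1q^{\mu_k+1-k},-s_0s_2q^{\mu_k+1-k},-s_0s_3q^{\mu_k+1-k};q)_{\lambda_j-j-\mu_k+k}}{q^{(\mu_k+1-k)(\lambda_j-j-\mu_k+k)}\,(q,\,s_0s_1s_2s_3q^{\lambda_j+\mu_k+1-j-k};q)_{\lambda_j-j-\mu_k+k}}\right]_{j,k=1}^{\ell(\lambda)};$$ an entry with $\lambda_j-j-\mu_k+k<0$ is $0$, and $\sigma^{qR}(\emptyset,\emptyset)=1$. One has $\Phi^{qR}_\lambda=S_\lambda+$ lower degree terms ($S_\lambda$ the Schur function), so these form a basis of $\mathrm{Sym}$. *)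

theory Defs
  imports Complex_Main "HOL-Library.Poly_Mapping" "Jordan_Normal_Form.Determinant"
begin

section \<open>Monomials and polynomials\<close>

text \<open>
  A monomial in the variables \<open>x\<^sub>0, x\<^sub>1, \<dots>\<close> is its exponent vector; variables, parts of partitions
  and rows of determinants are all indexed from 0, so that the mathematical \<open>x\<^sub>i\<close>, \<open>\<lambda>\<^sub>i\<close> have index \<open>i - 1\<close>.
\<close>

type_synonym monom = "nat \<Rightarrow>\<^sub>0 nat"
type_synonym mpoly = "monom \<Rightarrow>\<^sub>0 complex"

definition mon_deg :: "monom \<Rightarrow> nat" where
  "mon_deg m = (\<Sum>i\<in>Poly_Mapping.keys m. Poly_Mapping.lookup m i)"

definition mvar :: "nat \<Rightarrow> mpoly" where
  "mvar i = Poly_Mapping.single (Poly_Mapping.single i 1) 1"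

definition mconst :: "complex \<Rightarrow> mpoly" where
  "mconst c = Poly_Mapping.single 0 c"

text \<open>\<open>Poly_Mapping.map_key \<pi> m\<close> is the monomial \<open>m\<close> with the variables permuted by the inverse of \<open>\<pi>\<close>.\<close>

definition sympoly :: "nat \<Rightarrow> mpoly set" where
  "sympoly N = {P. (\<forall>m\<in>Poly_Mapping.keys P. Poly_Mapping.keys m \<subseteq> {..<N}) \<and>
     (\<forall>\<pi> m. \<pi> permutes {..<N} \<longrightarrow>
        Poly_Mapping.lookup P (Poly_Mapping.map_key \<pi> m) = Poly_Mapping.lookup P m)}"

definition mpoly_deg_le :: "nat \<Rightarrow> mpoly set" where
  "mpoly_deg_le d = {P. \<forall>m\<in>Poly_Mapping.keys P. mon_deg m \<le> d}"

lemma mon_deg_add: "mon_deg (a + b) = mon_deg a + mon_deg b"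
  unfolding mon_deg_def
  using setsum_keys_plus_distrib[of "\<lambda>_ x. x" a b] by simp

lemma mon_deg_zero [simp]: "mon_deg 0 = 0"
  by (simp add: mon_deg_def)

lemma lookup_map_key:
  "inj \<pi> \<Longrightarrow> Poly_Mapping.lookup (Poly_Mapping.map_key \<pi> m) i = Poly_Mapping.lookup m (\<pi> i)"
  by (simp add: Poly_Mapping.map_key.rep_eq)

lemma map_key_inv:
  fixes \<pi> :: "'a \<Rightarrow> 'a"
  assumes "bij \<pi>"
  shows "Poly_Mapping.map_key (inv_into UNIV \<pi>) (Poly_Mapping.map_key \<pi> m) = m"
    and "Poly_Mapping.map_key \<pi> (Poly_Mapping.map_key (inv_into UNIV \<pi>) m) = m"
  using assms
  by (auto intro!: poly_mapping_eqI simp: lookup_map_key bij_imp_bij_inv bij_is_inj bij_is_surj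
      surj_f_inv_f inv_f_f)

lemma map_key_eq_zero_iff:
  fixes \<pi> :: "nat \<Rightarrow> nat"
  assumes "bij \<pi>"
  shows "Poly_Mapping.map_key \<pi> (m :: monom) = 0 \<longleftrightarrow> m = 0"
proof
  assume "Poly_Mapping.map_key \<pi> m = 0"
  then have "Poly_Mapping.map_key (inv_into UNIV \<pi>) 0 = m"
    using map_key_inv(1)[OF assms, of m] by simp
  then show "m = 0"
    using map_key_zero[of "inv_into UNIV \<pi>"] assms by (simp add: bij_imp_bij_inv bij_is_inj)
qed (use assms in \<open>simp add: map_key_zero bij_is_inj\<close>)

lemma finite_monom_bounded:
  "finite {m :: monom. Poly_Mapping.keys m \<subseteq> A \<and> (\<forall>i. Poly_Mapping.lookup m i \<le> d)}"
  if "finite A"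
proof (rule finite_subset)
  let ?S = "{f :: nat \<Rightarrow> nat. \<forall>i. (i \<in> A \<longrightarrow> f i \<in> {..d}) \<and> (i \<notin> A \<longrightarrow> f i = 0)}"
  show "finite (Abs_poly_mapping ` ?S :: monom set)"
    by (intro finite_imageI finite_set_of_finite_funs that) auto
  show "{m :: monom. Poly_Mapping.keys m \<subseteq> A \<and> (\<forall>i. Poly_Mapping.lookup m i \<le> d)}
      \<subseteq> Abs_poly_mapping ` ?S"
  proof
    fix m :: monom
    assume "m \<in> {m. Poly_Mapping.keys m \<subseteq> A \<and> (\<forall>i. Poly_Mapping.lookup m i \<le> d)}"
    then have keys: "Poly_Mapping.keys m \<subseteq> A" and le: "\<forall>i. Poly_Mapping.lookup m i \<le> d"
      by blast+
    have "Poly_Mapping.lookup m i = 0" if "i \<notin> A" for i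
      using keys that by (meson in_keys_iff subsetD)
    then have "Poly_Mapping.lookup m \<in> ?S"
      using le by blast
    then have "Abs_poly_mapping (Poly_Mapping.lookup m) \<in> Abs_poly_mapping ` ?S"
      by (rule imageI)
    then show "m \<in> Abs_poly_mapping ` ?S"
      by (simp only: poly_mapping.lookup_inverse)
  qed
qed

lemma lookup_le_mon_deg: "Poly_Mapping.lookup m i \<le> mon_deg m"
proof (cases "i \<in> Poly_Mapping.keys m")
  case True
  then show ?thesis
    unfolding mon_deg_def by (intro member_le_sum) auto
qed (simp add: in_keys_iff)

lemma finite_splittings: "finite {(a, b). a + b = (m :: monom)}"
proof -
  let ?D = "{a :: monom. Poly_Mapping.keys a \<subseteq> Poly_Mapping.keys m \<and>
                (\<forall>i. Poly_Mapping.lookup a i \<le> mon_deg m)}"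
  have "{(a, b). a + b = m} \<subseteq> ?D \<times> ?D"
  proof safe
    fix a b :: monom and i
    assume "m = a + b"
    have le: "Poly_Mapping.lookup (a + b) i \<le> mon_deg (a + b)"
      by (rule lookup_le_mon_deg)
    then show "Poly_Mapping.lookup a i \<le> mon_deg (a + b)"
      and "Poly_Mapping.lookup b i \<le> mon_deg (a + b)"
      by (simp_all add: lookup_add)
  qed (auto simp: in_keys_iff lookup_add)
  then show ?thesis
    by (rule finite_subset) (intro finite_cartesian_product finite_monom_bounded finite_keys)
qed

section \<open>The algebra of symmetric functions\<close>

text \<open>
  Formal power series of bounded degree in countably many variables, given by their coefficients,
  that are invariant under all permutations of the variables.
\<close>

typedef symfun = "{f :: monom \<Rightarrow> complex.
    (\<forall>\<pi> m. bij \<pi> \<longrightarrow> f (Poly_Mapping.map_key \<pi> m) = f m) \<and> (\<exists>d. \<forall>m. f m \<noteq> 0 \<longrightarrow> mon_deg m \<le> d)}"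
  morphisms sym_coeff Abs_symfun
  by (rule exI[of _ "\<lambda>_. 0"]) simp

setup_lifting type_definition_symfun

lemma symfun_eqI: "(\<And>m. sym_coeff F m = sym_coeff G m) \<Longrightarrow> F = G"
  using sym_coeff_inject by blast

lemma sym_coeff_sym: "bij \<pi> \<Longrightarrow> sym_coeff F (Poly_Mapping.map_key \<pi> m) = sym_coeff F m"
  using sym_coeff[of F] by simp

lemma sym_coeff_bounded: "\<exists>d. \<forall>m. sym_coeff F m \<noteq> 0 \<longrightarrow> mon_deg m \<le> d"
  using sym_coeff[of F] by simp

lemma conv_assoc:
  fixes f g h :: "monom \<Rightarrow> complex"
  shows "(\<Sum>(a, c)\<in>{(a, c). a + c = m}. (\<Sum>(x, y)\<in>{(x, y). x + y = a}. f x * g y) * h c) =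
         (\<Sum>(a, c)\<in>{(a, c). a + c = m}. f a * (\<Sum>(x, y)\<in>{(x, y). x + y = c}. g x * h y))"
proof -
  have "(\<Sum>(a, c)\<in>{(a, c). a + c = m}. (\<Sum>(x, y)\<in>{(x, y). x + y = a}. f x * g y) * h c) =
      (\<Sum>p\<in>{(a, c). a + c = m}. \<Sum>r\<in>{(x, y). x + y = fst p}. f (fst r) * g (snd r) * h (snd p))"
    by (simp add: case_prod_unfold sum_distrib_right)
  also have "\<dots> = (\<Sum>(p, r)\<in>Sigma {(a, c). a + c = m} (\<lambda>p. {(x, y). x + y = fst p}).
      f (fst r) * g (snd r) * h (snd p))"
    by (intro sum.Sigma) (auto intro: finite_splittings)
  also have "\<dots> = (\<Sum>(p, r)\<in>Sigma {(a, c). a + c = m} (\<lambda>p. {(x, y). x + y = snd p}).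
      f (fst p) * (g (fst r) * h (snd r)))"
    by (rule sum.reindex_bij_witness
        [where i = "\<lambda>((a, c), (x, y)). ((a + x, y), (a, x))"
          and j = "\<lambda>((a, c), (x, y)). ((x, y + c), (y, c))"])
      (auto simp: add.assoc mult.assoc)
  also have "\<dots> = (\<Sum>p\<in>{(a, c). a + c = m}. \<Sum>r\<in>{(x, y). x + y = snd p}.
      f (fst p) * (g (fst r) * h (snd r)))"
    by (intro sum.Sigma[symmetric]) (auto intro: finite_splittings)
  also have "\<dots> = (\<Sum>(a, c)\<in>{(a, c). a + c = m}. f a * (\<Sum>(x, y)\<in>{(x, y). x + y = c}. g x * h y))"
    by (simp add: case_prod_unfold sum_distrib_left)
  finally show ?thesis .
qed

lemma conv_one:
  fixes f :: "monom \<Rightarrow> complex"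
  shows "(\<Sum>(a, b)\<in>{(a, b). a + b = m}. (if a = 0 then 1 else 0) * f b) = f m"
proof -
  have "(\<Sum>(a, b)\<in>{(a, b). a + b = m}. (if a = 0 then 1 else 0) * f b) =
      (\<Sum>(a, b)\<in>{(0 :: monom, m)}. (if a = 0 then 1 else 0) * f b)"
    by (rule sum.mono_neutral_right) (auto simp: finite_splittings split: if_splits)
  then show ?thesis by simp
qed

lemma conv_commute:
  fixes f g :: "monom \<Rightarrow> complex"
  shows "(\<Sum>(a, b)\<in>{(a, b). a + b = m}. f a * g b) = (\<Sum>(a, b)\<in>{(a, b). a + b = m}. g a * f b)"
  by (rule sum.reindex_bij_witness[where i = prod.swap and j = prod.swap])
    (auto simp: add.commute mult.commute)

instantiation symfun :: comm_ring_1
begin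

lift_definition zero_symfun :: symfun is "\<lambda>_. 0"
  by simp

lift_definition one_symfun :: symfun is "\<lambda>m. if m = 0 then 1 else 0"
  by (auto simp: map_key_eq_zero_iff)

lift_definition plus_symfun :: "symfun \<Rightarrow> symfun \<Rightarrow> symfun" is "\<lambda>f g m. f m + g m"
proof safe
  fix f g :: "monom \<Rightarrow> complex" and d e
  assume "\<forall>m. f m \<noteq> 0 \<longrightarrow> mon_deg m \<le> d" "\<forall>m. g m \<noteq> 0 \<longrightarrow> mon_deg m \<le> e"
  then show "\<exists>d. \<forall>m. f m + g m \<noteq> 0 \<longrightarrow> mon_deg m \<le> d"
    by (intro exI[of _ "max d e"]) (metis add.right_neutral le_max_iff_disj)
qed simp

lift_definition uminus_symfun :: "symfun \<Rightarrow> symfun" is "\<lambda>f m. - f m"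
  by simp

lift_definition minus_symfun :: "symfun \<Rightarrow> symfun \<Rightarrow> symfun" is "\<lambda>f g m. f m - g m"
proof safe
  fix f g :: "monom \<Rightarrow> complex" and d e
  assume "\<forall>m. f m \<noteq> 0 \<longrightarrow> mon_deg m \<le> d" "\<forall>m. g m \<noteq> 0 \<longrightarrow> mon_deg m \<le> e"
  then show "\<exists>d. \<forall>m. f m - g m \<noteq> 0 \<longrightarrow> mon_deg m \<le> d"
    by (intro exI[of _ "max d e"]) (metis diff_zero le_max_iff_disj)
qed simp

lift_definition times_symfun :: "symfun \<Rightarrow> symfun \<Rightarrow> symfun" is
  "\<lambda>f g m. \<Sum>(a, b)\<in>{(a, b). a + b = m}. f a * g b"
proof safe
  fix f g :: "monom \<Rightarrow> complex" and d e
  assume f: "\<forall>m. f m \<noteq> 0 \<longrightarrow> mon_deg m \<le> d" and g: "\<forall>m. g m \<noteq> 0 \<longrightarrow> mon_deg m \<le> e"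
  show "\<exists>d. \<forall>m. (\<Sum>(a, b)\<in>{(a, b). a + b = m}. f a * g b) \<noteq> 0 \<longrightarrow> mon_deg m \<le> d"
  proof (intro exI[of _ "d + e"] allI impI)
    fix m
    assume "(\<Sum>(a, b)\<in>{(a, b). a + b = m}. f a * g b) \<noteq> 0"
    then obtain a b where "a + b = m" "f a * g b \<noteq> 0"
      by (rule sum.not_neutral_contains_not_neutral) auto
    with f g show "mon_deg m \<le> d + e"
      by (auto simp: mon_deg_add intro!: add_mono)
  qed
next
  fix f g :: "monom \<Rightarrow> complex" and \<pi> :: "nat \<Rightarrow> nat" and m
  assume f: "\<forall>\<pi> m. bij \<pi> \<longrightarrow> f (Poly_Mapping.map_key \<pi> m) = f m"
    and g: "\<forall>\<pi> m. bij \<pi> \<longrightarrow> g (Poly_Mapping.map_key \<pi> m) = g m" and \<pi>: "bij \<pi>"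
  have inj: "inj \<pi>" "inj (inv_into UNIV \<pi>)"
    using \<pi> by (auto simp: bij_is_inj bij_imp_bij_inv)
  show "(\<Sum>(a, b)\<in>{(a, b). a + b = Poly_Mapping.map_key \<pi> m}. f a * g b) =
      (\<Sum>(a, b)\<in>{(a, b). a + b = m}. f a * g b)"
    by (rule sum.reindex_bij_witness
        [where i = "map_prod (Poly_Mapping.map_key \<pi>) (Poly_Mapping.map_key \<pi>)"
          and j = "map_prod (Poly_Mapping.map_key (inv_into UNIV \<pi>)) (Poly_Mapping.map_key (inv_into UNIV \<pi>))"])
      (use f g \<pi> inj in \<open>auto simp: map_key_inv map_key_plus[symmetric] bij_imp_bij_inv\<close>)
qed

instance
proof
  fix F G H :: symfun
  show "F * G * H = F * (G * H)"
    by transfer (simp add: conv_assoc)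
  show "F * G = G * F"
    by transfer (rule ext, rule conv_commute)
  show "1 * F = F"
    by transfer (simp only: conv_one)
  show "(F + G) * H = F * H + G * H"
    by transfer (simp add: case_prod_unfold distrib_right sum.distrib)
  show "(0 :: symfun) \<noteq> 1"
    by transfer (metis zero_neq_one)
qed (transfer; simp add: algebra_simps)+

end

lift_definition sym_scale :: "complex \<Rightarrow> symfun \<Rightarrow> symfun" is "\<lambda>c f m. c * f m"
  by auto

interpretation sym: vector_space sym_scale
  by unfold_locales (transfer; simp add: algebra_simps)+

definition sym_deg_le :: "nat \<Rightarrow> symfun set" where
  "sym_deg_le d = {F. \<forall>m. sym_coeff F m \<noteq> 0 \<longrightarrow> mon_deg m \<le> d}"

text \<open>The specialization \<open>F(x\<^sub>1, \<dots>, x\<^sub>N, 0, 0, \<dots>)\<close>.\<close>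

lift_definition sym_restrict :: "nat \<Rightarrow> symfun \<Rightarrow> mpoly" is
  "\<lambda>N f m. if Poly_Mapping.keys m \<subseteq> {..<N} then f m else 0"
proof -
  fix N :: nat and f :: "monom \<Rightarrow> complex"
  assume "(\<forall>\<pi> m. bij \<pi> \<longrightarrow> f (Poly_Mapping.map_key \<pi> m) = f m) \<and>
    (\<exists>d. \<forall>m. f m \<noteq> 0 \<longrightarrow> mon_deg m \<le> d)"
  then obtain d where d: "\<And>m. f m \<noteq> 0 \<Longrightarrow> mon_deg m \<le> d"
    by blast
  have "{m. (if Poly_Mapping.keys m \<subseteq> {..<N} then f m else 0) \<noteq> 0} \<subseteq>
      {m. Poly_Mapping.keys m \<subseteq> {..<N} \<and> (\<forall>i. Poly_Mapping.lookup m i \<le> d)}"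
    by (auto split: if_splits intro: order_trans[OF lookup_le_mon_deg d])
  then show "finite {m. (if Poly_Mapping.keys m \<subseteq> {..<N} then f m else 0) \<noteq> 0}"
    by (rule finite_subset) (simp add: finite_monom_bounded)
qed

text \<open>The map \<open>\<iota>\<^bsub>d,N\<^esub>\<close>; it is meaningful for \<open>N \<ge> d\<close> and arguments in \<open>sympoly N \<inter> mpoly_deg_le d\<close>.\<close>

definition sym_lift :: "nat \<Rightarrow> nat \<Rightarrow> mpoly \<Rightarrow> symfun" where
  "sym_lift d N = the_inv_into (sym_deg_le d) (sym_restrict N)"

text \<open>
  Monomial coefficients separate the points of the finite-dimensional space \<open>Sym\<^bsub>\<le>d\<^esub>\<close>, so convergence
  in it is convergence of every coefficient. Sequences need only be given for large \<open>N\<close>.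
\<close>

definition sym_converges :: "(nat \<Rightarrow> mpoly) \<Rightarrow> symfun \<Rightarrow> bool" where
  "sym_converges P F \<longleftrightarrow>
     (\<exists>d. \<forall>\<^sub>F N in sequentially. P N \<in> sympoly N \<inter> mpoly_deg_le d) \<and>
     (\<forall>\<^sub>F d in sequentially. F \<in> sym_deg_le d \<and>
        (\<forall>m. (\<lambda>N. sym_coeff (sym_lift d N (P N)) m) \<longlonglongrightarrow> sym_coeff F m))"

section \<open>Partitions\<close>

definition partitions :: "(nat \<Rightarrow> nat) set" where
  "partitions = {\<nu>. antimono \<nu> \<and> finite {i. \<nu> i \<noteq> 0}}"

definition part_length :: "(nat \<Rightarrow> nat) \<Rightarrow> nat" where
  "part_length \<nu> = card {i. \<nu> i \<noteq> 0}"

definition part_size :: "(nat \<Rightarrow> nat) \<Rightarrow> nat" where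
  "part_size \<nu> = (\<Sum>i<part_length \<nu>. \<nu> i)"

definition part_transpose :: "(nat \<Rightarrow> nat) \<Rightarrow> nat \<Rightarrow> nat" where
  "part_transpose \<nu> j = card {i. j < \<nu> i}"

definition part_n :: "(nat \<Rightarrow> nat) \<Rightarrow> nat" where
  "part_n \<nu> = (\<Sum>i<part_length \<nu>. i * \<nu> i)"

text \<open>\<open>(2\<nu>\<^sub>1, 2\<nu>\<^sub>1, 2\<nu>\<^sub>2, 2\<nu>\<^sub>2, \<dots>)\<close>\<close>

definition part_double :: "(nat \<Rightarrow> nat) \<Rightarrow> nat \<Rightarrow> nat" where
  "part_double \<nu> i = 2 * \<nu> (i div 2)"

definition part_subseteq :: "(nat \<Rightarrow> nat) \<Rightarrow> (nat \<Rightarrow> nat) \<Rightarrow> bool" where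
  "part_subseteq \<mu> \<nu> \<longleftrightarrow> (\<forall>i. \<mu> i \<le> \<nu> i)"

definition empty_part :: "nat \<Rightarrow> nat" where
  "empty_part = (\<lambda>_. 0)"

section \<open>Pochhammer symbols\<close>

definition qpoch :: "complex \<Rightarrow> complex \<Rightarrow> nat \<Rightarrow> complex" where
  "qpoch x q n = (\<Prod>k<n. 1 - x * q ^ k)"

definition qpoch_part :: "complex \<Rightarrow> complex \<Rightarrow> (nat \<Rightarrow> nat) \<Rightarrow> complex" where
  "qpoch_part x q \<nu> = (\<Prod>i<part_length \<nu>. qpoch (x * q powi (- int i)) q (\<nu> i))"

section \<open>Interpolation functions\<close>

definition vandermonde :: "nat \<Rightarrow> mpoly" where
  "vandermonde N = (\<Prod>j<N. \<Prod>i<j. mvar i - mvar j)"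

text \<open>The quotient of the determinant by the Vandermonde product, as a polynomial.\<close>

definition fact_schur :: "nat \<Rightarrow> (nat \<Rightarrow> nat) \<Rightarrow> (nat \<Rightarrow> complex) \<Rightarrow> mpoly" where
  "fact_schur N \<mu> c = (THE P. P * vandermonde N =
     det (mat N N (\<lambda>(i, j). \<Prod>k<\<mu> i + N - 1 - i. mvar j - mconst (c k))))"

definition interp_BC :: "(nat \<Rightarrow> nat) \<Rightarrow> complex \<Rightarrow> complex \<Rightarrow> symfun" where
  "interp_BC \<mu> q s = (THE F. sym_converges
     (\<lambda>N. fact_schur N \<mu> (\<lambda>i. s * q ^ i + inverse s * q powi (int N - int i - 1))) F)"

section \<open>\<open>q\<close>-Racah symmetric functions\<close>

text \<open>
  The entries of the determinant: \<open>d = \<lambda>\<^sub>j - j - \<mu>\<^sub>k + k\<close>, \<open>e\<close> is \<open>\<mu>\<^sub>k + 1 - k\<close>, and the last exponent is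
  \<open>\<lambda>\<^sub>j + \<mu>\<^sub>k + 1 - j - k\<close>, rewritten for indices \<open>j\<close>, \<open>k\<close> starting from 0.
\<close>

definition sigma_entry ::
    "(nat \<Rightarrow> nat) \<Rightarrow> (nat \<Rightarrow> nat) \<Rightarrow> complex \<Rightarrow> complex \<Rightarrow> complex \<Rightarrow> complex \<Rightarrow> complex \<Rightarrow>
     nat \<Rightarrow> nat \<Rightarrow> complex" where
  "sigma_entry \<nu> \<mu> q s0 s1 s2 s3 j k =
     (let d = int (\<nu> j) - int j - int (\<mu> k) + int k; e = int (\<mu> k) - int k in
      if d < 0 then 0
      else qpoch (- s0 * s1 * q powi e) q (nat d) * qpoch (- s0 * s2 * q powi e) q (nat d) *
           qpoch (- s0 * s3 * q powi e) q (nat d) /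
           (q powi (e * d) * qpoch q q (nat d) *
            qpoch (s0 * s1 * s2 * s3 * q powi (int (\<nu> j) + int (\<mu> k) - 1 - int j - int k)) q (nat d)))"

definition sigma_qR ::
    "(nat \<Rightarrow> nat) \<Rightarrow> (nat \<Rightarrow> nat) \<Rightarrow> complex \<Rightarrow> complex \<Rightarrow> complex \<Rightarrow> complex \<Rightarrow> complex \<Rightarrow> complex" where
  "sigma_qR \<nu> \<mu> q s0 s1 s2 s3 =
     s0 powi (int (part_size \<mu>) - int (part_size \<nu>)) *
     det (mat (part_length \<nu>) (part_length \<nu>) (\<lambda>(j, k). sigma_entry \<nu> \<mu> q s0 s1 s2 s3 j k))"

definition Phi_qR ::
    "(nat \<Rightarrow> nat) \<Rightarrow> complex \<Rightarrow> complex \<Rightarrow> complex \<Rightarrow> complex \<Rightarrow> complex \<Rightarrow> symfun" where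
  "Phi_qR \<nu> q s0 s1 s2 s3 =
     (\<Sum>\<mu>\<in>{\<mu> \<in> partitions. part_subseteq \<mu> \<nu>}.
        sym_scale (sigma_qR \<nu> \<mu> q s0 s1 s2 s3) (interp_BC \<mu> q s0))"

definition h_qR ::
    "(nat \<Rightarrow> nat) \<Rightarrow> complex \<Rightarrow> complex \<Rightarrow> complex \<Rightarrow> complex \<Rightarrow> complex \<Rightarrow> complex" where
  "h_qR \<nu> q s0 s1 s2 s3 =
     q powi (int (part_n (part_transpose \<nu>)) - int (part_n \<nu>)) *
     (\<Prod>j<4. \<Prod>i<j. qpoch_part (- ([s0, s1, s2, s3] ! i) * ([s0, s1, s2, s3] ! j)) q \<nu>) /
     qpoch_part (s0 * s1 * s2 * s3) q (part_double \<nu>) *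
     (s0 * s1 * s2 * s3 / q) ^ part_size \<nu>"

end

theory Submission
  imports Defs "HOL-Computational_Algebra.Formal_Power_Series" "HOL-Library.FuncSet"
begin

text \<open>
  The monic Askey--Wilson polynomials satisfy a three-term recurrence, hence are orthogonal with respect
  to a finite sum with complex weights, up to any given degree. By the Cauchy--Binet formula, the ratios
  \<open>det [p\<^bsub>\<lambda>\<^sub>i + N - i\<^esub>(x\<^sub>j)] / V(x)\<close> are orthogonal for the product weight times \<open>V(x)\<^sup>2\<close>, and their
  expansion in interpolation polynomials has determinantal coefficients, which tend to
  \<open>\<sigma>\<^sup>q\<^sup>R(\<lambda>, \<mu>)\<close> as \<open>N\<close> tends to infinity; the norms are products of recurrence coefficients and tend to
  \<open>h\<^sup>q\<^sup>R\<close>.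

  For the parameters that give \<open>\<sigma>\<^sup>q\<^sup>R\<close> in the limit, the nodes are \<open>s\<^sub>0\<inverse> q\<^bsup>N-i-1\<^esup> - s\<^sub>0 q\<^sup>i\<close>, whereas those of the
  interpolation functions are \<open>s\<^sub>0\<inverse> q\<^bsup>N-i-1\<^esup> + s\<^sub>0 q\<^sup>i\<close>. This is harmless: the limits of the structure
  constants of the interpolation functions are determined by their values on the interpolation grid, which
  only involve the nodes with index near \<open>N\<close>, where \<open>s\<^sub>0 q\<^sup>i\<close> tends to zero. The functional only sees the
  coefficients \<open>\<sigma>\<^sup>q\<^sup>R\<close> and these structure constants.
\<close>

text \<open>No measure is passed to the limit. For each N the functional is known only on the
  N-variable orthogonal polynomials; its values on the interpolation functions solve a linear system
  that is triangular for inclusion of partitions. The coefficients of the system converge and the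
  limiting diagonal is 1, so the values converge to those of the given functional, whatever the
  weights do.

  For this the polynomials in N variables must live in one space. The alternant divided by V(x) is a
  Jacobi--Trudi determinant whose size is the number of parts; N enters it only through the
  coefficients of the generating polynomial of the nodes. Hence it lifts to symmetric functions, and
  convergence becomes that of scalars.

  The sign of the nodes is forced by the arguments - s0 s_i q^e in \<sigma>: a product of two
  Askey--Wilson parameters has to be - s_i s_j q^(1-N), so each parameter carries a square root of
  -1, and the two terms of a node, proportional to a parameter and to its inverse, change their
  relative sign.\<close>

section \<open>Generating series and Jacobi--Trudi determinants\<close>

definition geo :: "'a :: comm_ring_1 \<Rightarrow> 'a fps" where
  "geo x = Abs_fps (\<lambda>r. x ^ r)"

definition lin_prod :: "nat \<Rightarrow> (nat \<Rightarrow> 'a :: comm_ring_1) \<Rightarrow> 'a fps" where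
  "lin_prod m c = (\<Prod>r<m. 1 - fps_const (c r) * fps_X)"

text \<open>The generating series of the complete homogeneous polynomials in x_0, ...,
  x_(N-1).\<close>

definition hser :: "nat \<Rightarrow> (nat \<Rightarrow> 'a :: comm_ring_1) \<Rightarrow> 'a fps" where
  "hser N x = (\<Prod>i<N. geo (x i))"

definition vdm :: "nat \<Rightarrow> (nat \<Rightarrow> 'a :: comm_ring_1) \<Rightarrow> 'a" where
  "vdm N x = (\<Prod>j<N. \<Prod>i<j. x i - x j)"

lemma lin_nth:
  "fps_nth ((1 - fps_const (c :: 'a :: comm_ring_1) * fps_X) * F) n =
     fps_nth F n - c * (if n = 0 then 0 else fps_nth F (n - 1))"
proof -
  have "(1 - fps_const c * fps_X) * F = F - fps_const c * (fps_X * F)"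
    by (simp add: algebra_simps)
  then show ?thesis
    by (simp only: fps_sub_nth fps_mult_left_const_nth fps_X_mult_nth)
qed

lemma lin_geo: "(1 - fps_const x * fps_X) * geo x = 1"
proof (rule fps_ext)
  fix n
  show "fps_nth ((1 - fps_const x * fps_X) * geo x) n = fps_nth 1 n"
    unfolding lin_nth by (cases n) (simp_all add: geo_def)
qed

text \<open>The coefficients of \<open>geo x\<close> form a geometric progression, so a factor 1 - c
  X replaces x^n by x^(n-1) (x - c). At n = m the product of the x - c_r becomes a single
  coefficient of a power series.\<close>

lemma lin_prod_geo_nth:
  "n \<ge> m \<Longrightarrow> fps_nth (lin_prod m c * geo x) n = x ^ (n - m) * (\<Prod>r<m. x - c r)"
proof (induction m arbitrary: n)
  case 0
  then show ?case by (simp add: lin_prod_def geo_def)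
next
  case (Suc m)
  have "lin_prod (Suc m) c * geo x = (1 - fps_const (c m) * fps_X) * (lin_prod m c * geo x)"
    by (simp add: lin_prod_def mult_ac)
  then have "fps_nth (lin_prod (Suc m) c * geo x) n =
      x ^ (n - m) * (\<Prod>r<m. x - c r) - c m * (x ^ (n - 1 - m) * (\<Prod>r<m. x - c r))"
    using Suc by (simp add: lin_nth)
  also have "x ^ (n - m) = x * x ^ (n - Suc m)"
    using Suc.prems by (metis Suc_diff_Suc Suc_le_eq power_Suc)
  finally show ?case
    by (simp add: algebra_simps)
qed

lemma prod_lin_nth_eq_0:
  "finite A \<Longrightarrow> b > card A \<Longrightarrow> fps_nth (\<Prod>i\<in>A. 1 - fps_const (x i :: 'a :: comm_ring_1) * fps_X) b = 0"
proof (induction A arbitrary: b rule: finite_induct)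
  case (insert a A)
  then have "fps_nth (\<Prod>i\<in>A. 1 - fps_const (x i) * fps_X) b = 0"
    "fps_nth (\<Prod>i\<in>A. 1 - fps_const (x i) * fps_X) (b - 1) = 0"
    by simp_all
  then show ?case
    using insert(1,2) by (simp add: lin_nth)
qed simp

lemma hser_cofactor:
  assumes "j < N"
  shows "hser N x * (\<Prod>i\<in>{..<N} - {j}. 1 - fps_const (x i) * fps_X) = geo (x j)"
proof -
  have "hser N x = geo (x j) * (\<Prod>i\<in>{..<N} - {j}. geo (x i))"
    unfolding hser_def using assms by (simp add: prod.remove)
  moreover have "(\<Prod>i\<in>{..<N} - {j}. geo (x i)) * (\<Prod>i\<in>{..<N} - {j}. 1 - fps_const (x i) * fps_X) = 1"
    unfolding prod.distrib[symmetric] by (rule prod.neutral) (metis lin_geo mult.commute)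
  ultimately show ?thesis by (simp add: mult.assoc)
qed

text \<open>A complete homogeneous polynomial of degree \<mu>_i - i + k, deformed by the nodes; the
  conditional stands for the vanishing of coefficients of negative degree.\<close>

definition jt_entry :: "nat \<Rightarrow> (nat \<Rightarrow> nat) \<Rightarrow> (nat \<Rightarrow> 'a :: comm_ring_1) \<Rightarrow> (nat \<Rightarrow> 'a) \<Rightarrow> nat \<Rightarrow> nat \<Rightarrow> 'a" where
  "jt_entry N \<mu> c x i k =
     (if i \<le> \<mu> i + k then fps_nth (lin_prod (\<mu> i + N - 1 - i) c * hser N x) (\<mu> i + k - i) else 0)"

text \<open>Column j consists of the signed elementary symmetric polynomials in the variables other
  than x_j.\<close>

definition cofactor_mat :: "nat \<Rightarrow> (nat \<Rightarrow> 'a :: comm_ring_1) \<Rightarrow> 'a mat" where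
  "cofactor_mat N x = mat N N (\<lambda>(k, j). fps_nth (\<Prod>i\<in>{..<N} - {j}. 1 - fps_const (x i) * fps_X) (N - 1 - k))"

text \<open>By \<open>hser_cofactor\<close> the series \<open>geo (x j)\<close> is
  \<open>hser N x\<close> times a polynomial of degree less than N, so the coefficient found in
  \<open>lin_prod_geo_nth\<close> is a convolution with at most N terms.\<close>

lemma jt_expansion:
  assumes "i < N" "j < N"
  shows "(\<Prod>r<\<mu> i + N - 1 - i. x j - c r) =
    (\<Sum>k<N. jt_entry N \<mu> c x i k * fps_nth (\<Prod>i\<in>{..<N} - {j}. 1 - fps_const (x i) * fps_X) (N - 1 - k))"
proof -
  let ?m = "\<mu> i + N - 1 - i"
  let ?W = "\<Prod>i\<in>{..<N} - {j}. 1 - fps_const (x i) * fps_X"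
  let ?F = "lin_prod ?m c * hser N x"
  have "(\<Prod>r<?m. x j - c r) = fps_nth (lin_prod ?m c * geo (x j)) ?m"
    by (simp add: lin_prod_geo_nth)
  also have "lin_prod ?m c * geo (x j) = ?W * ?F"
    unfolding hser_cofactor[OF assms(2), of x, symmetric] by (simp only: mult_ac)
  also have "fps_nth (?W * ?F) ?m = (\<Sum>b=0..?m. fps_nth ?W b * fps_nth ?F (?m - b))"
    by (rule fps_mult_nth)
  also have "\<dots> = (\<Sum>b<N. if b \<le> ?m then fps_nth ?W b * fps_nth ?F (?m - b) else 0)"
    using assms prod_lin_nth_eq_0[of "{..<N} - {j}" _ x]
    by (intro sum.mono_neutral_cong) auto
  also have "\<dots> = (\<Sum>k<N. if N - 1 - k \<le> ?m then fps_nth ?W (N - 1 - k) * fps_nth ?F (?m - (N - 1 - k)) else 0)"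
    by (rule sum.reindex_bij_witness[where i = "\<lambda>k. N - 1 - k" and j = "\<lambda>k. N - 1 - k"]) auto
  also have "\<dots> = (\<Sum>k<N. jt_entry N \<mu> c x i k * fps_nth ?W (N - 1 - k))"
  proof (rule sum.cong[OF refl])
    fix k assume "k \<in> {..<N}"
    then have "N - 1 - k \<le> ?m \<longleftrightarrow> i \<le> \<mu> i + k" "i \<le> \<mu> i + k \<Longrightarrow> ?m - (N - 1 - k) = \<mu> i + k - i"
      using assms by auto
    then show "(if N - 1 - k \<le> ?m then fps_nth ?W (N - 1 - k) * fps_nth ?F (?m - (N - 1 - k)) else 0) =
      jt_entry N \<mu> c x i k * fps_nth ?W (N - 1 - k)"
      by (auto simp: jt_entry_def)
  qed
  finally show ?thesis .
qed

lemma det_alternant_cofactor: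
  "det (mat N N (\<lambda>(i, j). \<Prod>r<\<mu> i + N - 1 - i. x j - c r)) =
   det (mat N N (\<lambda>(i, k). jt_entry N \<mu> c x i k)) * det (cofactor_mat N x)"
proof -
  have "mat N N (\<lambda>(i, j). \<Prod>r<\<mu> i + N - 1 - i. x j - c r) =
      mat N N (\<lambda>(i, k). jt_entry N \<mu> c x i k) * cofactor_mat N x"
    by (rule eq_matI)
      (auto simp: cofactor_mat_def scalar_prod_def lessThan_atLeast0[symmetric]
        jt_expansion[simplified] intro!: sum.cong)
  then show ?thesis
    by (simp add: det_mult[of _ N] cofactor_mat_def)
qed

lemma det_mat_lower_left_zero:
  assumes "\<And>i k. i < n \<Longrightarrow> k < i \<Longrightarrow> f (i, k) = 0"
  shows "det (mat n n f) = (\<Prod>i<n. f (i, i))"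
proof -
  have "upper_triangular (mat n n f)"
    using assms by (auto intro!: upper_triangularI)
  then have "det (mat n n f) = prod_list (diag_mat (mat n n f))"
    by (intro det_upper_triangular[of _ n]) auto
  also have "\<dots> = (\<Prod>i<n. f (i, i))"
    by (auto simp: diag_mat_def lessThan_atLeast0 prod.distinct_set_conv_list[symmetric] intro!: prod.cong)
  finally show ?thesis .
qed

lemma hser_nth_0 [simp]: "fps_nth (hser N x) 0 = 1"
  by (induction N) (simp_all add: hser_def geo_def)

lemma lin_prod_nth_0 [simp]: "fps_nth (lin_prod m c) 0 = 1"
  by (induction m) (simp_all add: lin_prod_def)

text \<open>For the zero partition the Jacobi--Trudi factor is unitriangular, so the left-hand side
  does not depend on the nodes. They can therefore be chosen at will, as in
  \<open>det_vandermonde\<close>.\<close>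

lemma det_factorial_empty:
  "det (mat N N (\<lambda>(i, j). \<Prod>r<N - 1 - i. x j - c r)) = det (cofactor_mat N x)"
proof -
  have "det (mat N N (\<lambda>(i, k). jt_entry N (\<lambda>_. 0) c x i k)) = 1"
    by (subst det_mat_lower_left_zero) (auto simp: jt_entry_def)
  then show ?thesis
    using det_alternant_cofactor[where \<mu> = "\<lambda>_. 0" and c = c and x = x and N = N] by simp
qed

lemma det_mat_scale:
  "det (mat n n (\<lambda>(i, k). u i * v k * f i k)) = (\<Prod>i<n. u i) * (\<Prod>k<n. v k) * det (mat n n (\<lambda>(i, k). f i k :: 'a :: comm_ring_1))"
proof -
  have perm: "(\<Prod>i = 0..<n. v (p i)) = (\<Prod>k<n. v k)" if "p permutes {0..<n}" for p
    using prod.permute[OF that, of v] by (simp add: o_def lessThan_atLeast0)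
  have *: "(\<Prod>i = 0..<n. mat n n (\<lambda>(i, k). u i * v k * f i k) $$ (i, p i)) =
    (\<Prod>i<n. u i) * (\<Prod>k<n. v k) * (\<Prod>i = 0..<n. mat n n (\<lambda>(i, k). f i k) $$ (i, p i))"
    if "p permutes {0..<n}" for p
  proof -
    have "(\<Prod>i = 0..<n. mat n n (\<lambda>(i, k). u i * v k * f i k) $$ (i, p i)) =
        (\<Prod>i = 0..<n. u i * v (p i) * f i (p i))"
      using permutes_in_image[OF that] by (intro prod.cong) auto
    also have "\<dots> = (\<Prod>i<n. u i) * (\<Prod>k<n. v k) * (\<Prod>i = 0..<n. f i (p i))"
      by (simp add: prod.distrib perm[OF that] lessThan_atLeast0)
    also have "(\<Prod>i = 0..<n. f i (p i)) = (\<Prod>i = 0..<n. mat n n (\<lambda>(i, k). f i k) $$ (i, p i))"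
      using permutes_in_image[OF that] by (intro prod.cong) auto
    finally show ?thesis .
  qed
  show ?thesis
    unfolding det_def'[OF mat_carrier] sum_distrib_left
    by (rule sum.cong[OF refl], unfold mem_Collect_eq, subst *, assumption, rule mult.left_commute)
qed

lemma det_mat_last_row:
  assumes "\<And>k. k < n \<Longrightarrow> f (n, k) = 0"
  shows "det (mat (Suc n) (Suc n) f) = f (n, n) * det (mat n n f :: 'a :: comm_ring_1 mat)"
proof -
  let ?A = "mat (Suc n) (Suc n) f"
  have "det ?A = (\<Sum>j<Suc n. ?A $$ (n, j) * cofactor ?A n j)"
    by (intro laplace_expansion_row) auto
  also have "\<dots> = f (n, n) * cofactor ?A n n"
    using assms by (simp add: lessThan_Suc)
  also have "mat_delete ?A n n = mat n n f"
    by (rule eq_matI) (auto simp: mat_delete_def)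
  then have "cofactor ?A n n = det (mat n n f)"
    by (simp add: cofactor_def)
  finally show ?thesis .
qed

lemma det_mat_last_col:
  assumes "\<And>k. k < n \<Longrightarrow> f (k, n) = 0"
  shows "det (mat (Suc n) (Suc n) f) = f (n, n) * det (mat n n f :: 'a :: comm_ring_1 mat)"
proof -
  let ?A = "mat (Suc n) (Suc n) f"
  have "det ?A = (\<Sum>j<Suc n. ?A $$ (j, n) * cofactor ?A j n)"
    by (intro laplace_expansion_column) auto
  also have "\<dots> = f (n, n) * cofactor ?A n n"
    using assms by (simp add: lessThan_Suc)
  also have "mat_delete ?A n n = mat n n f"
    by (rule eq_matI) (auto simp: mat_delete_def)
  then have "cofactor ?A n n = det (mat n n f)"
    by (simp add: cofactor_def)
  finally show ?thesis .
qed

text \<open>Cuts a determinant of size N down to a size independent of N: rows beyond the length of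
  a partition have this shape.\<close>

lemma det_mat_trailing_unit:
  assumes "L \<le> N" "\<And>i k. L \<le> i \<Longrightarrow> i < N \<Longrightarrow> k < i \<Longrightarrow> f (i, k) = 0"
    and "\<And>i. L \<le> i \<Longrightarrow> i < N \<Longrightarrow> f (i, i) = 1"
  shows "det (mat N N f) = det (mat L L f :: 'a :: comm_ring_1 mat)"
  using assms
proof (induction N)
  case (Suc N)
  show ?case
  proof (cases "L = Suc N")
    case False
    then have "det (mat N N f) = det (mat L L f)"
      using Suc by simp
    moreover have "det (mat (Suc N) (Suc N) f) = f (N, N) * det (mat N N f)"
      using Suc.prems False by (intro det_mat_last_row) auto
    ultimately show ?thesis using Suc.prems False by simp
  qed simp
qed simp

lemma det_vandermonde: "det (mat N N (\<lambda>(i, j). x j ^ (N - 1 - i))) = vdm N (x :: nat \<Rightarrow> 'a :: comm_ring_1)"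
proof (induction N arbitrary: x)
  case (Suc N)
  \<comment> \<open>All nodes are moved from 0 to x_N, which leaves a single nonzero entry in the
    last column.\<close>
  have "det (mat (Suc N) (Suc N) (\<lambda>(i, j). x j ^ (Suc N - 1 - i))) =
      det (mat (Suc N) (Suc N) (\<lambda>(i, j). (x j - x N) ^ (Suc N - 1 - i)))"
    using det_factorial_empty[of "Suc N" x "\<lambda>_. 0"] det_factorial_empty[of "Suc N" x "\<lambda>_. x N"]
    by simp
  also have "\<dots> = (x N - x N) ^ (N - N) * det (mat N N (\<lambda>(i, j). (x j - x N) ^ (Suc N - 1 - i)))"
    by (subst det_mat_last_col) (auto simp: power_0_left)
  also have "mat N N (\<lambda>(i, j). (x j - x N) ^ (Suc N - 1 - i)) =
      mat N N (\<lambda>(i, j). 1 * (x j - x N) * (x j - x N) ^ (N - 1 - i))"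
    by (rule eq_matI) (auto simp: power_Suc[symmetric] Suc_diff_Suc simp del: power_Suc)
  also have "det \<dots> = (\<Prod>i<N. x i - x N) * vdm N (\<lambda>i. x i - x N)"
    by (simp only: det_mat_scale Suc.IH) simp
  also have "vdm N (\<lambda>i. x i - x N) = vdm N x"
    by (simp add: vdm_def)
  finally show ?case by (simp add: vdm_def mult.commute)
qed (simp add: vdm_def)

text \<open>The cofactor matrix involves neither \<mu> nor c, and the case \<mu> = 0, c = 0
  identifies its determinant as the Vandermonde product.\<close>

lemma det_alternant:
  "det (mat N N (\<lambda>(i, j). \<Prod>r<\<mu> i + N - 1 - i. x j - c r)) =
   det (mat N N (\<lambda>(i, k). jt_entry N \<mu> c x i k)) * vdm N x"
  using det_alternant_cofactor[where \<mu> = \<mu> and c = c and x = x and N = N] det_factorial_empty[of N x "\<lambda>_. 0"] det_vandermonde[of N x]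
  by simp

section \<open>Partitions\<close>

lemma partitions_antimono: "\<nu> \<in> partitions \<Longrightarrow> i \<le> j \<Longrightarrow> \<nu> j \<le> \<nu> i"
  by (auto simp: partitions_def antimono_def)

lemma partition_support:
  assumes "\<nu> \<in> partitions"
  shows "{i. \<nu> i \<noteq> 0} = {..<part_length \<nu>}"
proof -
  have fin: "finite {i. \<nu> i \<noteq> 0}"
    using assms by (simp add: partitions_def)
  then have "{i. \<nu> i \<noteq> 0} \<noteq> UNIV"
    by auto
  then obtain i0 where i0: "\<nu> i0 = 0"
    by auto
  define m where "m = (LEAST i. \<nu> i = 0)"
  have "\<nu> m = 0" "\<And>i. i < m \<Longrightarrow> \<nu> i \<noteq> 0"
    using LeastI[of "\<lambda>i. \<nu> i = 0", OF i0] not_less_Least unfolding m_def by auto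
  moreover have "i < m" if "\<nu> i \<noteq> 0" for i
    using partitions_antimono[OF assms, of m i] \<open>\<nu> m = 0\<close> that by (cases "m \<le> i") auto
  ultimately have "{i. \<nu> i \<noteq> 0} = {..<m}"
    by auto
  then show ?thesis
    by (simp add: part_length_def)
qed

lemma part_nonzero_iff: "\<nu> \<in> partitions \<Longrightarrow> \<nu> i \<noteq> 0 \<longleftrightarrow> i < part_length \<nu>"
  using partition_support by blast

lemma part_eq_0_iff: "\<nu> \<in> partitions \<Longrightarrow> \<nu> i = 0 \<longleftrightarrow> part_length \<nu> \<le> i"
  using part_nonzero_iff[of \<nu> i] by auto

lemma part_length_le_iff: "\<nu> \<in> partitions \<Longrightarrow> part_length \<nu> \<le> L \<longleftrightarrow> \<nu> L = 0"
  by (simp add: part_eq_0_iff)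

lemma part_size_eq:
  assumes "\<nu> \<in> partitions" "part_length \<nu> \<le> L"
  shows "part_size \<nu> = (\<Sum>i<L. \<nu> i)"
  unfolding part_size_def using assms by (intro sum.mono_neutral_left) (auto simp: part_eq_0_iff)

lemma part_subseteq_length:
  assumes "\<mu> \<in> partitions" "\<nu> \<in> partitions" "part_subseteq \<mu> \<nu>"
  shows "part_length \<mu> \<le> part_length \<nu>"
  using assms by (metis part_length_le_iff part_subseteq_def le_zero_eq order_refl)

lemma part_subseteq_size:
  assumes "\<mu> \<in> partitions" "\<nu> \<in> partitions" "part_subseteq \<mu> \<nu>"
  shows "part_size \<mu> \<le> part_size \<nu>"
  using part_size_eq[of \<mu> "part_length \<nu>"] part_size_eq[of \<nu> "part_length \<nu>"]
    part_subseteq_length[OF assms] assms by (auto simp: part_subseteq_def intro: sum_mono)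

lemma part_subseteq_size_eq:
  assumes "\<mu> \<in> partitions" "\<nu> \<in> partitions" "part_subseteq \<mu> \<nu>" "part_size \<nu> \<le> part_size \<mu>"
  shows "\<mu> = \<nu>"
proof (rule ccontr)
  assume "\<mu> \<noteq> \<nu>"
  then obtain i where "\<mu> i \<noteq> \<nu> i" by blast
  then have i: "\<mu> i < \<nu> i"
    using assms(3) unfolding part_subseteq_def by (meson le_neq_implies_less)
  then have "i < part_length \<nu>" using part_nonzero_iff[OF assms(2), of i] by simp
  then have "(\<Sum>i<part_length \<nu>. \<mu> i) < (\<Sum>i<part_length \<nu>. \<nu> i)"
    using i assms(3) unfolding part_subseteq_def by (intro sum_strict_mono_ex1) blast+
  then show False
    using assms(4) part_size_eq[OF assms(1), of "part_length \<nu>"] part_size_eq[OF assms(2) order_refl]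
      part_subseteq_length[OF assms(1-3)] by linarith
qed

lemma part_size_ge:
  assumes "\<nu> \<in> partitions"
  shows "\<nu> i \<le> part_size \<nu>"
proof (cases "i < part_length \<nu>")
  case True
  then show ?thesis unfolding part_size_def by (intro member_le_sum) auto
qed (use part_eq_0_iff[OF assms, of i] in simp)

lemma part_length_le_size:
  assumes "\<nu> \<in> partitions"
  shows "part_length \<nu> \<le> part_size \<nu>"
proof -
  have "(\<Sum>i<part_length \<nu>. 1) \<le> (\<Sum>i<part_length \<nu>. \<nu> i)"
    using part_nonzero_iff[OF assms] by (intro sum_mono) (auto simp: Suc_le_eq)
  then show ?thesis by (simp add: part_size_def)
qed

lemma finite_partitions_box: "finite {\<nu> \<in> partitions. part_length \<nu> \<le> L \<and> (\<forall>i. \<nu> i \<le> d)}"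
proof (rule finite_subset)
  let ?S = "{f :: nat \<Rightarrow> nat. \<forall>i. (i \<in> {..<L} \<longrightarrow> f i \<in> {..d}) \<and> (i \<notin> {..<L} \<longrightarrow> f i = 0)}"
  show "finite ?S" by (intro finite_set_of_finite_funs) auto
  show "{\<nu> \<in> partitions. part_length \<nu> \<le> L \<and> (\<forall>i. \<nu> i \<le> d)} \<subseteq> ?S"
    by (auto simp: part_eq_0_iff)
qed

text \<open>The index set of the finite-dimensional linear algebra below.\<close>

definition parts_le :: "nat \<Rightarrow> (nat \<Rightarrow> nat) set" where
  "parts_le d = {\<nu> \<in> partitions. part_size \<nu> \<le> d}"

lemma finite_parts_le [simp]: "finite (parts_le d)"
  by (rule finite_subset[OF _ finite_partitions_box[of d d]])
    (auto simp: parts_le_def intro: order_trans part_size_ge part_length_le_size)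

lemma finite_sub_partitions [simp]: "\<nu> \<in> partitions \<Longrightarrow> finite {\<mu> \<in> partitions. part_subseteq \<mu> \<nu>}"
  by (rule finite_subset[OF _ finite_parts_le[of "part_size \<nu>"]])
    (auto simp: parts_le_def part_subseteq_size)

lemma empty_part_partition [simp]: "empty_part \<in> partitions"
  by (simp add: partitions_def empty_part_def antimono_def)

lemma empty_part_length [simp]: "part_length empty_part = 0"
  by (simp add: part_length_def empty_part_def)

lemma empty_part_size [simp]: "part_size empty_part = 0"
  by (simp add: part_size_def)

lemma part_subseteq_refl [simp]: "part_subseteq \<mu> \<mu>"
  by (simp add: part_subseteq_def)

subsection \<open>Strictly decreasing sequences and the Cauchy--Binet formula\<close>

text \<open>Adding the staircase turns partitions with at most n parts into n-element sets of
  exponents, listed in decreasing order; minors can thus be indexed by partitions.\<close>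

definition shifted :: "nat \<Rightarrow> (nat \<Rightarrow> nat) \<Rightarrow> nat \<Rightarrow> nat" where
  "shifted n \<mu> i = \<mu> i + n - 1 - i"

lemma shifted_strict:
  assumes "\<mu> \<in> partitions" "i < j" "j < n"
  shows "shifted n \<mu> j < shifted n \<mu> i"
  using partitions_antimono[OF assms(1), of i j] assms(2,3) by (simp add: shifted_def)

lemma shifted_inj:
  assumes "\<mu> \<in> partitions"
  shows "inj_on (shifted n \<mu>) {..<n}"
  by (rule inj_onI) (metis assms lessThan_iff less_irrefl linorder_neqE_nat shifted_strict)

lemma shifted_image_inj:
  assumes \<mu>: "\<mu> \<in> partitions" "part_length \<mu> \<le> n" and \<nu>: "\<nu> \<in> partitions" "part_length \<nu> \<le> n"
    and eq: "shifted n \<mu> ` {..<n} = shifted n \<nu> ` {..<n}"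
  shows "\<mu> = \<nu>"
proof -
  have srt: "sorted (rev (map (shifted n \<kappa>) [0..<n]))" "distinct (rev (map (shifted n \<kappa>) [0..<n]))"
    if "\<kappa> \<in> partitions" for \<kappa>
    using that shifted_inj[OF that, of n]
    by (auto simp: sorted_rev_iff_nth_mono distinct_map lessThan_atLeast0 le_less dest!: shifted_strict)
  have "rev (map (shifted n \<mu>) [0..<n]) = rev (map (shifted n \<nu>) [0..<n])"
    by (rule sorted_distinct_set_unique) (use srt \<mu> \<nu> eq in \<open>auto simp: lessThan_atLeast0\<close>)
  then have "shifted n \<mu> i = shifted n \<nu> i" if "i < n" for i
    using that by (auto simp: map_eq_conv)
  then have "\<mu> i = \<nu> i" if "i < n" for i
    using that by (force simp: shifted_def)
  moreover have "\<mu> i = \<nu> i" if "i \<ge> n" for i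
    using that \<mu> \<nu> part_eq_0_iff[of \<mu> i] part_eq_0_iff[of \<nu> i] by auto
  ultimately show ?thesis
    by (metis ext not_le)
qed

lemma shifted_surj:
  assumes "finite S" "card S = n"
  obtains \<mu> where "\<mu> \<in> partitions" "part_length \<mu> \<le> n" "shifted n \<mu> ` {..<n} = S"
proof -
  define xs where "xs = rev (sorted_list_of_set S)"
  have xs: "length xs = n" "set xs = S" "distinct xs" "sorted (rev xs)"
    using assms by (auto simp: xs_def)
  have dec: "xs ! j < xs ! i" if "i < j" "j < n" for i j
    using that xs nth_eq_iff_index_eq[OF xs(3), of i j] sorted_rev_nth_mono[OF xs(4), of i j]
    by (auto simp: le_less)
  have dec': "xs ! j + (j - i) \<le> xs ! i" if "i \<le> j" "j < n" for i j
    using that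
  proof (induction j rule: dec_induct)
    case (step j)
    then show ?case using dec[of j "Suc j"] by auto
  qed simp
  define \<mu> where "\<mu> = (\<lambda>i. if i < n then xs ! i - (n - 1 - i) else 0)"
  \<comment> \<open>At least n - 1 - i smaller values follow \<open>xs ! i\<close>, so the truncated
    subtraction in \<open>\<mu>\<close> loses nothing.\<close>
  have ge: "n - 1 - i \<le> xs ! i" if "i < n" for i
  proof -
    have "xs ! (n - 1) + (n - 1 - i) \<le> xs ! i"
      using dec'[of i "n - 1"] that by linarith
    then show ?thesis by linarith
  qed
  have "\<mu> j \<le> \<mu> i" if "i \<le> j" for i j
    using that dec'[of i j] ge[of i] ge[of j] by (auto simp: \<mu>_def)
  moreover have "finite {i. \<mu> i \<noteq> 0}"
    by (rule finite_subset[of _ "{..<n}"]) (auto simp: \<mu>_def)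
  ultimately have \<mu>: "\<mu> \<in> partitions"
    by (auto simp: partitions_def antimono_def)
  moreover have "part_length \<mu> \<le> n"
    using \<mu> by (simp add: part_length_le_iff) (simp add: \<mu>_def)
  moreover have "shifted n \<mu> i = xs ! i" if "i < n" for i
    using ge[OF that] that by (simp add: shifted_def \<mu>_def)
  then have "shifted n \<mu> ` {..<n} = S"
    using xs by (auto simp: image_def in_set_conv_nth set_eq_iff[of S])
  ultimately show thesis by (rule that)
qed

lemma det_permuted_rows:
  assumes "p permutes {0..<n}"
  shows "det (mat n n (\<lambda>(i, k). f (p i) k)) = signof p * det (mat n n (\<lambda>(i, k). f i k :: 'a :: comm_ring_1))"
proof -
  have "mat n n (\<lambda>(i, k). f (p i) k) = mat n n (\<lambda>(i, j). mat n n (\<lambda>(i, k). f i k) $$ (p i, j))"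
    using permutes_in_image[OF assms] by (intro eq_matI) auto
  then show ?thesis
    using det_permute_rows[of "mat n n (\<lambda>(i, k). f i k)" n p] assms by simp
qed

text \<open>Expanding the rows gives a sum over all maps f from row indices to columns of A. A map
  that is not injective repeats a row of B; an injective one factors uniquely as a decreasing
  enumeration \<open>shifted n \<mu>\<close> after a permutation p, and the sum over p rebuilds the
  minor of A.\<close>

theorem cauchy_binet:
  fixes A B :: "nat \<Rightarrow> nat \<Rightarrow> 'a :: comm_ring_1"
  shows "det (mat n n (\<lambda>(i, k). \<Sum>m<M. A i m * B m k)) =
    (\<Sum>\<mu> | \<mu> \<in> partitions \<and> part_length \<mu> \<le> n \<and> shifted n \<mu> ` {..<n} \<subseteq> {..<M}.
       det (mat n n (\<lambda>(i, k). A i (shifted n \<mu> k))) * det (mat n n (\<lambda>(i, k). B (shifted n \<mu> i) k)))"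
proof -
  let ?P = "{\<mu>. \<mu> \<in> partitions \<and> part_length \<mu> \<le> n \<and> shifted n \<mu> ` {..<n} \<subseteq> {..<M}}"
  let ?E = "{0..<n} \<rightarrow>\<^sub>E {..<M}"
  let ?T = "{p. p permutes {0..<n}}"
  let ?D = "\<lambda>f. det (mat n n (\<lambda>(i, k). B (f i) k))"
  let ?F = "\<lambda>f. (\<Prod>i = 0..<n. A i (f i)) * ?D f"
  have expand: "det (mat n n (\<lambda>(i, k). h i k)) = (\<Sum>p\<in>?T. signof p * (\<Prod>i = 0..<n. h i (p i)))"
    for h :: "nat \<Rightarrow> nat \<Rightarrow> 'a"
    unfolding det_def'[OF mat_carrier]
    by (intro sum.cong refl arg_cong2[where f = "(*)"] prod.cong) (auto simp: permutes_in_image)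
  have "det (mat n n (\<lambda>(i, k). \<Sum>m<M. A i m * B m k)) =
      (\<Sum>p\<in>?T. signof p * (\<Sum>f\<in>?E. \<Prod>i = 0..<n. A i (f i) * B (f i) (p i)))"
    by (simp only: expand) (simp add: prod_sum_PiE)
  also have "\<dots> = (\<Sum>f\<in>?E. ?F f)"
    unfolding expand sum_distrib_left
    by (subst sum.swap) (simp add: prod.distrib mult.left_commute)
  also have "\<dots> = (\<Sum>f\<in>{f\<in>?E. inj_on f {0..<n}}. ?F f)"
  proof (intro sum.mono_neutral_right ballI)
    fix f assume "f \<in> ?E - {f\<in>?E. inj_on f {0..<n}}"
    then obtain i j where "i < n" "j < n" "i \<noteq> j" "f i = f j"
      by (auto simp: inj_on_def)
    then have "?D f = 0"
      by (intro det_identical_rows[of _ n i j]) (auto intro!: eq_vecI)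
    then show "?F f = 0" by simp
  qed (auto intro: finite_PiE)
  also have "\<dots> = (\<Sum>(\<mu>, p)\<in>?P \<times> ?T. ?F (\<lambda>i. shifted n \<mu> (p i)))"
  proof (rule sum.reindex_cong[of "\<lambda>(\<mu>, p). restrict (\<lambda>i. shifted n \<mu> (p i)) {0..<n}"])
    have im: "(\<lambda>i. shifted n \<mu> (p i)) ` {0..<n} = shifted n \<mu> ` {..<n}" if "p permutes {0..<n}" for \<mu> p
      using permutes_image[OF that] by (metis image_image lessThan_atLeast0)
    show "inj_on (\<lambda>(\<mu>, p). restrict (\<lambda>i. shifted n \<mu> (p i)) {0..<n}) (?P \<times> ?T)"
    proof (rule inj_onI, clarify)
      fix \<mu> \<nu> p p'
      assume *: "restrict (\<lambda>i. shifted n \<mu> (p i)) {0..<n} = restrict (\<lambda>i. shifted n \<nu> (p' i)) {0..<n}"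
        and \<mu>: "\<mu> \<in> partitions" "part_length \<mu> \<le> n" and \<nu>: "\<nu> \<in> partitions" "part_length \<nu> \<le> n"
        and p: "p permutes {0..<n}" "p' permutes {0..<n}"
      have **: "shifted n \<mu> (p i) = shifted n \<nu> (p' i)" if "i < n" for i
        using fun_cong[OF *, of i] that by simp
      then have "shifted n \<mu> ` {..<n} = shifted n \<nu> ` {..<n}"
        unfolding im[OF p(1), of \<mu>, symmetric] im[OF p(2), of \<nu>, symmetric]
        by (intro image_cong) auto
      then have "\<mu> = \<nu>" using shifted_image_inj \<mu> \<nu> by blast
      moreover have "p i = p' i" for i
      proof (cases "i < n")
        case True
        then show ?thesis
          using ** \<open>\<mu> = \<nu>\<close> inj_onD[OF shifted_inj[OF \<nu>(1), of n], of "p i" "p' i"]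
            permutes_in_image[OF p(1), of i] permutes_in_image[OF p(2), of i] by auto
      next
        case False
        then show ?thesis using p by (auto simp: permutes_def)
      qed
      ultimately show "\<mu> = \<nu> \<and> p = p'" by blast
    qed
    show "{f\<in>?E. inj_on f {0..<n}} = (\<lambda>(\<mu>, p). restrict (\<lambda>i. shifted n \<mu> (p i)) {0..<n}) ` (?P \<times> ?T)"
    proof (intro equalityI subsetI)
      fix f assume f: "f \<in> {f\<in>?E. inj_on f {0..<n}}"
      then have "card (f ` {0..<n}) = n" by (auto simp: card_image)
      then obtain \<mu> where \<mu>: "\<mu> \<in> partitions" "part_length \<mu> \<le> n" "shifted n \<mu> ` {..<n} = f ` {0..<n}"
        by (rule shifted_surj[rotated]) auto
      \<comment> \<open>The permutation that sorts f; outside the index range it has to be the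
        identity.\<close>
      define p where "p = (\<lambda>i. if i \<in> {0..<n} then inv_into {0..<n} (shifted n \<mu>) (f i) else i)"
      have bb: "bij_betw (shifted n \<mu>) {0..<n} (f ` {0..<n})"
        using \<mu>(3) shifted_inj[OF \<mu>(1), of n] by (simp add: bij_betw_def lessThan_atLeast0)
      have "bij_betw f {0..<n} (f ` {0..<n})"
        using f by (auto simp: bij_betw_def)
      then have "bij_betw (inv_into {0..<n} (shifted n \<mu>) \<circ> f) {0..<n} {0..<n}"
        using bij_betw_inv_into[OF bb] by (rule bij_betw_trans)
      then have "bij_betw p {0..<n} {0..<n}"
        by (rule bij_betw_cong[THEN iffD1, rotated]) (simp add: p_def)
      then have p: "p permutes {0..<n}"
        by (rule bij_imp_permutes) (simp add: p_def)
      have "shifted n \<mu> (p i) = f i" if "i < n" for i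
        using that bij_betw_inv_into_right[OF bb, of "f i"] by (simp add: p_def)
      then have "f = restrict (\<lambda>i. shifted n \<mu> (p i)) {0..<n}"
        using f by (auto simp: fun_eq_iff PiE_def extensional_def restrict_def)
      moreover have "\<mu> \<in> ?P" using \<mu> f by auto
      ultimately show "f \<in> (\<lambda>(\<mu>, p). restrict (\<lambda>i. shifted n \<mu> (p i)) {0..<n}) ` (?P \<times> ?T)"
        using p by (intro image_eqI[of _ _ "(\<mu>, p)"]) auto
    next
      fix f assume "f \<in> (\<lambda>(\<mu>, p). restrict (\<lambda>i. shifted n \<mu> (p i)) {0..<n}) ` (?P \<times> ?T)"
      then obtain \<mu> p where \<mu>: "\<mu> \<in> ?P" and p: "p permutes {0..<n}"
        and f: "f = restrict (\<lambda>i. shifted n \<mu> (p i)) {0..<n}"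
        by auto
      have "inj_on (shifted n \<mu> \<circ> p) {0..<n}"
        using shifted_inj[of \<mu> n] \<mu> permutes_image[OF p] permutes_inj_on[OF p]
        by (intro comp_inj_on) (auto simp: lessThan_atLeast0)
      moreover have "shifted n \<mu> (p i) < M" if "i < n" for i
      proof -
        have "shifted n \<mu> (p i) \<in> (\<lambda>i. shifted n \<mu> (p i)) ` {0..<n}"
          using that by auto
        then show ?thesis using \<mu> unfolding im[OF p] by auto
      qed
      ultimately show "f \<in> {f\<in>?E. inj_on f {0..<n}}"
        by (auto simp: f inj_on_def)
    qed
    fix x assume "x \<in> ?P \<times> ?T"
    then show "?F ((\<lambda>(\<mu>, p). restrict (\<lambda>i. shifted n \<mu> (p i)) {0..<n}) x) =
        (case x of (\<mu>, p) \<Rightarrow> ?F (\<lambda>i. shifted n \<mu> (p i)))"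
      by (auto intro!: arg_cong2[where f = "(*)"] prod.cong arg_cong[where f = det] eq_matI split: prod.splits)
  qed
  also have "\<dots> = (\<Sum>\<mu>\<in>?P. \<Sum>p\<in>?T. ?F (\<lambda>i. shifted n \<mu> (p i)))"
    by (rule sum.cartesian_product[symmetric])
  also have "\<dots> = (\<Sum>\<mu>\<in>?P. det (mat n n (\<lambda>(i, k). A i (shifted n \<mu> k))) * ?D (shifted n \<mu>))"
    by (intro sum.cong refl) (simp add: expand[of "\<lambda>i k. A i (shifted n _ k)"] sum_distrib_right sum_distrib_left
      det_permuted_rows[where f = "\<lambda>i k. B (shifted n _ i) k"] mult_ac)
  finally show ?thesis .
qed

subsection \<open>Homomorphisms out of the algebra of symmetric functions\<close>

lemma lookup_times_splittings:
  fixes P Q :: mpoly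
  shows "Poly_Mapping.lookup (P * Q) m =
    (\<Sum>(a, b)\<in>{(a, b). a + b = m}. Poly_Mapping.lookup P a * Poly_Mapping.lookup Q b)"
proof -
  have "Poly_Mapping.lookup (P * Q) m =
      (\<Sum>(a, b). Poly_Mapping.lookup P a * Poly_Mapping.lookup Q b when m = a + b)"
    by (simp add: times_poly_mapping.rep_eq prod_fun_unfold_prod)
  also have "\<dots> = (\<Sum>(a, b)\<in>{(a, b). a + b = m}. Poly_Mapping.lookup P a * Poly_Mapping.lookup Q b when m = a + b)"
    by (rule Sum_any.expand_superset) (auto simp: finite_splittings)
  also have "\<dots> = (\<Sum>(a, b)\<in>{(a, b). a + b = m}. Poly_Mapping.lookup P a * Poly_Mapping.lookup Q b)"
    by (rule sum.cong) auto
  finally show ?thesis .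
qed

lemma keys_add_monom: "Poly_Mapping.keys (a + b :: monom) = Poly_Mapping.keys a \<union> Poly_Mapping.keys b"
  by (auto simp: in_keys_iff lookup_add)

lemma sym_coeff_times:
  "sym_coeff (F * G) m = (\<Sum>(a, b)\<in>{(a, b). a + b = m}. sym_coeff F a * sym_coeff G b)"
  by (simp add: times_symfun.rep_eq)

lemma sym_coeff_add: "sym_coeff (F + G) m = sym_coeff F m + sym_coeff G m"
  by (simp add: plus_symfun.rep_eq)

lemma sym_coeff_diff: "sym_coeff (F - G) m = sym_coeff F m - sym_coeff G m"
  by (simp add: minus_symfun.rep_eq)

lemma sym_coeff_scale: "sym_coeff (sym_scale c F) m = c * sym_coeff F m"
  by (simp add: sym_scale.rep_eq)

lemma sym_coeff_zero [simp]: "sym_coeff 0 m = 0"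
  by (simp add: zero_symfun.rep_eq)

lemma sym_coeff_sum: "sym_coeff (sum f A) m = (\<Sum>x\<in>A. sym_coeff (f x) m)"
  by (induction A rule: infinite_finite_induct) (simp_all add: sym_coeff_add)

lemma sym_scale_mult: "sym_scale c F * G = sym_scale c (F * G)"
  by (rule symfun_eqI) (simp add: sym_coeff_times sym_coeff_scale sum_distrib_left case_prod_unfold mult.assoc)

lemma sym_scale_mult_right: "F * sym_scale c G = sym_scale c (F * G)"
  using sym_scale_mult[of c G F] by (simp add: mult.commute)

lemma lookup_restrict:
  "Poly_Mapping.lookup (sym_restrict N F) m = (if Poly_Mapping.keys m \<subseteq> {..<N} then sym_coeff F m else 0)"
  by (simp add: sym_restrict.rep_eq)

interpretation restrict_hom: comm_ring_hom "sym_restrict N"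
proof
  fix F G :: symfun
  show "sym_restrict N (F + G) = sym_restrict N F + sym_restrict N G"
    by (rule poly_mapping_eqI) (simp add: lookup_restrict lookup_add sym_coeff_add)
  show "sym_restrict N (F * G) = sym_restrict N F * sym_restrict N G"
  proof (rule poly_mapping_eqI)
    fix m
    show "Poly_Mapping.lookup (sym_restrict N (F * G)) m = Poly_Mapping.lookup (sym_restrict N F * sym_restrict N G) m"
    proof (cases "Poly_Mapping.keys m \<subseteq> {..<N}")
      case True
      then show ?thesis
        unfolding lookup_times_splittings lookup_restrict sym_coeff_times
        by (auto simp: keys_add_monom intro!: sum.cong)
    next
      case False
      then have "(\<Sum>(a, b)\<in>{(a, b). a + b = m}. Poly_Mapping.lookup (sym_restrict N F) a *
          Poly_Mapping.lookup (sym_restrict N G) b) = 0"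
        by (intro sum.neutral) (auto simp: keys_add_monom lookup_restrict)
      then show ?thesis
        using False unfolding lookup_times_splittings by (simp add: lookup_restrict)
    qed
  qed
  show "sym_restrict N 1 = 1"
    by (rule poly_mapping_eqI) (auto simp: lookup_restrict one_symfun.rep_eq lookup_one when_def)
qed (rule poly_mapping_eqI, simp add: lookup_restrict)

interpretation mconst_hom: comm_ring_hom mconst
  by unfold_locales (simp_all add: mconst_def single_add mult_single)

lemma restrict_scale: "sym_restrict N (sym_scale c F) = mconst c * sym_restrict N F"
proof (rule poly_mapping_eqI)
  fix m
  have "Poly_Mapping.lookup (mconst c * sym_restrict N F) m =
      (\<Sum>(a, b)\<in>{(a, b). a + b = m}. (if a = 0 then 1 else 0) * (c * Poly_Mapping.lookup (sym_restrict N F) b))"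
    unfolding lookup_times_splittings mconst_def lookup_single
    by (intro sum.cong) (auto simp: when_def)
  also have "\<dots> = c * Poly_Mapping.lookup (sym_restrict N F) m"
    by (rule conv_one)
  finally show "Poly_Mapping.lookup (sym_restrict N (sym_scale c F)) m = Poly_Mapping.lookup (mconst c * sym_restrict N F) m"
    by (simp add: lookup_restrict sym_coeff_scale)
qed

definition mon_eval :: "(nat \<Rightarrow> complex) \<Rightarrow> monom \<Rightarrow> complex" where
  "mon_eval z m = (\<Prod>i\<in>Poly_Mapping.keys m. z i ^ Poly_Mapping.lookup m i)"

definition poly_eval :: "(nat \<Rightarrow> complex) \<Rightarrow> mpoly \<Rightarrow> complex" where
  "poly_eval z P = (\<Sum>m\<in>Poly_Mapping.keys P. Poly_Mapping.lookup P m * mon_eval z m)"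

lemma mon_eval_superset:
  "finite A \<Longrightarrow> Poly_Mapping.keys m \<subseteq> A \<Longrightarrow> mon_eval z m = (\<Prod>i\<in>A. z i ^ Poly_Mapping.lookup m i)"
  unfolding mon_eval_def by (intro prod.mono_neutral_left) (auto simp: in_keys_iff)

lemma mon_eval_add: "mon_eval z (a + b) = mon_eval z a * mon_eval z b"
proof -
  let ?A = "Poly_Mapping.keys a \<union> Poly_Mapping.keys b"
  have "mon_eval z (a + b) = (\<Prod>i\<in>?A. z i ^ Poly_Mapping.lookup (a + b) i)"
    by (rule mon_eval_superset) (auto simp: keys_add_monom)
  moreover have "mon_eval z a = (\<Prod>i\<in>?A. z i ^ Poly_Mapping.lookup a i)"
    "mon_eval z b = (\<Prod>i\<in>?A. z i ^ Poly_Mapping.lookup b i)"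
    by (rule mon_eval_superset; simp)+
  ultimately show ?thesis
    by (simp add: lookup_add power_add prod.distrib)
qed

lemma poly_eval_superset:
  "finite A \<Longrightarrow> Poly_Mapping.keys P \<subseteq> A \<Longrightarrow> poly_eval z P = (\<Sum>m\<in>A. Poly_Mapping.lookup P m * mon_eval z m)"
  unfolding poly_eval_def by (intro sum.mono_neutral_left) (auto simp: in_keys_iff)

lemma poly_eval_single: "poly_eval z (Poly_Mapping.single m c) = c * mon_eval z m"
  by (subst poly_eval_superset[of "{m}"]) (auto simp: lookup_single)

lemma poly_eval_mvar [simp]: "poly_eval z (mvar i) = z i"
  by (simp add: mvar_def poly_eval_single mon_eval_def)

lemma poly_eval_mconst [simp]: "poly_eval z (mconst c) = c"
  by (simp add: mconst_def poly_eval_single mon_eval_def)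

interpretation eval_hom: comm_ring_hom "poly_eval z"
proof
  fix P Q :: mpoly
  show "poly_eval z (P + Q) = poly_eval z P + poly_eval z Q"
  proof -
    let ?A = "Poly_Mapping.keys P \<union> Poly_Mapping.keys Q"
    have "poly_eval z (P + Q) = (\<Sum>m\<in>?A. Poly_Mapping.lookup (P + Q) m * mon_eval z m)"
      using Poly_Mapping.keys_add[of P Q] by (intro poly_eval_superset) auto
    moreover have "poly_eval z P = (\<Sum>m\<in>?A. Poly_Mapping.lookup P m * mon_eval z m)"
      "poly_eval z Q = (\<Sum>m\<in>?A. Poly_Mapping.lookup Q m * mon_eval z m)"
      by (rule poly_eval_superset; simp)+
    ultimately show ?thesis
      by (simp add: lookup_add distrib_right sum.distrib)
  qed
  show "poly_eval z (P * Q) = poly_eval z P * poly_eval z Q"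
  proof -
    let ?S = "Poly_Mapping.keys P \<times> Poly_Mapping.keys Q"
    let ?g = "\<lambda>(a, b). a + b :: monom"
    have "poly_eval z (P * Q) = (\<Sum>m\<in>?g ` ?S. Poly_Mapping.lookup (P * Q) m * mon_eval z m)"
      using Poly_Mapping.keys_mult[of P Q] by (intro poly_eval_superset) auto
    also have "\<dots> = (\<Sum>m\<in>?g ` ?S. \<Sum>x\<in>{x \<in> ?S. ?g x = m}.
        Poly_Mapping.lookup P (fst x) * Poly_Mapping.lookup Q (snd x) * mon_eval z m)"
      unfolding lookup_times_splittings sum_distrib_right[symmetric] case_prod_unfold
      by (intro sum.cong refl arg_cong2[where f = "(*)"] sum.mono_neutral_right)
        (auto simp: in_keys_iff finite_splittings[unfolded case_prod_unfold])
    also have "\<dots> = (\<Sum>m\<in>?g ` ?S. \<Sum>x\<in>{x \<in> ?S. ?g x = m}.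
        Poly_Mapping.lookup P (fst x) * mon_eval z (fst x) * (Poly_Mapping.lookup Q (snd x) * mon_eval z (snd x)))"
      by (intro sum.cong refl) (auto simp: mon_eval_add)
    also have "\<dots> = (\<Sum>x\<in>?S. Poly_Mapping.lookup P (fst x) * mon_eval z (fst x) *
        (Poly_Mapping.lookup Q (snd x) * mon_eval z (snd x)))"
      by (rule sum.image_gen[symmetric]) simp
    also have "\<dots> = poly_eval z P * poly_eval z Q"
      by (simp add: poly_eval_def sum_product sum.cartesian_product case_prod_unfold)
    finally show ?thesis .
  qed
  show "poly_eval z 1 = 1"
    using poly_eval_mconst[of z 1] by (simp add: mconst_def)
qed (simp add: poly_eval_def)

definition sym_eval :: "nat \<Rightarrow> (nat \<Rightarrow> complex) \<Rightarrow> symfun \<Rightarrow> complex" where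
  "sym_eval N z F = poly_eval z (sym_restrict N F)"

interpretation sym_eval_hom: comm_ring_hom "sym_eval N z"
  by unfold_locales (simp_all add: sym_eval_def restrict_hom.hom_add restrict_hom.hom_mult
    eval_hom.hom_add eval_hom.hom_mult)

lemma sym_eval_scale: "sym_eval N z (sym_scale c F) = c * sym_eval N z F"
  by (simp add: sym_eval_def restrict_scale eval_hom.hom_mult)

subsection \<open>Complete homogeneous symmetric functions\<close>

lemma mon_deg_map_key:
  assumes "bij \<pi>"
  shows "mon_deg (Poly_Mapping.map_key \<pi> m) = mon_deg m"
proof -
  have "inj \<pi>" using assms by (rule bij_is_inj)
  have "mon_deg (Poly_Mapping.map_key \<pi> m) =
      (\<Sum>i\<in>\<pi> -` Poly_Mapping.keys m. Poly_Mapping.lookup m (\<pi> i))"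
    unfolding mon_deg_def by (simp add: keys_map_key \<open>inj \<pi>\<close> lookup_map_key)
  also have "\<dots> = (\<Sum>i\<in>\<pi> ` (\<pi> -` Poly_Mapping.keys m). Poly_Mapping.lookup m i)"
    by (subst sum.reindex) (auto intro: inj_on_subset[OF \<open>inj \<pi>\<close>])
  also have "\<pi> ` (\<pi> -` Poly_Mapping.keys m) = Poly_Mapping.keys m"
    using assms by (simp add: bij_is_surj surj_image_vimage_eq)
  finally show ?thesis by (simp add: mon_deg_def)
qed

lift_definition hsym :: "nat \<Rightarrow> symfun" is "\<lambda>r m. if mon_deg m = r then 1 else 0"
  by (auto simp: mon_deg_map_key)

lemma mon_deg_0_iff: "mon_deg m = 0 \<longleftrightarrow> m = 0"
proof
  assume "mon_deg m = 0"
  then show "m = 0"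
    using lookup_le_mon_deg[of m] by (intro poly_mapping_eqI) simp
qed simp

lemma hsym_0 [simp]: "hsym 0 = 1"
  by (rule symfun_eqI) (simp add: hsym.rep_eq one_symfun.rep_eq mon_deg_0_iff)

lemma mon_deg_single [simp]: "mon_deg (Poly_Mapping.single i k) = k"
  by (cases "k = 0") (auto simp: mon_deg_def)

lemma lookup_mvar_times:
  "Poly_Mapping.lookup (mvar N * P) m =
    (if Poly_Mapping.lookup m N = 0 then 0 else Poly_Mapping.lookup P (m - Poly_Mapping.single N 1))"
proof -
  let ?e = "Poly_Mapping.single N 1 :: monom"
  have eq: "?e + (m - ?e) = m" if "Poly_Mapping.lookup m N \<noteq> 0"
    using that by (intro poly_mapping_eqI) (auto simp: lookup_add lookup_minus lookup_single when_def)
  have "Poly_Mapping.lookup (mvar N * P) m =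
      (\<Sum>x\<in>{(a, b). a + b = m}. if fst x = ?e then Poly_Mapping.lookup P (snd x) else 0)"
    unfolding lookup_times_splittings mvar_def lookup_single
    by (intro sum.cong) (auto simp: when_def)
  also have "\<dots> = (\<Sum>x\<in>(if Poly_Mapping.lookup m N = 0 then {} else {(?e, m - ?e)}).
      if fst x = ?e then Poly_Mapping.lookup P (snd x) else 0)"
    by (intro sum.mono_neutral_right)
      (auto simp: finite_splittings eq[simplified] lookup_add split: if_splits)
  also have "\<dots> = (if Poly_Mapping.lookup m N = 0 then 0 else Poly_Mapping.lookup P (m - ?e))"
    by auto
  finally show ?thesis .
qed

lemma restrict_hsym_0: "sym_restrict 0 (hsym r) = (if r = 0 then 1 else 0)"
  by (rule poly_mapping_eqI) (auto simp: lookup_restrict hsym.rep_eq lookup_one when_def)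

text \<open>Monomials that contain x_N are x_N times a monomial of one degree less. For generating
  series: multiplication by 1 - x_N X removes the variable x_N.\<close>

lemma restrict_hsym_Suc:
  "sym_restrict (Suc N) (hsym (Suc r)) - mvar N * sym_restrict (Suc N) (hsym r) = sym_restrict N (hsym (Suc r))"
proof (rule poly_mapping_eqI)
  fix m :: monom
  let ?e = "Poly_Mapping.single N 1 :: monom"
  show "Poly_Mapping.lookup (sym_restrict (Suc N) (hsym (Suc r)) - mvar N * sym_restrict (Suc N) (hsym r)) m =
      Poly_Mapping.lookup (sym_restrict N (hsym (Suc r))) m"
  proof (cases "Poly_Mapping.lookup m N = 0")
    case True
    then have "N \<notin> Poly_Mapping.keys m"
      by (simp add: in_keys_iff)
    then have "Poly_Mapping.keys m \<subseteq> {..<Suc N} \<longleftrightarrow> Poly_Mapping.keys m \<subseteq> {..<N}"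
      unfolding lessThan_Suc by blast
    then show ?thesis
      using True by (simp add: lookup_minus lookup_mvar_times lookup_restrict)
  next
    case False
    then have m: "?e + (m - ?e) = m"
      by (intro poly_mapping_eqI) (auto simp: lookup_add lookup_minus lookup_single when_def)
    have deg: "mon_deg m = Suc (mon_deg (m - ?e))"
      by (subst m[symmetric], subst mon_deg_add) simp
    have keys: "Poly_Mapping.keys m = insert N (Poly_Mapping.keys (m - ?e))"
      by (subst m[symmetric], subst keys_add_monom) simp
    show ?thesis
      using False by (auto simp: lookup_minus lookup_mvar_times lookup_restrict hsym.rep_eq deg keys)
  qed
qed

lemma hser_0 [simp]: "hser 0 x = 1"
  by (simp add: hser_def)

lemma hser_Suc: "hser (Suc N) x = hser N x * geo (x N)"
  by (simp add: hser_def)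

lemma restrict_hsym: "sym_restrict N (hsym r) = fps_nth (hser N mvar) r"
proof -
  have "Abs_fps (\<lambda>r. sym_restrict N (hsym r)) = hser N mvar"
  proof (induction N)
    case 0
    show ?case by (rule fps_ext) (simp add: restrict_hsym_0)
  next
    case (Suc N)
    let ?l = "1 - fps_const (mvar N) * fps_X"
    have "?l * Abs_fps (\<lambda>r. sym_restrict (Suc N) (hsym r)) = Abs_fps (\<lambda>r. sym_restrict N (hsym r))"
    proof (rule fps_ext)
      fix n
      show "fps_nth (?l * Abs_fps (\<lambda>r. sym_restrict (Suc N) (hsym r))) n =
          fps_nth (Abs_fps (\<lambda>r. sym_restrict N (hsym r))) n"
        unfolding lin_nth by (cases n) (simp_all add: restrict_hsym_Suc)
    qed
    then have "geo (mvar N) * (?l * Abs_fps (\<lambda>r. sym_restrict (Suc N) (hsym r))) = geo (mvar N) * hser N mvar"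
      using Suc by simp
    then show ?case
      using lin_geo[of "mvar N"] by (simp only: hser_Suc mult.assoc[symmetric] mult.commute[of "geo _"] mult_1_left)
  qed
  then show ?thesis
    by (metis fps_nth_Abs_fps)
qed

lemma (in comm_ring_hom) hom_hser_nth: "hom (fps_nth (hser N x) r) = fps_nth (hser N (\<lambda>i. hom (x i))) r"
  by (induction N arbitrary: r) (simp_all add: hser_Suc fps_mult_nth hom_sum hom_mult hom_power geo_def)

lemma lin_prod_Suc: "lin_prod (Suc m) c = (1 - fps_const (c m) * fps_X) * lin_prod m c"
  by (simp add: lin_prod_def mult.commute)

lemma (in comm_ring_hom) hom_lin_prod_nth:
  "hom (fps_nth (lin_prod m c) r) = fps_nth (lin_prod m (\<lambda>i. hom (c i))) r"
  by (induction m arbitrary: r) (simp_all add: lin_prod_Suc lin_nth hom_minus hom_mult, simp_all add: lin_prod_def)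

lemma sym_eval_hsym: "sym_eval N z (hsym r) = fps_nth (hser N z) r"
  by (simp add: sym_eval_def restrict_hsym eval_hom.hom_hser_nth)

subsection \<open>The degree filtration\<close>

text \<open>The index is an integer, so that a degree lower than that of the empty partition makes
  sense and forces the function to vanish.\<close>

definition sym_filt :: "int \<Rightarrow> symfun set" where
  "sym_filt t = {F. \<forall>m. sym_coeff F m \<noteq> 0 \<longrightarrow> int (mon_deg m) \<le> t}"

lemma sym_filt_nat: "sym_filt (int d) = sym_deg_le d"
  by (simp add: sym_filt_def sym_deg_le_def)

lemma sym_filt_mono: "s \<le> t \<Longrightarrow> sym_filt s \<subseteq> sym_filt t"
  by (auto simp: sym_filt_def)

lemma sym_filt_neg: "t < 0 \<Longrightarrow> sym_filt t = {0}"
  by (auto simp: sym_filt_def intro!: symfun_eqI)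

lemma zero_in_sym_filt [simp]: "0 \<in> sym_filt t"
  by (simp add: sym_filt_def)

lemma one_in_sym_filt [simp]: "1 \<in> sym_filt 0"
  by (auto simp: sym_filt_def one_symfun.rep_eq)

lemma sym_filt_add: "F \<in> sym_filt t \<Longrightarrow> G \<in> sym_filt t \<Longrightarrow> F + G \<in> sym_filt t"
  by (auto simp: sym_filt_def sym_coeff_add) (metis add_0)

lemma sym_filt_diff: "F \<in> sym_filt t \<Longrightarrow> G \<in> sym_filt t \<Longrightarrow> F - G \<in> sym_filt t"
  by (auto simp: sym_filt_def sym_coeff_diff) (metis diff_0_right)

lemma sym_filt_uminus: "F \<in> sym_filt t \<Longrightarrow> - F \<in> sym_filt t"
  using sym_filt_diff[of 0 t F] by simp

lemma sym_filt_scale: "F \<in> sym_filt t \<Longrightarrow> sym_scale c F \<in> sym_filt t"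
  by (auto simp: sym_filt_def sym_coeff_scale)

lemma sym_filt_sum: "(\<And>x. x \<in> A \<Longrightarrow> f x \<in> sym_filt t) \<Longrightarrow> sum f A \<in> sym_filt t"
  by (induction A rule: infinite_finite_induct) (auto intro: sym_filt_add)

lemma sym_filt_mult: "F \<in> sym_filt s \<Longrightarrow> G \<in> sym_filt t \<Longrightarrow> F * G \<in> sym_filt (s + t)"
proof -
  assume F: "F \<in> sym_filt s" and G: "G \<in> sym_filt t"
  show ?thesis
    unfolding sym_filt_def
  proof (safe)
    fix m assume "sym_coeff (F * G) m \<noteq> 0"
    then have "(\<Sum>(a, b)\<in>{(a, b). a + b = m}. sym_coeff F a * sym_coeff G b) \<noteq> 0"
      by (simp add: sym_coeff_times)
    then obtain a b where "a + b = m" "sym_coeff F a * sym_coeff G b \<noteq> 0"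
      by (rule sum.not_neutral_contains_not_neutral) auto
    then show "int (mon_deg m) \<le> s + t"
      using F G by (auto simp: sym_filt_def mon_deg_add intro!: add_mono)
  qed
qed

lemma sym_filt_sign: "F \<in> sym_filt t \<Longrightarrow> of_int (sign p) * F \<in> sym_filt t"
  by (cases p rule: sign_cases) (auto intro: sym_filt_uminus)

lemma hsym_in_sym_filt: "hsym r \<in> sym_filt (int r)"
  by (auto simp: sym_filt_def hsym.rep_eq)

lemma sym_filt_prod:
  "finite A \<Longrightarrow> (\<And>x. x \<in> A \<Longrightarrow> f x \<in> sym_filt (d x)) \<Longrightarrow> prod f A \<in> sym_filt (sum d A)"
  by (induction A rule: finite_induct) (auto intro: sym_filt_mult)

text \<open>The difference telescopes one factor at a time. It shows that leading terms of
  determinants depend only on the leading terms of the entries.\<close>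

lemma sym_filt_prod_diff:
  assumes "finite A" "\<And>x. x \<in> A \<Longrightarrow> f x \<in> sym_filt (d x)" "\<And>x. x \<in> A \<Longrightarrow> g x \<in> sym_filt (d x)"
    "\<And>x. x \<in> A \<Longrightarrow> f x - g x \<in> sym_filt (d x - 1)"
  shows "prod f A - prod g A \<in> sym_filt (sum d A - 1)"
  using assms
proof (induction A rule: finite_induct)
  case (insert x A)
  have eq: "prod f (insert x A) - prod g (insert x A) =
      (f x - g x) * prod f A + g x * (prod f A - prod g A)"
    using insert(1,2) by (simp add: algebra_simps)
  have "(f x - g x) * prod f A \<in> sym_filt ((d x - 1) + sum d A)"
    using insert by (intro sym_filt_mult sym_filt_prod) auto
  moreover have "g x * (prod f A - prod g A) \<in> sym_filt (d x + (sum d A - 1))"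
    using insert by (intro sym_filt_mult) auto
  ultimately show ?case
    unfolding eq using insert(1,2) by (intro sym_filt_add) (simp_all add: algebra_simps)
qed simp

subsection \<open>Jacobi--Trudi determinants in the algebra of symmetric functions\<close>

text \<open>\<open>jt_entry\<close> with the polynomial in the nodes replaced by an arbitrary array
  of coefficients. The same formula then covers the interpolation polynomials for finite N, their
  limits and, if only a = 0 contributes, the Schur functions.\<close>

definition jts_entry :: "(int \<Rightarrow> nat \<Rightarrow> complex) \<Rightarrow> (nat \<Rightarrow> nat) \<Rightarrow> nat \<Rightarrow> nat \<Rightarrow> symfun" where
  "jts_entry \<epsilon> \<mu> i k =
     (if i \<le> \<mu> i + k
      then \<Sum>a\<le>\<mu> i + k - i. sym_scale (\<epsilon> (int (\<mu> i) - int i) a) (hsym (\<mu> i + k - i - a)) else 0)"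

definition jts :: "(int \<Rightarrow> nat \<Rightarrow> complex) \<Rightarrow> (nat \<Rightarrow> nat) \<Rightarrow> symfun" where
  "jts \<epsilon> \<mu> = det (mat (part_length \<mu>) (part_length \<mu>) (\<lambda>(i, k). jts_entry \<epsilon> \<mu> i k))"

text \<open>
  The coefficients of the generating series \<open>\<Prod> (1 - c\<^sub>r X)\<close> over the nodes \<open>c\<^sub>0, c\<^sub>1, \<dots>\<close> of index less
  than \<open>t + N - 1\<close>; here \<open>t\<close> is the shifted part \<open>\<mu>\<^sub>i - i\<close>, the form that survives the limit in \<open>N\<close>.
\<close>

definition node_coeff :: "nat \<Rightarrow> (nat \<Rightarrow> complex) \<Rightarrow> int \<Rightarrow> nat \<Rightarrow> complex" where
  "node_coeff N c t a = fps_nth (lin_prod (nat (t + int N - 1)) c) a"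

lemma node_coeff_0 [simp]: "node_coeff N c t 0 = 1"
  by (simp add: node_coeff_def)

lemma jts_eq:
  assumes "\<mu> \<in> partitions" "part_length \<mu> \<le> L" "\<And>t. \<epsilon> t 0 = 1"
  shows "jts \<epsilon> \<mu> = det (mat L L (\<lambda>(i, k). jts_entry \<epsilon> \<mu> i k))"
  unfolding jts_def
  by (rule det_mat_trailing_unit[symmetric])
    (use assms in \<open>auto simp: jts_entry_def part_eq_0_iff[OF assms(1), THEN iffD2]\<close>)

lemma jts_empty [simp]: "jts \<epsilon> empty_part = 1"
  by (simp add: jts_def)

lemma jts_entry_filt: "jts_entry \<epsilon> \<mu> i k \<in> sym_filt (int (\<mu> i) + int k - int i)"
proof (cases "i \<le> \<mu> i + k")
  case True
  then show ?thesis
    unfolding jts_entry_def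
    by (auto intro!: sym_filt_sum sym_filt_scale subsetD[OF sym_filt_mono hsym_in_sym_filt])
qed (simp add: jts_entry_def)

text \<open>The terms with a = 0 cancel, and all others have lower degree.\<close>

lemma jts_entry_diff_filt:
  assumes "\<And>t. \<epsilon> t 0 = 1" "\<And>t. \<epsilon>' t 0 = 1"
  shows "jts_entry \<epsilon> \<mu> i k - jts_entry \<epsilon>' \<mu> i k \<in> sym_filt (int (\<mu> i) + int k - int i - 1)"
proof (cases "i \<le> \<mu> i + k")
  case True
  let ?n = "\<mu> i + k - i"
  have "jts_entry \<epsilon> \<mu> i k - jts_entry \<epsilon>' \<mu> i k =
      (\<Sum>a\<le>?n. sym_scale (\<epsilon> (int (\<mu> i) - int i) a - \<epsilon>' (int (\<mu> i) - int i) a) (hsym (?n - a)))"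
    using True by (simp add: jts_entry_def sum_subtractf[symmetric] sym.scale_left_diff_distrib)
  also have "\<dots> \<in> sym_filt (int (\<mu> i) + int k - int i - 1)"
  proof (intro sym_filt_sum)
    fix a assume "a \<in> {..?n}"
    then show "sym_scale (\<epsilon> (int (\<mu> i) - int i) a - \<epsilon>' (int (\<mu> i) - int i) a) (hsym (?n - a))
        \<in> sym_filt (int (\<mu> i) + int k - int i - 1)"
      using True assms
      by (cases "a = 0") (auto intro!: sym_filt_scale subsetD[OF sym_filt_mono hsym_in_sym_filt])
  qed
  finally show ?thesis .
qed (simp add: jts_entry_def)

text \<open>All terms of the Leibniz expansion of a Jacobi--Trudi determinant have the same degree
  bound, because the shifts p i - i of a permutation cancel.\<close>

lemma sum_perm_shift:
  assumes "p permutes {0..<n}"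
  shows "(\<Sum>i = 0..<n. int (\<mu> i) + int (p i) - int i) = int (\<Sum>i<n. \<mu> i)"
proof -
  have "(\<Sum>i = 0..<n. int (p i)) = (\<Sum>i = 0..<n. int i)"
    using sum.permute[OF assms, of int] by (simp add: o_def)
  then show ?thesis
    by (simp add: sum.distrib sum_subtractf lessThan_atLeast0)
qed

lemma jts_filt:
  assumes "\<mu> \<in> partitions"
  shows "jts \<epsilon> \<mu> \<in> sym_filt (int (part_size \<mu>))"
proof -
  let ?n = "part_length \<mu>"
  have "of_int (sign p) * (\<Prod>i = 0..<?n. mat ?n ?n (\<lambda>(i, k). jts_entry \<epsilon> \<mu> i k) $$ (i, p i))
      \<in> sym_filt (int (part_size \<mu>))" if p: "p permutes {0..<?n}" for p
  proof (rule sym_filt_sign)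
    have "(\<Prod>i = 0..<?n. mat ?n ?n (\<lambda>(i, k). jts_entry \<epsilon> \<mu> i k) $$ (i, p i)) \<in>
        sym_filt (\<Sum>i = 0..<?n. int (\<mu> i) + int (p i) - int i)"
      using p by (intro sym_filt_prod) (auto simp: permutes_in_image intro: jts_entry_filt)
    then show "(\<Prod>i = 0..<?n. mat ?n ?n (\<lambda>(i, k). jts_entry \<epsilon> \<mu> i k) $$ (i, p i))
      \<in> sym_filt (int (part_size \<mu>))"
      unfolding sum_perm_shift[OF p] part_size_def .
  qed
  then show ?thesis
    unfolding jts_def det_def'[OF mat_carrier] by (intro sym_filt_sum) simp
qed

lemma jts_diff_filt:
  assumes "\<mu> \<in> partitions" "\<And>t. \<epsilon> t 0 = 1" "\<And>t. \<epsilon>' t 0 = 1"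
  shows "jts \<epsilon> \<mu> - jts \<epsilon>' \<mu> \<in> sym_filt (int (part_size \<mu>) - 1)"
proof -
  let ?n = "part_length \<mu>"
  let ?M = "\<lambda>\<epsilon>. mat ?n ?n (\<lambda>(i, k). jts_entry \<epsilon> \<mu> i k)"
  have "of_int (sign p) * ((\<Prod>i = 0..<?n. ?M \<epsilon> $$ (i, p i)) - (\<Prod>i = 0..<?n. ?M \<epsilon>' $$ (i, p i)))
      \<in> sym_filt (int (part_size \<mu>) - 1)" if p: "p permutes {0..<?n}" for p
  proof (rule sym_filt_sign)
    have "(\<Prod>i = 0..<?n. ?M \<epsilon> $$ (i, p i)) - (\<Prod>i = 0..<?n. ?M \<epsilon>' $$ (i, p i)) \<in>
        sym_filt ((\<Sum>i = 0..<?n. int (\<mu> i) + int (p i) - int i) - 1)"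
      using p
      by (intro sym_filt_prod_diff)
        (auto simp: permutes_in_image intro: jts_entry_filt jts_entry_diff_filt assms)
    then show "(\<Prod>i = 0..<?n. ?M \<epsilon> $$ (i, p i)) - (\<Prod>i = 0..<?n. ?M \<epsilon>' $$ (i, p i))
      \<in> sym_filt (int (part_size \<mu>) - 1)"
      unfolding sum_perm_shift[OF p] part_size_def .
  qed
  then show ?thesis
    unfolding jts_def det_def'[OF mat_carrier] sum_subtractf[symmetric] right_diff_distrib[symmetric]
    by (intro sym_filt_sum) simp
qed

lemma (in comm_ring_hom) hom_det_mat: "hom (det (mat n n (\<lambda>(i, k). f i k))) = det (mat n n (\<lambda>(i, k). hom (f i k)))"
proof -
  have "map_mat hom (mat n n (\<lambda>(i, k). f i k)) = mat n n (\<lambda>(i, k). hom (f i k))"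
    by (rule eq_matI) auto
  then show ?thesis by (metis hom_det)
qed

lemma shift_index:
  "i < N \<Longrightarrow> nat (int (\<mu> i) - int i + int N - 1) = \<mu> i + N - 1 - i"
  by auto

lemma restrict_jts:
  assumes "\<mu> \<in> partitions" "part_length \<mu> \<le> N"
  shows "sym_restrict N (jts (node_coeff N c) \<mu>) =
    det (mat N N (\<lambda>(i, k). jt_entry N \<mu> (\<lambda>r. mconst (c r)) mvar i k))"
proof -
  have "sym_restrict N (jts_entry (node_coeff N c) \<mu> i k) = jt_entry N \<mu> (\<lambda>r. mconst (c r)) mvar i k"
    if "i < N" for i k
    unfolding jts_entry_def jt_entry_def node_coeff_def shift_index[of _ _ \<mu>, OF that]
    by (simp add: restrict_hom.hom_sum restrict_scale restrict_hsym mconst_hom.hom_lin_prod_nth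
        fps_mult_nth atLeast0AtMost)
  then show ?thesis
    by (subst jts_eq[OF assms]) (auto simp: restrict_hom.hom_det_mat intro!: arg_cong[where f = det] eq_matI)
qed

lemma vandermonde_eq: "vandermonde N = vdm N mvar"
  by (simp add: vandermonde_def vdm_def)

lemma mvar_neq: "i \<noteq> j \<Longrightarrow> mvar i \<noteq> mvar j"
proof
  assume "i \<noteq> j" "mvar i = mvar j"
  then have "poly_eval (\<lambda>k. if k = i then 1 else 0) (mvar i) = poly_eval (\<lambda>k. if k = i then 1 else 0) (mvar j)"
    by simp
  then show False using \<open>i \<noteq> j\<close> by simp
qed

lemma vandermonde_nonzero: "vandermonde N \<noteq> 0"
  unfolding vandermonde_def using mvar_neq by auto

text \<open>The quotient exists by \<open>det_alternant\<close> over the ring of polynomials, and it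
  is unique because that ring has no zero divisors.\<close>

lemma fact_schur_eq:
  assumes "\<mu> \<in> partitions" "part_length \<mu> \<le> N"
  shows "fact_schur N \<mu> c = sym_restrict N (jts (node_coeff N c) \<mu>)"
proof -
  have *: "sym_restrict N (jts (node_coeff N c) \<mu>) * vandermonde N =
      det (mat N N (\<lambda>(i, j). \<Prod>k<\<mu> i + N - 1 - i. mvar j - mconst (c k)))"
    unfolding restrict_jts[OF assms] vandermonde_eq by (rule det_alternant[symmetric])
  show ?thesis
    unfolding fact_schur_def
  proof (rule the_equality)
    fix P
    assume "P * vandermonde N = det (mat N N (\<lambda>(i, j). \<Prod>k<\<mu> i + N - 1 - i. mvar j - mconst (c k)))"
    then have "P * vandermonde N = sym_restrict N (jts (node_coeff N c) \<mu>) * vandermonde N"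
      using * by simp
    then show "P = sym_restrict N (jts (node_coeff N c) \<mu>)"
      using mult_right_cancel[OF vandermonde_nonzero] by blast
  qed (rule *)
qed

lemma sym_eval_jts_full:
  assumes "\<mu> \<in> partitions" "part_length \<mu> \<le> N"
  shows "sym_eval N z (jts (node_coeff N c) \<mu>) * vdm N z =
    det (mat N N (\<lambda>(i, j). \<Prod>r<\<mu> i + N - 1 - i. z j - c r))"
proof -
  have "poly_eval z (jt_entry N \<mu> (\<lambda>r. mconst (c r)) mvar i k) = jt_entry N \<mu> c z i k" for i k
    by (simp add: jt_entry_def fps_mult_nth eval_hom.hom_sum eval_hom.hom_mult
      eval_hom.hom_lin_prod_nth eval_hom.hom_hser_nth)
  then have "sym_eval N z (jts (node_coeff N c) \<mu>) = det (mat N N (\<lambda>(i, k). jt_entry N \<mu> c z i k))"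
    unfolding sym_eval_def restrict_jts[OF assms] by (simp add: eval_hom.hom_det_mat)
  then show ?thesis by (simp only: det_alternant)
qed

text \<open>
  At a point whose coordinates of index \<open>j \<ge> K\<close> are the nodes \<open>c\<^bsub>N-1-j\<^esub>\<close>, these coordinates cancel
  against the lowest \<open>N - K\<close> nodes, and the value only depends on the nodes of index at least \<open>N - K\<close>.
\<close>

lemma lin_prod_hser_cancel:
  assumes "K \<le> N" "N - K \<le> m" "\<And>j. K \<le> j \<Longrightarrow> j < N \<Longrightarrow> z j = c (N - 1 - j)"
  shows "lin_prod m c * hser N z = lin_prod (m - (N - K)) (\<lambda>r. c (N - K + r)) * hser K z"
proof -
  have uN: "{..<N} = {..<K} \<union> {K..<N}" using assms(1) by auto
  have h: "hser N z = hser K z * (\<Prod>j\<in>{K..<N}. geo (z j))"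
    unfolding hser_def uN by (subst prod.union_disjoint) auto
  have g: "(\<Prod>j\<in>{K..<N}. geo (z j)) = (\<Prod>r<N - K. geo (c r))"
    using assms by (intro prod.reindex_bij_witness[where i = "\<lambda>r. N - 1 - r" and j = "\<lambda>j. N - 1 - j"]) auto
  have l: "lin_prod m c = lin_prod (N - K) c * lin_prod (m - (N - K)) (\<lambda>r. c (N - K + r))"
  proof -
    have um: "{..<m} = {..<N - K} \<union> {N - K..<m}" using assms(2) by auto
    have um': "(\<Prod>r\<in>{N - K..<m}. 1 - fps_const (c r) * fps_X) =
        (\<Prod>r<m - (N - K). 1 - fps_const (c (N - K + r)) * fps_X)"
      using assms(2) by (intro prod.reindex_bij_witness[where i = "\<lambda>r. N - K + r" and j = "\<lambda>j. j - (N - K)"]) auto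
    show ?thesis
      unfolding lin_prod_def um um'[symmetric] by (subst prod.union_disjoint) auto
  qed
  have one: "lin_prod n c * (\<Prod>r<n. geo (c r)) = 1" for n
    unfolding lin_prod_def prod.distrib[symmetric] by (rule prod.neutral) (simp add: lin_geo)
  have "lin_prod m c * hser N z = (lin_prod (N - K) c * (\<Prod>r<N - K. geo (c r))) *
      (lin_prod (m - (N - K)) (\<lambda>r. c (N - K + r)) * hser K z)"
    unfolding h l g by (simp only: mult_ac)
  then show ?thesis
    unfolding one by simp
qed

text \<open>After the cancellation the entries are those for K variables and the nodes from index N
  - K on, so the determinant keeps its size as N grows.\<close>

lemma sym_eval_jts_top:
  assumes \<mu>: "\<mu> \<in> partitions" "part_length \<mu> \<le> K" and K: "K \<le> N"
    and z: "\<And>j. K \<le> j \<Longrightarrow> j < N \<Longrightarrow> z j = c (N - 1 - j)"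
  shows "sym_eval N z (jts (node_coeff N c) \<mu>) * vdm K z =
    det (mat K K (\<lambda>(i, j). \<Prod>r<\<mu> i + K - 1 - i. z j - c (N - K + r)))"
proof -
  have "sym_eval N z (jts_entry (node_coeff N c) \<mu> i k) = jt_entry K \<mu> (\<lambda>r. c (N - K + r)) z i k"
    if "i < K" for i k
  proof -
    have i: "i < N" and m: "N - K \<le> \<mu> i + N - 1 - i"
      and e: "\<mu> i + N - 1 - i - (N - K) = \<mu> i + K - 1 - i"
      using that K by auto
    have cancel: "lin_prod (\<mu> i + K - 1 - i) (\<lambda>r. c (N - K + r)) * hser K z =
        lin_prod (\<mu> i + N - 1 - i) c * hser N z"
      using lin_prod_hser_cancel[where z = z and c = c, OF K m] z unfolding e by simp
    show ?thesis
      unfolding jts_entry_def jt_entry_def node_coeff_def shift_index[of _ _ \<mu>, OF i] cancel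
      by (simp add: sym_eval_hom.hom_sum sym_eval_scale sym_eval_hsym fps_mult_nth atLeast0AtMost)
  qed
  then have "sym_eval N z (jts (node_coeff N c) \<mu>) = det (mat K K (\<lambda>(i, k). jt_entry K \<mu> (\<lambda>r. c (N - K + r)) z i k))"
    by (subst jts_eq[OF \<mu>]) (auto simp: sym_eval_hom.hom_det_mat intro!: arg_cong[where f = det] eq_matI)
  then show ?thesis by (simp only: det_alternant)
qed

subsection \<open>Rearranging monomials\<close>

text \<open>Inside a large initial segment the complements of domain and image have the same size;
  above it the extension is the identity.\<close>

lemma bij_extending:
  fixes f :: "nat \<Rightarrow> nat"
  assumes "inj_on f {..<n}"
  obtains \<pi> where "bij \<pi>" "\<And>i. i < n \<Longrightarrow> \<pi> i = f i"
proof -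
  obtain M0 where M0: "f ` {..<n} \<subseteq> {..<M0}"
    using finite_nat_bounded[of "f ` {..<n}"] by auto
  define M where "M = max n M0"
  have sub: "f ` {..<n} \<subseteq> {..<M}" "{..<n} \<subseteq> {..<M}"
    using M0 by (auto simp: M_def)
  have "card ({..<M} - {..<n}) = card ({..<M} - f ` {..<n})"
    using sub assms by (simp add: card_Diff_subset card_image)
  then obtain g where g: "bij_betw g ({..<M} - {..<n}) ({..<M} - f ` {..<n})"
    using finite_same_card_bij[of "{..<M} - {..<n}" "{..<M} - f ` {..<n}"] by auto
  define \<pi> where "\<pi> i = (if i < n then f i else if i < M then g i else i)" for i
  have "bij_betw \<pi> {..<n} (f ` {..<n})"
    using assms by (subst bij_betw_cong[of _ _ f]) (auto simp: \<pi>_def bij_betw_def)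
  moreover have "bij_betw \<pi> ({..<M} - {..<n}) ({..<M} - f ` {..<n})"
    using g by (subst bij_betw_cong[of _ _ g]) (auto simp: \<pi>_def)
  ultimately have "bij_betw \<pi> ({..<n} \<union> ({..<M} - {..<n})) (f ` {..<n} \<union> ({..<M} - f ` {..<n}))"
    by (rule bij_betw_combine) auto
  moreover have "bij_betw \<pi> {M..} {M..}"
    by (subst bij_betw_cong[of _ _ id]) (auto simp: \<pi>_def M_def)
  ultimately have "bij_betw \<pi> ({..<n} \<union> ({..<M} - {..<n}) \<union> {M..}) (f ` {..<n} \<union> ({..<M} - f ` {..<n}) \<union> {M..})"
    by (rule bij_betw_combine) (use sub in auto)
  moreover have "{..<n} \<union> ({..<M} - {..<n}) \<union> {M..} = UNIV" "f ` {..<n} \<union> ({..<M} - f ` {..<n}) \<union> {M..} = UNIV"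
    using sub by auto
  ultimately have "bij \<pi>" by simp
  moreover have "\<pi> i = f i" if "i < n" for i using that by (simp add: \<pi>_def)
  ultimately show thesis by (rule that)
qed

text \<open>A symmetric function is determined by its coefficients at sorted monomials, and such a
  monomial of degree at most N survives the restriction to N variables.\<close>

lemma monom_sorted_rearrangement:
  fixes m :: monom
  obtains \<pi> where "bij \<pi>" "Poly_Mapping.lookup (Poly_Mapping.map_key \<pi> m) \<in> partitions"
    "Poly_Mapping.keys (Poly_Mapping.map_key \<pi> m) \<subseteq> {..<mon_deg m}"
proof -
  define xs where "xs = rev (sort_key (Poly_Mapping.lookup m) (sorted_list_of_set (Poly_Mapping.keys m)))"
  define n where "n = length xs"
  have xs: "set xs = Poly_Mapping.keys m" "distinct xs" "sorted (rev (map (Poly_Mapping.lookup m) xs))"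
    by (simp_all add: xs_def rev_map)
  have "inj_on (\<lambda>i. xs ! i) {..<n}"
    unfolding n_def using xs(2) by (simp add: inj_on_def nth_eq_iff_index_eq)
  then obtain \<pi> where \<pi>: "bij \<pi>" "\<And>i. i < n \<Longrightarrow> \<pi> i = xs ! i"
    by (rule bij_extending) blast
  have l: "Poly_Mapping.lookup (Poly_Mapping.map_key \<pi> m) i = Poly_Mapping.lookup m (\<pi> i)" for i
    using \<pi>(1) by (simp add: lookup_map_key bij_is_inj)
  have zero: "Poly_Mapping.lookup m (\<pi> i) = 0" if "i \<ge> n" for i
  proof (rule ccontr)
    assume "Poly_Mapping.lookup m (\<pi> i) \<noteq> 0"
    then have "\<pi> i \<in> set xs" by (simp add: xs in_keys_iff)
    then obtain j where "j < n" "xs ! j = \<pi> i" by (auto simp: in_set_conv_nth n_def)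
    then have "\<pi> j = \<pi> i" using \<pi>(2) by simp
    then show False
      using injD[OF bij_is_inj[OF \<pi>(1)], of j i] \<open>j < n\<close> that by simp
  qed
  have dec: "Poly_Mapping.lookup m (\<pi> j) \<le> Poly_Mapping.lookup m (\<pi> i)" if "i \<le> j" for i j
  proof (cases "j < n")
    case True
    then have "map (Poly_Mapping.lookup m) xs ! j \<le> map (Poly_Mapping.lookup m) xs ! i"
      using sorted_rev_nth_mono[OF xs(3) that] by (simp add: n_def)
    then show ?thesis using True that \<pi>(2) by (simp add: n_def)
  qed (simp add: zero)
  have "finite {i. Poly_Mapping.lookup m (\<pi> i) \<noteq> 0}"
  proof (rule finite_subset)
    show "{i. Poly_Mapping.lookup m (\<pi> i) \<noteq> 0} \<subseteq> {..<n}"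
    proof
      fix i assume "i \<in> {i. Poly_Mapping.lookup m (\<pi> i) \<noteq> 0}"
      then have "\<not> n \<le> i" using zero[of i] by auto
      then show "i \<in> {..<n}" by simp
    qed
  qed simp
  then have "Poly_Mapping.lookup (Poly_Mapping.map_key \<pi> m) \<in> partitions"
    unfolding partitions_def using dec by (auto simp: l antimono_def)
  moreover have n: "n \<le> mon_deg m"
  proof -
    have "n = card (Poly_Mapping.keys m)"
      using distinct_card[OF xs(2)] xs(1) by (simp add: n_def)
    also have "\<dots> = (\<Sum>i\<in>Poly_Mapping.keys m. 1)" by simp
    also have "\<dots> \<le> mon_deg m"
      unfolding mon_deg_def by (intro sum_mono) (simp add: in_keys_iff Suc_le_eq)
    finally show ?thesis .
  qed
  moreover have "Poly_Mapping.keys (Poly_Mapping.map_key \<pi> m) \<subseteq> {..<mon_deg m}"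
  proof (intro subsetI)
    fix i assume "i \<in> Poly_Mapping.keys (Poly_Mapping.map_key \<pi> m)"
    then have "Poly_Mapping.lookup m (\<pi> i) \<noteq> 0"
      by (simp only: in_keys_iff l simp_thms)
    then have "\<not> n \<le> i" using zero[of i] by auto
    then show "i \<in> {..<mon_deg m}" using n by simp
  qed
  ultimately show thesis using \<pi>(1) that by blast
qed

lemma sym_restrict_inj: "d \<le> N \<Longrightarrow> inj_on (sym_restrict N) (sym_deg_le d)"
proof (rule inj_onI, rule symfun_eqI)
  fix F G :: symfun and m :: monom
  assume *: "d \<le> N" "F \<in> sym_deg_le d" "G \<in> sym_deg_le d" "sym_restrict N F = sym_restrict N G"
  show "sym_coeff F m = sym_coeff G m"
  proof (cases "mon_deg m \<le> d")
    case True
    obtain \<pi> where \<pi>: "bij \<pi>" "Poly_Mapping.keys (Poly_Mapping.map_key \<pi> m) \<subseteq> {..<mon_deg m}"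
      by (rule monom_sorted_rearrangement)
    have "Poly_Mapping.keys (Poly_Mapping.map_key \<pi> m) \<subseteq> {..<N}"
      using \<pi>(2) True *(1) by auto
    then have "sym_coeff F (Poly_Mapping.map_key \<pi> m) = sym_coeff G (Poly_Mapping.map_key \<pi> m)"
      using arg_cong[OF *(4), of "\<lambda>P. Poly_Mapping.lookup P (Poly_Mapping.map_key \<pi> m)"]
      by (simp add: lookup_restrict)
    then show ?thesis using \<pi>(1) by (simp add: sym_coeff_sym)
  next
    case False
    then have "sym_coeff F m = 0" "sym_coeff G m = 0"
      using *(2,3) by (auto simp: sym_deg_le_def)
    then show ?thesis by simp
  qed
qed

lemma sym_lift_restrict: "d \<le> N \<Longrightarrow> F \<in> sym_deg_le d \<Longrightarrow> sym_lift d N (sym_restrict N F) = F"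
  unfolding sym_lift_def by (rule the_inv_into_f_f[OF sym_restrict_inj])

lemma restrict_in_sympoly: "sym_restrict N F \<in> sympoly N"
proof -
  have "Poly_Mapping.lookup (sym_restrict N F) (Poly_Mapping.map_key \<pi> m) = Poly_Mapping.lookup (sym_restrict N F) m"
    if \<pi>: "\<pi> permutes {..<N}" for \<pi> m
  proof -
    have "Poly_Mapping.keys (Poly_Mapping.map_key \<pi> m) = \<pi> -` Poly_Mapping.keys m"
      using \<pi> by (simp add: keys_map_key permutes_inj)
    moreover have "\<pi> -` Poly_Mapping.keys m \<subseteq> {..<N} \<longleftrightarrow> Poly_Mapping.keys m \<subseteq> {..<N}"
      using permutes_in_image[OF \<pi>] permutes_surj[OF \<pi>] by (auto simp: subset_iff) (metis surjD)
    ultimately show ?thesis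
      using \<pi> by (simp add: lookup_restrict sym_coeff_sym permutes_bij)
  qed
  then show ?thesis
    by (auto simp: sympoly_def lookup_restrict in_keys_iff subset_iff split: if_splits)
qed

lemma restrict_in_deg_le: "F \<in> sym_deg_le d \<Longrightarrow> sym_restrict N F \<in> mpoly_deg_le d"
  by (auto simp: sym_deg_le_def mpoly_deg_le_def in_keys_iff lookup_restrict split: if_splits)

subsection \<open>Coefficientwise convergence\<close>

definition sym_tendsto :: "(nat \<Rightarrow> symfun) \<Rightarrow> symfun \<Rightarrow> bool" where
  "sym_tendsto F G \<longleftrightarrow> (\<forall>m. (\<lambda>N. sym_coeff (F N) m) \<longlonglongrightarrow> sym_coeff G m)"

lemma sym_tendsto_const: "sym_tendsto (\<lambda>_. F) F"
  by (simp add: sym_tendsto_def)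

lemma sym_tendsto_unique: "sym_tendsto F G \<Longrightarrow> sym_tendsto F H \<Longrightarrow> G = H"
  by (rule symfun_eqI) (auto simp: sym_tendsto_def intro: LIMSEQ_unique)

lemma sym_tendsto_mult:
  "sym_tendsto F f \<Longrightarrow> sym_tendsto G g \<Longrightarrow> sym_tendsto (\<lambda>N. F N * G N) (f * g)"
  unfolding sym_tendsto_def sym_coeff_times case_prod_unfold by (intro allI tendsto_sum tendsto_mult) auto

lemma sym_tendsto_scale:
  "a \<longlonglongrightarrow> b \<Longrightarrow> sym_tendsto F f \<Longrightarrow> sym_tendsto (\<lambda>N. sym_scale (a N) (F N)) (sym_scale b f)"
  unfolding sym_tendsto_def sym_coeff_scale by (intro allI tendsto_mult) auto

lemma sym_tendsto_sum:
  "(\<And>x. x \<in> A \<Longrightarrow> sym_tendsto (\<lambda>N. F N x) (f x)) \<Longrightarrow> sym_tendsto (\<lambda>N. \<Sum>x\<in>A. F N x) (\<Sum>x\<in>A. f x)"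
  unfolding sym_tendsto_def sym_coeff_sum by (intro allI tendsto_sum) auto

lemma sym_tendsto_prod:
  "(\<And>x. x \<in> A \<Longrightarrow> sym_tendsto (\<lambda>N. F N x) (f x)) \<Longrightarrow> sym_tendsto (\<lambda>N. \<Prod>x\<in>A. F N x) (\<Prod>x\<in>A. f x)"
proof (induction A rule: infinite_finite_induct)
  case (insert x A)
  then show ?case
    unfolding prod.insert[OF insert.hyps] by (intro sym_tendsto_mult) simp_all
qed (simp_all add: sym_tendsto_const)

lemma sym_tendsto_jts:
  assumes "\<And>t a. (\<lambda>N. \<epsilon> N t a) \<longlonglongrightarrow> \<epsilon>' t a"
  shows "sym_tendsto (\<lambda>N. jts (\<epsilon> N) \<mu>) (jts \<epsilon>' \<mu>)"
proof -
  let ?n = "part_length \<mu>"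
  have *: "sym_tendsto (\<lambda>N. jts_entry (\<epsilon> N) \<mu> i k) (jts_entry \<epsilon>' \<mu> i k)" for i k
    unfolding jts_entry_def
    by (cases "i \<le> \<mu> i + k", simp_all only: if_True if_False simp_thms)
      (intro sym_tendsto_sum sym_tendsto_scale sym_tendsto_const assms)+
  then show ?thesis
    unfolding jts_def det_def'[OF mat_carrier]
  proof (intro sym_tendsto_sum sym_tendsto_mult[OF sym_tendsto_const] sym_tendsto_prod)
    fix p i assume "p \<in> {p. p permutes {0..<?n}}" "i \<in> {0..<?n}"
    then have "i < ?n" "p i < ?n" using permutes_in_image[of p "{0..<?n}" i] by auto
    then show "sym_tendsto (\<lambda>N. mat ?n ?n (\<lambda>(i, k). jts_entry (\<epsilon> N) \<mu> i k) $$ (i, p i))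
        (mat ?n ?n (\<lambda>(i, k). jts_entry \<epsilon>' \<mu> i k) $$ (i, p i))"
      using * by simp
  qed
qed

text \<open>For large N the lift of \<open>fact_schur\<close> is the \<open>jts\<close> that
  restricts to it, so the convergence in the definition reduces to that of
  \<open>node_coeff\<close>.\<close>

lemma interp_BC_eq:
  assumes \<mu>: "\<mu> \<in> partitions"
    and lim: "\<And>t a. (\<lambda>N. node_coeff N (\<lambda>i. s * q ^ i + inverse s * q powi (int N - int i - 1)) t a) \<longlonglongrightarrow> \<epsilon> t a"
  shows "interp_BC \<mu> q s = jts \<epsilon> \<mu>"
proof -
  let ?c = "\<lambda>N i. s * q ^ i + inverse s * q powi (int N - int i - 1)"
  let ?J = "\<lambda>N. jts (node_coeff N (?c N)) \<mu>"
  let ?P = "\<lambda>N. fact_schur N \<mu> (?c N)"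
  have P: "?P N = sym_restrict N (?J N)" if "N \<ge> part_length \<mu>" for N
    using fact_schur_eq[OF \<mu> that] .
  have deg: "?J N \<in> sym_deg_le d" if "d \<ge> part_size \<mu>" for N d
    using jts_filt[OF \<mu>] sym_filt_mono[of "int (part_size \<mu>)" "int d"] that
    by (auto simp: sym_filt_nat[symmetric])
  have deg': "jts \<epsilon> \<mu> \<in> sym_deg_le d" if "d \<ge> part_size \<mu>" for d
    using jts_filt[OF \<mu>] sym_filt_mono[of "int (part_size \<mu>)" "int d"] that
    by (auto simp: sym_filt_nat[symmetric])
  have tend: "sym_tendsto ?J (jts \<epsilon> \<mu>)"
    by (rule sym_tendsto_jts) (rule lim)
  have conv: "sym_converges ?P (jts \<epsilon> \<mu>)"
    unfolding sym_converges_def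
  proof (intro conjI exI[of _ "part_size \<mu>"])
    show "\<forall>\<^sub>F N in sequentially. ?P N \<in> sympoly N \<inter> mpoly_deg_le (part_size \<mu>)"
      using eventually_ge_at_top[of "part_length \<mu>"]
      by eventually_elim (simp add: P restrict_in_sympoly restrict_in_deg_le deg)
    show "\<forall>\<^sub>F d in sequentially. jts \<epsilon> \<mu> \<in> sym_deg_le d \<and>
        (\<forall>m. (\<lambda>N. sym_coeff (sym_lift d N (?P N)) m) \<longlonglongrightarrow> sym_coeff (jts \<epsilon> \<mu>) m)"
      using eventually_ge_at_top[of "part_size \<mu>"]
    proof eventually_elim
      case (elim d)
      have "(\<lambda>N. sym_coeff (sym_lift d N (?P N)) m) \<longlonglongrightarrow> sym_coeff (jts \<epsilon> \<mu>) m" for m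
      proof (rule Lim_transform_eventually)
        show "(\<lambda>N. sym_coeff (?J N) m) \<longlonglongrightarrow> sym_coeff (jts \<epsilon> \<mu>) m"
          using tend by (simp only: sym_tendsto_def)
        show "\<forall>\<^sub>F N in sequentially. sym_coeff (?J N) m = sym_coeff (sym_lift d N (?P N)) m"
          using eventually_ge_at_top[of "max d (part_length \<mu>)"]
          by eventually_elim (use elim in \<open>simp add: P sym_lift_restrict deg\<close>)
      qed
      then show ?case using deg'[OF elim] by blast
    qed
  qed
  have unique: "F = jts \<epsilon> \<mu>" if "sym_converges ?P F" for F
  proof -
    \<comment> \<open>Both convergence statements hold for all large d, so one d serves for
      both.\<close>
    have "\<forall>\<^sub>F d in sequentially. sym_tendsto (\<lambda>N. sym_lift d N (?P N)) F \<and>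
        sym_tendsto (\<lambda>N. sym_lift d N (?P N)) (jts \<epsilon> \<mu>)"
      using eventually_conj[OF conjunct2[OF that[unfolded sym_converges_def]]
          conjunct2[OF conv[unfolded sym_converges_def]]]
      unfolding sym_tendsto_def by (rule eventually_mono) blast
    then obtain d where "sym_tendsto (\<lambda>N. sym_lift d N (?P N)) F" "sym_tendsto (\<lambda>N. sym_lift d N (?P N)) (jts \<epsilon> \<mu>)"
      using eventually_happens'[OF sequentially_bot] by blast
    then show ?thesis by (rule sym_tendsto_unique)
  qed
  show ?thesis
    unfolding interp_BC_def using conv unique by (rule the_equality)
qed

subsection \<open>Vanishing of the interpolation determinants\<close>

text \<open>The alternant of \<mu> at the grid point of \<nu>; divided by the Vandermonde product at
  that point it is the value of the interpolation polynomial.\<close>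

definition interp_det :: "nat \<Rightarrow> (nat \<Rightarrow> complex) \<Rightarrow> (nat \<Rightarrow> nat) \<Rightarrow> (nat \<Rightarrow> nat) \<Rightarrow> complex" where
  "interp_det K c \<nu> \<mu> = det (mat K K (\<lambda>(i, j). \<Prod>r<shifted K \<mu> i. c (shifted K \<nu> j) - c r))"

lemma prod_nodes_eq_0: "(n :: nat) < m \<Longrightarrow> (\<Prod>r<m. c n - c r :: complex) = 0"
  by (rule prod_zero) auto

text \<open>If \<nu> < \<mu> at i0, then by the pigeonhole principle every permutation sends some i
  \<le> i0 to p i \<ge> i0. Hence \<nu> at p i is less than \<mu> at i, and the product in that
  entry runs through its zero.\<close>

lemma interp_det_vanish:
  assumes \<mu>: "\<mu> \<in> partitions" "part_length \<mu> \<le> K" and \<nu>: "\<nu> \<in> partitions"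
    and nsub: "\<not> part_subseteq \<mu> \<nu>"
  shows "interp_det K c \<nu> \<mu> = 0"
proof -
  obtain i0 where i0: "\<nu> i0 < \<mu> i0"
    using nsub by (auto simp: part_subseteq_def not_le)
  then have "i0 < K"
    using part_nonzero_iff[OF \<mu>(1), of i0] \<mu>(2) by linarith
  let ?A = "mat K K (\<lambda>(i, j). \<Prod>r<shifted K \<mu> i. c (shifted K \<nu> j) - c r)"
  have "(\<Prod>i = 0..<K. ?A $$ (i, p i)) = 0" if p: "p permutes {0..<K}" for p
  proof -
    have "\<exists>i\<le>i0. i0 \<le> p i"
    proof (rule ccontr)
      assume "\<not> (\<exists>i\<le>i0. i0 \<le> p i)"
      then have "p i < i0" if "i \<le> i0" for i
        using that by (meson not_le)
      then have "p ` {..i0} \<subseteq> {..<i0}" by auto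
      then have "card (p ` {..i0}) \<le> i0"
        using card_mono[of "{..<i0}" "p ` {..i0}"] by simp
      moreover have "card (p ` {..i0}) = Suc i0"
        using card_image[OF permutes_inj_on[OF p], of "{..i0}"] by simp
      ultimately show False by simp
    qed
    then obtain i where i: "i \<le> i0" "i0 \<le> p i" by blast
    have iK: "i < K" "p i < K"
      using i(1) \<open>i0 < K\<close> permutes_in_image[OF p, of i] by auto
    have "\<nu> (p i) < \<mu> i"
      using partitions_antimono[OF \<nu> i(2)] partitions_antimono[OF \<mu>(1) i(1)] i0 by linarith
    then have "shifted K \<nu> (p i) < shifted K \<mu> i"
      using i iK by (simp add: shifted_def)
    then have "?A $$ (i, p i) = 0"
      using iK by (simp add: prod_nodes_eq_0 del: prod_zero_iff)
    from prod_zero[OF finite_atLeastLessThan bexI[of "\<lambda>i. ?A $$ (i, p i) = 0", OF this]] show ?thesis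
      using iK by simp
  qed
  then show ?thesis
    unfolding interp_det_def det_def'[OF mat_carrier] by (intro sum.neutral) auto
qed

lemma interp_det_diag:
  assumes "\<nu> \<in> partitions"
  shows "interp_det K c \<nu> \<nu> = (\<Prod>i<K. \<Prod>r<shifted K \<nu> i. c (shifted K \<nu> i) - c r)"
proof -
  let ?A = "mat K K (\<lambda>(i, j). \<Prod>r<shifted K \<nu> i. c (shifted K \<nu> j) - c r)"
  have "det ?A = det (mat K K (\<lambda>(j, i). \<Prod>r<shifted K \<nu> i. c (shifted K \<nu> j) - c r))"
    by (subst det_transpose[of ?A K, symmetric]) (auto intro!: arg_cong[where f = det] eq_matI)
  also have "\<dots> = (\<Prod>i<K. \<Prod>r<shifted K \<nu> i. c (shifted K \<nu> i) - c r)"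
    by (subst det_mat_lower_left_zero) (auto intro!: prod_nodes_eq_0 shifted_strict assms)
  finally show ?thesis by (simp add: interp_det_def)
qed

lemma interp_det_diag_nonzero:
  assumes "\<nu> \<in> partitions" "\<And>i j. i < j \<Longrightarrow> c i \<noteq> (c j :: complex)"
  shows "interp_det K c \<nu> \<nu> \<noteq> 0"
  unfolding interp_det_diag[OF assms(1)] using assms(2) by (force simp: prod_zero_iff)

lemma vdm_nonzero:
  assumes "\<And>i j. i < j \<Longrightarrow> j < N \<Longrightarrow> x i \<noteq> (x j :: complex)"
  shows "vdm N x \<noteq> 0"
  unfolding vdm_def using assms by (force simp: prod_zero_iff)

subsection \<open>Monomial symmetric functions\<close>

lemma part_transpose_iff:
  assumes "\<nu> \<in> partitions"
  shows "j < \<nu> i \<longleftrightarrow> i < part_transpose \<nu> j"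
proof -
  have "finite {i. j < \<nu> i}"
    by (rule finite_subset[of _ "{i. \<nu> i \<noteq> 0}"]) (use assms in \<open>auto simp: partitions_def\<close>)
  then have "{i. j < \<nu> i} \<noteq> UNIV" by auto
  then obtain i0 where i0: "\<not> j < \<nu> i0" by auto
  define m where "m = (LEAST i. \<not> j < \<nu> i)"
  have m: "\<not> j < \<nu> m"
    unfolding m_def by (rule LeastI[of "\<lambda>i. \<not> j < \<nu> i", OF i0])
  have m': "j < \<nu> i" if "i < m" for i
    using not_less_Least[of i "\<lambda>i. \<not> j < \<nu> i"] that unfolding m_def by blast
  have "i < m" if "j < \<nu> i" for i
    using partitions_antimono[OF assms, of m i] m that by (cases "m \<le> i") auto
  with m' have eq: "{i. j < \<nu> i} = {..<m}" by blast
  have "i \<in> {i. j < \<nu> i} \<longleftrightarrow> i < part_transpose \<nu> j"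
    unfolding part_transpose_def eq by simp
  then show ?thesis by simp
qed

lemma map_key_map_key:
  fixes \<pi> \<tau> :: "nat \<Rightarrow> nat"
  assumes "bij \<pi>" "bij \<tau>"
  shows "Poly_Mapping.map_key \<tau> (Poly_Mapping.map_key \<pi> m) = Poly_Mapping.map_key (\<pi> \<circ> \<tau>) (m :: monom)"
  by (rule poly_mapping_eqI) (use assms in \<open>simp add: lookup_map_key bij_is_inj inj_compose\<close>)

lift_definition msym :: "(nat \<Rightarrow> nat) \<Rightarrow> symfun" is
  "\<lambda>\<nu> m. if \<exists>\<pi>. bij \<pi> \<and> Poly_Mapping.lookup (Poly_Mapping.map_key \<pi> m) = \<nu> then 1 else 0"
proof safe
  fix \<nu> :: "nat \<Rightarrow> nat" and \<pi> :: "nat \<Rightarrow> nat" and m :: monom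
  assume \<pi>: "bij \<pi>"
  have "(\<exists>\<tau>. bij \<tau> \<and> Poly_Mapping.lookup (Poly_Mapping.map_key \<tau> (Poly_Mapping.map_key \<pi> m)) = \<nu>) \<longleftrightarrow>
      (\<exists>\<tau>. bij \<tau> \<and> Poly_Mapping.lookup (Poly_Mapping.map_key \<tau> m) = \<nu>)"
  proof safe
    fix \<tau> :: "nat \<Rightarrow> nat"
    assume "bij \<tau>" "\<nu> = Poly_Mapping.lookup (Poly_Mapping.map_key \<tau> (Poly_Mapping.map_key \<pi> m))"
    then show "\<exists>\<tau>'. bij \<tau>' \<and> Poly_Mapping.lookup (Poly_Mapping.map_key \<tau>' m) =
        Poly_Mapping.lookup (Poly_Mapping.map_key \<tau> (Poly_Mapping.map_key \<pi> m))"
      using \<pi> by (intro exI[of _ "\<pi> \<circ> \<tau>"]) (simp add: map_key_map_key bij_comp)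
  next
    fix \<tau> :: "nat \<Rightarrow> nat"
    assume \<tau>: "bij \<tau>"
    have "\<pi> \<circ> (inv_into UNIV \<pi> \<circ> \<tau>) = \<tau>"
      using \<pi> by (auto simp: fun_eq_iff bij_is_surj surj_f_inv_f)
    then have "Poly_Mapping.map_key (inv_into UNIV \<pi> \<circ> \<tau>) (Poly_Mapping.map_key \<pi> m) = Poly_Mapping.map_key \<tau> m"
      using \<pi> \<tau> by (simp add: map_key_map_key bij_comp bij_imp_bij_inv)
    then show "\<exists>\<tau>'. bij \<tau>' \<and> Poly_Mapping.lookup (Poly_Mapping.map_key \<tau>' (Poly_Mapping.map_key \<pi> m)) =
        Poly_Mapping.lookup (Poly_Mapping.map_key \<tau> m)"
      using \<pi> \<tau> by (intro exI[of _ "inv_into UNIV \<pi> \<circ> \<tau>"]) (simp add: bij_comp bij_imp_bij_inv)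
  qed
  then show "(if \<exists>\<tau>. bij \<tau> \<and> Poly_Mapping.lookup (Poly_Mapping.map_key \<tau> (Poly_Mapping.map_key \<pi> m)) = \<nu>
      then 1 else 0 :: complex) =
      (if \<exists>\<tau>. bij \<tau> \<and> Poly_Mapping.lookup (Poly_Mapping.map_key \<tau> m) = \<nu> then 1 else 0)"
    by simp
next
  fix \<nu> :: "nat \<Rightarrow> nat"
  show "\<exists>d. \<forall>m. (if \<exists>\<pi>. bij \<pi> \<and> Poly_Mapping.lookup (Poly_Mapping.map_key \<pi> m) = \<nu>
      then 1 else 0 :: complex) \<noteq> 0 \<longrightarrow> mon_deg m \<le> d"
    \<comment> \<open>If \<nu> has infinite support, no monomial rearranges to it and any bound will
      do.\<close>
    by (rule exI[of _ "mon_deg (Abs_poly_mapping \<nu>)"])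
      (auto simp: lookup_inverse mon_deg_map_key)
qed

text \<open>The number of exponents above j is invariant under rearrangement; these numbers form the
  transposed partition, which determines the partition.\<close>

lemma rearranged_partition_unique:
  fixes m :: monom
  assumes "bij \<pi>" "Poly_Mapping.lookup (Poly_Mapping.map_key \<pi> m) = \<nu>" "\<nu> \<in> partitions"
    and "bij \<tau>" "Poly_Mapping.lookup (Poly_Mapping.map_key \<tau> m) = \<nu>'" "\<nu>' \<in> partitions"
  shows "\<nu> = \<nu>'"
proof -
  have tr: "part_transpose (Poly_Mapping.lookup (Poly_Mapping.map_key \<pi> m)) j = card {i. j < Poly_Mapping.lookup m i}"
    if "bij \<pi>" for \<pi> :: "nat \<Rightarrow> nat" and j
  proof -
    have pre: "{i. j < Poly_Mapping.lookup (Poly_Mapping.map_key \<pi> m) i} = \<pi> -` {i. j < Poly_Mapping.lookup m i}"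
      using that by (auto simp: lookup_map_key bij_is_inj)
    then show ?thesis
      unfolding part_transpose_def pre
      using that by (intro card_vimage_inj) (simp_all add: bij_is_inj bij_is_surj)
  qed
  have "j < \<nu> i \<longleftrightarrow> j < \<nu>' i" for i j
    using tr[OF assms(1), of j] tr[OF assms(4), of j]
    unfolding assms(2,5) part_transpose_iff[OF assms(3)] part_transpose_iff[OF assms(6)] by simp
  then show ?thesis
    by (metis ext nat_neq_iff less_irrefl)
qed

lemma part_size_lookup:
  fixes m :: monom
  assumes "Poly_Mapping.lookup m \<in> partitions"
  shows "part_size (Poly_Mapping.lookup m) = mon_deg m"
proof -
  have "Poly_Mapping.keys m = {i. Poly_Mapping.lookup m i \<noteq> 0}"
    by (auto simp: in_keys_iff)
  also note partition_support[OF assms]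
  finally show ?thesis by (simp only: part_size_def mon_deg_def)
qed

text \<open>Serves to bound the dimension of \<open>sym_deg_le d\<close> by the number of partitions
  of size at most d.\<close>

lemma sym_deg_le_span_msym: "sym_deg_le d \<subseteq> sym.span (msym ` parts_le d)"
proof
  fix F assume F: "F \<in> sym_deg_le d"
  have "F = (\<Sum>\<nu>\<in>parts_le d. sym_scale (sym_coeff F (Abs_poly_mapping \<nu>)) (msym \<nu>))"
  proof (rule symfun_eqI)
    fix m :: monom
    obtain \<pi> where \<pi>: "bij \<pi>" "Poly_Mapping.lookup (Poly_Mapping.map_key \<pi> m) \<in> partitions"
      by (rule monom_sorted_rearrangement[of m]) blast
    let ?\<nu> = "Poly_Mapping.lookup (Poly_Mapping.map_key \<pi> m)"
    have co: "sym_coeff (msym \<nu>) m = (if \<nu> = ?\<nu> then 1 else 0)" if "\<nu> \<in> parts_le d" for \<nu>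
    proof -
      have "(\<exists>\<tau>. bij \<tau> \<and> Poly_Mapping.lookup (Poly_Mapping.map_key \<tau> m) = \<nu>) \<longleftrightarrow> \<nu> = ?\<nu>"
      proof
        assume "\<exists>\<tau>. bij \<tau> \<and> Poly_Mapping.lookup (Poly_Mapping.map_key \<tau> m) = \<nu>"
        then obtain \<tau> where \<tau>: "bij \<tau>" "Poly_Mapping.lookup (Poly_Mapping.map_key \<tau> m) = \<nu>" by blast
        moreover have "\<nu> \<in> partitions" using that by (simp add: parts_le_def)
        ultimately show "\<nu> = ?\<nu>"
          by (intro rearranged_partition_unique[OF \<tau> _ \<pi>(1) refl \<pi>(2)])
      next
        assume "\<nu> = ?\<nu>"
        then show "\<exists>\<tau>. bij \<tau> \<and> Poly_Mapping.lookup (Poly_Mapping.map_key \<tau> m) = \<nu>"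
          using \<pi>(1) by (intro exI[of _ \<pi>] conjI) simp_all
      qed
      then show ?thesis by (simp only: msym.rep_eq)
    qed
    have "sym_coeff (\<Sum>\<nu>\<in>parts_le d. sym_scale (sym_coeff F (Abs_poly_mapping \<nu>)) (msym \<nu>)) m =
        (\<Sum>\<nu>\<in>parts_le d. if \<nu> = ?\<nu> then sym_coeff F (Abs_poly_mapping \<nu>) else 0)"
      unfolding sym_coeff_sum sym_coeff_scale by (intro sum.cong) (auto simp: co)
    also have "\<dots> = (if ?\<nu> \<in> parts_le d then sym_coeff F (Abs_poly_mapping ?\<nu>) else 0)"
      by simp
    also have "\<dots> = (if mon_deg m \<le> d then sym_coeff F m else 0)"
      using \<pi> by (simp add: parts_le_def part_size_lookup mon_deg_map_key lookup_inverse sym_coeff_sym)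
    also have "\<dots> = sym_coeff F m"
      using F by (auto simp: sym_deg_le_def)
    finally show "sym_coeff F m = sym_coeff (\<Sum>\<nu>\<in>parts_le d. sym_scale (sym_coeff F (Abs_poly_mapping \<nu>)) (msym \<nu>)) m"
      by simp
  qed
  moreover have "(\<Sum>\<nu>\<in>parts_le d. sym_scale (sym_coeff F (Abs_poly_mapping \<nu>)) (msym \<nu>)) \<in> sym.span (msym ` parts_le d)"
    by (intro sym.span_sum sym.span_scale sym.span_base imageI)
  ultimately show "F \<in> sym.span (msym ` parts_le d)" by (simp only:)
qed

subsection \<open>Families with Schur functions as leading terms\<close>

lemma finite_family_independent:
  assumes "finite S" "\<And>k. (\<Sum>x\<in>S. sym_scale (k x) (g x)) = 0 \<Longrightarrow> \<forall>x\<in>S. k x = 0"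
  shows "inj_on g S \<and> sym.independent (g ` S)"
proof
  show inj: "inj_on g S"
  proof (rule inj_onI, rule ccontr)
    fix x y assume *: "x \<in> S" "y \<in> S" "g x = g y" "x \<noteq> y"
    define k :: "'a \<Rightarrow> complex" where "k z = (if z = x then 1 else if z = y then -1 else 0)" for z
    have "(\<Sum>z\<in>S. sym_scale (k z) (g z)) = (\<Sum>z\<in>{x, y}. sym_scale (k z) (g z))"
      using * assms(1) by (intro sum.mono_neutral_right) (auto simp: k_def)
    also have "\<dots> = 0" using * by (simp add: k_def)
    finally show False using assms(2)[of k] * by (auto simp: k_def)
  qed
  show "sym.independent (g ` S)"
  proof
    assume "sym.dependent (g ` S)"
    then obtain u where u: "\<exists>v\<in>g ` S. u v \<noteq> 0" "(\<Sum>v\<in>g ` S. sym_scale (u v) v) = 0"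
      using sym.dependent_finite[of "g ` S"] assms(1) by auto
    then have "(\<Sum>x\<in>S. sym_scale (u (g x)) (g x)) = 0"
      by (simp add: sum.reindex[OF inj])
    then show False using assms(2)[of "\<lambda>x. u (g x)"] u(1) by auto
  qed
qed

text \<open>The integers are a choice of distinct nodes. In a linear relation take \<nu> of least
  size among the partitions with nonzero coefficient: at its grid point only \<mu> contained in
  \<nu> contribute, and minimality leaves \<nu> alone.\<close>

lemma jts_nodes_independent:
  fixes d :: nat
  defines "g \<equiv> jts (node_coeff d of_nat)"
  shows "inj_on g (parts_le d) \<and> sym.independent (g ` parts_le d)"
proof (rule finite_family_independent)
  fix k assume k: "(\<Sum>\<mu>\<in>parts_le d. sym_scale (k \<mu>) (g \<mu>)) = 0"
  show "\<forall>\<mu>\<in>parts_le d. k \<mu> = 0"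
  proof (rule ccontr)
    assume "\<not> (\<forall>\<mu>\<in>parts_le d. k \<mu> = 0)"
    then obtain \<nu> where \<nu>: "\<nu> \<in> parts_le d" "k \<nu> \<noteq> 0"
      and min: "\<And>\<mu>. \<mu> \<in> parts_le d \<Longrightarrow> k \<mu> \<noteq> 0 \<Longrightarrow> part_size \<nu> \<le> part_size \<mu>"
      using ex_has_least_nat[of "\<lambda>\<mu>. \<mu> \<in> parts_le d \<and> k \<mu> \<noteq> 0" _ part_size] by blast
    let ?z = "\<lambda>j. of_nat (shifted d \<nu> j) :: complex"
    have len: "\<mu> \<in> partitions" "part_length \<mu> \<le> d" if "\<mu> \<in> parts_le d" for \<mu>
      using that part_length_le_size[of \<mu>] by (auto simp: parts_le_def)
    have ev: "sym_eval d ?z (g \<mu>) * vdm d ?z = interp_det d of_nat \<nu> \<mu>" if "\<mu> \<in> parts_le d" for \<mu>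
      unfolding g_def using sym_eval_jts_full[OF len[OF that], of ?z of_nat]
      by (simp add: interp_det_def shifted_def)
    have "0 = sym_eval d ?z (\<Sum>\<mu>\<in>parts_le d. sym_scale (k \<mu>) (g \<mu>)) * vdm d ?z"
      by (simp add: k)
    also have "\<dots> = (\<Sum>\<mu>\<in>parts_le d. k \<mu> * interp_det d of_nat \<nu> \<mu>)"
      by (simp add: sym_eval_hom.hom_sum sym_eval_scale sum_distrib_right mult.assoc ev)
    also have "\<dots> = (\<Sum>\<mu>\<in>{\<nu>}. k \<mu> * interp_det d of_nat \<nu> \<mu>)"
    proof (intro sum.mono_neutral_right ballI)
      fix \<mu> assume \<mu>: "\<mu> \<in> parts_le d - {\<nu>}"
      show "k \<mu> * interp_det d of_nat \<nu> \<mu> = 0"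
      proof (cases "k \<mu> = 0 \<or> \<not> part_subseteq \<mu> \<nu>")
        case True
        then show ?thesis using \<mu> \<nu> interp_det_vanish[of \<mu> d \<nu>] len by auto
      next
        case False
        then have "\<mu> = \<nu>"
          using min[of \<mu>] \<mu> \<nu> len by (intro part_subseteq_size_eq) auto
        then show ?thesis using \<mu> by simp
      qed
    qed (use \<nu> in auto)
    finally have "interp_det d of_nat \<nu> \<nu> = 0" using \<nu> by simp
    then show False
      using interp_det_diag_nonzero[of \<nu> of_nat d] len(1)[OF \<nu>(1)] by simp
  qed
qed simp

text \<open>The \<open>jts\<close> with the single coefficient at a = 0 is the Schur function, by
  the Jacobi--Trudi identity.\<close>

definition schur_like :: "((nat \<Rightarrow> nat) \<Rightarrow> symfun) \<Rightarrow> bool" where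
  "schur_like f \<longleftrightarrow>
     (\<forall>\<mu>\<in>partitions. f \<mu> - jts (\<lambda>t a. if a = 0 then 1 else 0) \<mu> \<in> sym_filt (int (part_size \<mu>) - 1))"

lemma schur_like_jts:
  assumes "\<And>t. \<epsilon> t 0 = 1"
  shows "schur_like (jts \<epsilon>)"
  unfolding schur_like_def by (intro ballI jts_diff_filt) (simp_all add: assms)

lemma schur_like_diff:
  assumes "schur_like f" "schur_like g" "\<mu> \<in> partitions"
  shows "f \<mu> - g \<mu> \<in> sym_filt (int (part_size \<mu>) - 1)"
proof -
  let ?s = "jts (\<lambda>t a. if a = 0 then 1 else 0) \<mu>"
  have "(f \<mu> - ?s) - (g \<mu> - ?s) \<in> sym_filt (int (part_size \<mu>) - 1)"
    by (rule sym_filt_diff) (use assms in \<open>auto simp: schur_like_def\<close>)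
  then show ?thesis by simp
qed

lemma schur_like_filt:
  assumes "schur_like f" "\<mu> \<in> partitions" "part_size \<mu> \<le> d"
  shows "f \<mu> \<in> sym_deg_le d"
proof -
  let ?s = "jts (\<lambda>t a. if a = 0 then 1 else 0) \<mu>"
  have "(f \<mu> - ?s) + ?s \<in> sym_filt (int d)"
  proof (rule sym_filt_add)
    show "f \<mu> - ?s \<in> sym_filt (int d)"
      using assms sym_filt_mono[of "int (part_size \<mu>) - 1" "int d"] by (auto simp: schur_like_def)
    show "?s \<in> sym_filt (int d)"
      using jts_filt[OF assms(2)] assms(3) sym_filt_mono[of "int (part_size \<mu>)" "int d"] by auto
  qed
  then show ?thesis by (simp add: sym_filt_nat)
qed

lemma parts_le_mono: "d \<le> e \<Longrightarrow> parts_le d \<subseteq> parts_le e"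
  by (auto simp: parts_le_def)

text \<open>An independent family with as many members as the spanning monomial family must span,
  since otherwise it could be enlarged.\<close>

lemma jts_nodes_span: "sym_deg_le d \<subseteq> sym.span (jts (node_coeff d of_nat) ` parts_le d)"
proof (rule ccontr)
  let ?g = "jts (node_coeff d of_nat)"
  assume "\<not> ?thesis"
  then obtain F where F: "F \<in> sym_deg_le d" "F \<notin> sym.span (?g ` parts_le d)" by auto
  have g: "inj_on ?g (parts_le d)" "sym.independent (?g ` parts_le d)"
    using jts_nodes_independent by auto
  then have "sym.independent (insert F (?g ` parts_le d))"
    using F(2) by (simp add: sym.independent_insertI)
  moreover have "?g ` parts_le d \<subseteq> sym_deg_le d"
    using schur_like_filt[OF schur_like_jts] by (auto simp: parts_le_def)
  then have "insert F (?g ` parts_le d) \<subseteq> sym.span (msym ` parts_le d)"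
    using F(1) sym_deg_le_span_msym by blast
  ultimately have "card (insert F (?g ` parts_le d)) \<le> card (msym ` parts_le d)"
    using sym.independent_span_bound[of "msym ` parts_le d"] by simp
  moreover have "F \<notin> ?g ` parts_le d"
    using F(2) sym.span_base by blast
  ultimately show False
    using card_image[OF g(1)] card_image_le[of "parts_le d" msym] by simp
qed

text \<open>Induction on the degree: \<open>f \<mu>\<close> differs from the corresponding member of
  the known spanning family by something of lower degree.\<close>

lemma schur_like_span:
  assumes "schur_like f"
  shows "sym_deg_le d \<subseteq> sym.span (f ` parts_le d)"
proof (induction d rule: less_induct)
  case (less d)
  let ?g = "jts (node_coeff d of_nat)"
  have "?g \<mu> \<in> sym.span (f ` parts_le d)" if \<mu>: "\<mu> \<in> parts_le d" for \<mu>
  proof -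
    have diff: "f \<mu> - ?g \<mu> \<in> sym_filt (int (part_size \<mu>) - 1)"
      using \<mu> by (intro schur_like_diff assms schur_like_jts) (auto simp: parts_le_def)
    have "f \<mu> - ?g \<mu> \<in> sym.span (f ` parts_le d)"
    proof (cases "part_size \<mu> = 0")
      case True
      then show ?thesis using diff by (simp add: sym_filt_neg sym.span_zero)
    next
      case False
      then have "int (part_size \<mu>) - 1 = int (part_size \<mu> - 1)" by simp
      from diff[unfolded this] have "f \<mu> - ?g \<mu> \<in> sym_deg_le (part_size \<mu> - 1)"
        by (simp only: sym_filt_nat)
      moreover have "part_size \<mu> - 1 < d" using False \<mu> by (auto simp: parts_le_def)
      ultimately have "f \<mu> - ?g \<mu> \<in> sym.span (f ` parts_le (part_size \<mu> - 1))"
        using less.IH by blast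
      moreover have "sym.span (f ` parts_le (part_size \<mu> - 1)) \<subseteq> sym.span (f ` parts_le d)"
        using \<open>part_size \<mu> - 1 < d\<close> by (intro sym.span_mono image_mono parts_le_mono) simp
      ultimately show ?thesis by (rule rev_subsetD)
    qed
    then have "f \<mu> - (f \<mu> - ?g \<mu>) \<in> sym.span (f ` parts_le d)"
      by (rule sym.span_diff[OF sym.span_base[OF imageI[OF \<mu>]]])
    then show ?thesis by simp
  qed
  then have "sym.span (?g ` parts_le d) \<subseteq> sym.span (f ` parts_le d)"
    by (intro sym.span_minimal sym.subspace_span) blast
  then show ?case using jts_nodes_span[of d] by (rule subset_trans[rotated])
qed

text \<open>Dimension count: the independent family \<open>?g\<close> lies in every span that
  contains that of \<open>f\<close>, so no spanning set can have fewer members than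
  \<open>parts_le d\<close>.\<close>

lemma schur_like_independent:
  assumes "schur_like f"
  shows "inj_on f (parts_le d)" "sym.independent (f ` parts_le d)"
proof -
  let ?g = "jts (node_coeff d of_nat)"
  let ?P = "parts_le d"
  have g: "inj_on ?g ?P" "sym.independent (?g ` ?P)"
    using jts_nodes_independent by auto
  have bound: "card ?P \<le> card T" if "finite T" "sym.span (f ` ?P) \<subseteq> sym.span T" for T
  proof -
    have "?g ` ?P \<subseteq> sym_deg_le d"
      using schur_like_filt[OF schur_like_jts] by (auto simp: parts_le_def)
    then have "?g ` ?P \<subseteq> sym.span T"
      using schur_like_span[OF assms, of d] that(2) by blast
    then have "card (?g ` ?P) \<le> card T"
      using sym.independent_span_bound[OF that(1) g(2)] by blast
    then show ?thesis by (simp add: card_image[OF g(1)])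
  qed
  have "card (f ` ?P) = card ?P"
    using bound[of "f ` ?P"] card_image_le[of ?P f] by simp
  then show inj: "inj_on f ?P"
    by (intro eq_card_imp_inj_on) auto
  show "sym.independent (f ` ?P)"
  proof
    assume "sym.dependent (f ` ?P)"
    then obtain a where a: "a \<in> f ` ?P" "a \<in> sym.span (f ` ?P - {a})"
      by (auto simp: sym.dependent_def)
    have "f ` ?P \<subseteq> sym.span (f ` ?P - {a})"
      using a sym.span_superset[of "f ` ?P - {a}"] by auto
    then have "sym.span (f ` ?P) \<subseteq> sym.span (f ` ?P - {a})"
      by (intro sym.span_minimal) (auto simp: sym.subspace_span)
    then have "card ?P \<le> card (f ` ?P - {a})"
      by (intro bound) auto
    also have "\<dots> < card (f ` ?P)"
      using a by (intro psubset_card_mono) auto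
    also have "\<dots> \<le> card ?P" by (rule card_image_le) simp
    finally show False by simp
  qed
qed

theorem schur_like_basis:
  assumes "schur_like f"
  shows "inj_on f partitions" "sym.independent (f ` partitions)" "sym.span (f ` partitions) = UNIV"
proof -
  show "inj_on f partitions"
  proof (rule inj_onI)
    fix \<mu> \<nu> assume "\<mu> \<in> partitions" "\<nu> \<in> partitions" "f \<mu> = f \<nu>"
    then show "\<mu> = \<nu>"
      using inj_onD[OF schur_like_independent(1)[OF assms, of "max (part_size \<mu>) (part_size \<nu>)"], of \<mu> \<nu>]
      by (simp add: parts_le_def)
  qed
  have ex: "\<exists>d. T \<subseteq> f ` parts_le d" if "finite T" "T \<subseteq> f ` partitions" for T
    using that
  proof (induction T rule: finite_induct)
    case (insert x T)
    then obtain d \<mu> where "T \<subseteq> f ` parts_le d" "x = f \<mu>" "\<mu> \<in> partitions" by auto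
    then have "T \<subseteq> f ` parts_le (max d (part_size \<mu>))" "x \<in> f ` parts_le (max d (part_size \<mu>))"
      using image_mono[OF parts_le_mono[of d "max d (part_size \<mu>)"], of f] by (auto simp: parts_le_def)
    then show ?case by (meson insert_subset)
  qed simp
  show "sym.independent (f ` partitions)"
  proof
    assume "sym.dependent (f ` partitions)"
    then obtain T u where T: "finite T" "T \<subseteq> f ` partitions" "\<exists>v\<in>T. u v \<noteq> 0" "(\<Sum>v\<in>T. sym_scale (u v) v) = 0"
      by (auto simp: sym.dependent_explicit)
    then obtain d where "T \<subseteq> f ` parts_le d" using ex by blast
    moreover have "sym.dependent T" using T by (auto simp: sym.dependent_finite)
    ultimately show False using schur_like_independent(2)[OF assms, of d] sym.independent_mono by blast
  qed
  show "sym.span (f ` partitions) = UNIV"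
  proof (intro equalityI subsetI)
    fix F :: symfun
    obtain d where "F \<in> sym_deg_le d"
      using sym_coeff_bounded[of F] by (auto simp: sym_deg_le_def)
    then have "F \<in> sym.span (f ` parts_le d)" using schur_like_span[OF assms] by blast
    then show "F \<in> sym.span (f ` partitions)"
      using sym.span_mono[of "f ` parts_le d" "f ` partitions"] by (auto simp: parts_le_def)
  qed simp
qed

lemma schur_like_expansion:
  assumes "schur_like f" "F \<in> sym_deg_le d"
  obtains C where "F = (\<Sum>\<rho>\<in>parts_le d. sym_scale (C \<rho>) (f \<rho>))"
proof -
  have "F \<in> sym.span (f ` parts_le d)"
    using schur_like_span[OF assms(1)] assms(2) by blast
  then obtain u where "F = (\<Sum>v\<in>f ` parts_le d. sym_scale (u v) v)"
    using sym.span_finite[of "f ` parts_le d"] by auto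
  also have "\<dots> = (\<Sum>\<rho>\<in>parts_le d. sym_scale (u (f \<rho>)) (f \<rho>))"
    by (simp add: sum.reindex[OF schur_like_independent(1)[OF assms(1)]])
  finally show thesis by (rule that)
qed

subsection \<open>Limits of triangular systems\<close>

text \<open>Forward substitution: row \<nu> determines \<open>C N \<nu>\<close> from the values at
  smaller partitions, and the diagonal entry can be divided out for large N because its limit is
  nonzero. Applied both to the structure constants and to the values of the functionals.\<close>

lemma triangular_convergent:
  fixes v :: "nat \<Rightarrow> (nat \<Rightarrow> nat) \<Rightarrow> (nat \<Rightarrow> nat) \<Rightarrow> complex"
  assumes tri: "\<And>N \<nu> \<rho>. \<nu> \<in> parts_le d \<Longrightarrow> \<rho> \<in> parts_le d \<Longrightarrow> \<not> part_subseteq \<rho> \<nu> \<Longrightarrow> v N \<nu> \<rho> = 0"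
    and sys: "\<And>\<nu>. \<nu> \<in> parts_le d \<Longrightarrow> \<forall>\<^sub>F N in sequentially. (\<Sum>\<rho>\<in>parts_le d. v N \<nu> \<rho> * C N \<rho>) = b N \<nu>"
    and v: "\<And>\<nu> \<rho>. \<nu> \<in> parts_le d \<Longrightarrow> \<rho> \<in> parts_le d \<Longrightarrow> (\<lambda>N. v N \<nu> \<rho>) \<longlonglongrightarrow> v0 \<nu> \<rho>"
    and b: "\<And>\<nu>. \<nu> \<in> parts_le d \<Longrightarrow> (\<lambda>N. b N \<nu>) \<longlonglongrightarrow> b0 \<nu>"
    and diag: "\<And>\<nu>. \<nu> \<in> parts_le d \<Longrightarrow> v0 \<nu> \<nu> \<noteq> 0"
    and \<nu>: "\<nu> \<in> parts_le d"
  shows "convergent (\<lambda>N. C N \<nu>)"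
  using \<nu>
proof (induction "part_size \<nu>" arbitrary: \<nu> rule: less_induct)
  case less
  let ?T = "{\<rho> \<in> parts_le d. part_subseteq \<rho> \<nu> \<and> \<rho> \<noteq> \<nu>}"
  have lt: "part_size \<rho> < part_size \<nu>" if "\<rho> \<in> ?T" for \<rho>
  proof (rule ccontr)
    assume "\<not> part_size \<rho> < part_size \<nu>"
    then have "\<rho> = \<nu>"
      using that less.prems by (intro part_subseteq_size_eq) (auto simp: parts_le_def)
    then show False using that by blast
  qed
  have "\<exists>x. (\<lambda>N. C N \<rho>) \<longlonglongrightarrow> x" if "\<rho> \<in> ?T" for \<rho>
    using less.hyps[OF lt[OF that]] that unfolding convergent_def by blast
  then have "\<forall>\<rho>\<in>?T. \<exists>x. (\<lambda>N. C N \<rho>) \<longlonglongrightarrow> x" by blast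
  from bchoice[OF this] obtain x where x: "\<And>\<rho>. \<rho> \<in> ?T \<Longrightarrow> (\<lambda>N. C N \<rho>) \<longlonglongrightarrow> x \<rho>" by blast
  have split: "(\<Sum>\<rho>\<in>parts_le d. v N \<nu> \<rho> * C N \<rho>) = v N \<nu> \<nu> * C N \<nu> + (\<Sum>\<rho>\<in>?T. v N \<nu> \<rho> * C N \<rho>)" for N
  proof -
    have "(\<Sum>\<rho>\<in>parts_le d. v N \<nu> \<rho> * C N \<rho>) = (\<Sum>\<rho>\<in>insert \<nu> ?T. v N \<nu> \<rho> * C N \<rho>)"
    proof (intro sum.mono_neutral_right ballI)
      fix \<rho> assume "\<rho> \<in> parts_le d - insert \<nu> ?T"
      then show "v N \<nu> \<rho> * C N \<rho> = 0"
        using tri[OF less.prems, of \<rho> N] by auto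
    qed (use less.prems in auto)
    then show ?thesis by simp
  qed
  have "\<forall>\<^sub>F N in sequentially. v N \<nu> \<nu> \<noteq> 0"
    by (rule tendsto_imp_eventually_ne[OF v[OF less.prems less.prems] diag[OF less.prems]])
  then have "\<forall>\<^sub>F N in sequentially. (b N \<nu> - (\<Sum>\<rho>\<in>?T. v N \<nu> \<rho> * C N \<rho>)) / v N \<nu> \<nu> = C N \<nu>"
    using sys[OF less.prems]
  proof eventually_elim
    case (elim N)
    from elim(2) have "b N \<nu> - (\<Sum>\<rho>\<in>?T. v N \<nu> \<rho> * C N \<rho>) = v N \<nu> \<nu> * C N \<nu>"
      unfolding split by (simp add: algebra_simps)
    then show ?case using elim(1) by simp
  qed
  moreover have "(\<lambda>N. (b N \<nu> - (\<Sum>\<rho>\<in>?T. v N \<nu> \<rho> * C N \<rho>)) / v N \<nu> \<nu>) \<longlonglongrightarrow>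
      (b0 \<nu> - (\<Sum>\<rho>\<in>?T. v0 \<nu> \<rho> * x \<rho>)) / v0 \<nu> \<nu>"
    by (intro tendsto_divide tendsto_diff tendsto_sum tendsto_mult x v b diag less.prems) auto
  ultimately show ?case
    by (intro convergentI[OF Lim_transform_eventually[rotated]])
qed

lemma triangular_unique:
  fixes v0 :: "(nat \<Rightarrow> nat) \<Rightarrow> (nat \<Rightarrow> nat) \<Rightarrow> complex"
  assumes tri: "\<And>\<nu> \<rho>. \<nu> \<in> parts_le d \<Longrightarrow> \<rho> \<in> parts_le d \<Longrightarrow> \<not> part_subseteq \<rho> \<nu> \<Longrightarrow> v0 \<nu> \<rho> = 0"
    and diag: "\<And>\<nu>. \<nu> \<in> parts_le d \<Longrightarrow> v0 \<nu> \<nu> \<noteq> 0"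
    and sys: "\<And>\<nu>. \<nu> \<in> parts_le d \<Longrightarrow> (\<Sum>\<rho>\<in>parts_le d. v0 \<nu> \<rho> * C \<rho>) = (\<Sum>\<rho>\<in>parts_le d. v0 \<nu> \<rho> * C' \<rho>)"
    and \<nu>: "\<nu> \<in> parts_le d"
  shows "C \<nu> = C' \<nu>"
  using \<nu>
proof (induction "part_size \<nu>" arbitrary: \<nu> rule: less_induct)
  case less
  have "0 = (\<Sum>\<rho>\<in>parts_le d. v0 \<nu> \<rho> * (C \<rho> - C' \<rho>))"
    using sys[OF less.prems] by (simp add: right_diff_distrib sum_subtractf)
  also have "\<dots> = (\<Sum>\<rho>\<in>{\<nu>}. v0 \<nu> \<rho> * (C \<rho> - C' \<rho>))"
  proof (intro sum.mono_neutral_right ballI)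
    fix \<rho> assume \<rho>: "\<rho> \<in> parts_le d - {\<nu>}"
    show "v0 \<nu> \<rho> * (C \<rho> - C' \<rho>) = 0"
    proof (cases "part_subseteq \<rho> \<nu>")
      case True
      then have "part_size \<rho> < part_size \<nu>"
        using part_subseteq_size_eq[of \<rho> \<nu>] less.prems \<rho> by (force simp: parts_le_def)
      then show ?thesis using less.hyps \<rho> by simp
    qed (use tri less.prems \<rho> in simp)
  qed (use less.prems in auto)
  finally show ?case using diag[OF less.prems] by simp
qed

subsection \<open>Askey--Wilson polynomials\<close>

lemma qpoch_0 [simp]: "qpoch x q 0 = 1"
  by (simp add: qpoch_def)

lemma qpoch_Suc: "qpoch x q (Suc n) = qpoch x q n * (1 - x * q ^ n)"
  by (simp add: qpoch_def)

lemma qpoch_Suc_shift: "qpoch x q (Suc n) = (1 - x) * qpoch (x * q) q n"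
  unfolding qpoch_def prod.lessThan_Suc_shift by (simp add: mult.assoc)

text \<open>
  The monic Askey--Wilson polynomial of degree \<open>n\<close>, in the variable \<open>a\<inverse> (z + z\<inverse>)\<close>, is the sum of
  \<open>aw_coeff n m\<close> times the product of the \<open>y - (q\<^sup>-\<^sup>i + \<theta> q\<^sup>i)\<close> over \<open>i < m\<close>. Its parameters are
  \<open>a\<close>, \<open>a b\<^sub>1\<close>, \<open>a b\<^sub>2\<close>, \<open>a b\<^sub>3\<close>, and \<open>\<theta>\<close> is \<open>a\<^sup>2\<close>, so that no square root is needed.
\<close>

definition aw_coeff :: "complex \<Rightarrow> complex \<Rightarrow> complex \<Rightarrow> complex \<Rightarrow> complex \<Rightarrow> nat \<Rightarrow> nat \<Rightarrow> complex" where
  "aw_coeff q \<theta> b1 b2 b3 n m =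
     (if m \<le> n
      then inverse q ^ (m * (n - m)) * (qpoch (\<theta> * b1 * q ^ m) q (n - m) * qpoch (\<theta> * b2 * q ^ m) q (n - m) *
        qpoch (\<theta> * b3 * q ^ m) q (n - m)) * qpoch q q n /
        (qpoch q q (n - m) * qpoch q q m *
         qpoch (\<theta>^2 * b1 * b2 * b3 * q powi (int n + int m - 1)) q (n - m))
      else 0)"

definition aw_A :: "complex \<Rightarrow> complex \<Rightarrow> complex \<Rightarrow> complex \<Rightarrow> complex \<Rightarrow> nat \<Rightarrow> complex" where
  "aw_A q \<theta> b1 b2 b3 n = (let T = \<theta>^2 * b1 * b2 * b3 in
     (1 - \<theta> * b1 * q ^ n) * (1 - \<theta> * b2 * q ^ n) * (1 - \<theta> * b3 * q ^ n) * (1 - T * q powi (int n - 1)) /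
     ((1 - T * q powi (2 * int n - 1)) * (1 - T * q powi (2 * int n))))"

definition aw_C :: "complex \<Rightarrow> complex \<Rightarrow> complex \<Rightarrow> complex \<Rightarrow> complex \<Rightarrow> nat \<Rightarrow> complex" where
  "aw_C q \<theta> b1 b2 b3 n = (let T = \<theta>^2 * b1 * b2 * b3; W = q powi (int n - 1) in
     \<theta> * (1 - q ^ n) * ((1 - \<theta> * b1 * b2 * W) * (1 - \<theta> * b1 * b3 * W) * (1 - \<theta> * b2 * b3 * W)) /
     ((1 - T * q powi (2 * int n - 2)) * (1 - T * q powi (2 * int n - 1))))"

text \<open>For n > 0 this is \<open>aw_A\<close> at n - 1 times \<open>aw_C\<close> at n.\<close>

definition aw_gamma :: "complex \<Rightarrow> complex \<Rightarrow> complex \<Rightarrow> complex \<Rightarrow> complex \<Rightarrow> nat \<Rightarrow> complex" where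
  "aw_gamma q \<theta> b1 b2 b3 n = (let T = \<theta>^2 * b1 * b2 * b3; W = q powi (int n - 1) in
     \<theta> * (1 - q ^ n) * (1 - T * q powi (int n - 2)) *
     ((1 - \<theta> * b1 * W) * (1 - \<theta> * b2 * W) * (1 - \<theta> * b3 * W)) *
     ((1 - \<theta> * b1 * b2 * W) * (1 - \<theta> * b1 * b3 * W) * (1 - \<theta> * b2 * b3 * W)) /
     ((1 - T * q powi (2 * int n - 3)) * (1 - T * q powi (2 * int n - 2)) ^ 2 * (1 - T * q powi (2 * int n - 1))))"

text \<open>What remains of the recurrence once \<open>aw_combine\<close> has divided out all common
  factors. Here p stands for the inverse of q, Y for \<theta> q^(m-1) and Z for q^(n-m+1).\<close>

lemma aw_core:
  fixes Y Z p q b1 b2 b3 t :: complex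
  assumes "p * q = 1" and t: "t = b1 * b2 * b3 * Y^2 * Z * p"
  shows "Z * ((1 - b1 * Y) * (1 - b2 * Y) * (1 - b3 * Y)) * (1 - t * Z) + (1 - q * Y) * (1 - t) * (1 - t * Z) * (1 - Z)
    = (1 - t) * ((1 - b1 * Y * Z) * (1 - b2 * Y * Z) * (1 - b3 * Y * Z))
      - q * Y * (1 - Z) * ((1 - b1 * b2 * Y * Z * p) * (1 - b1 * b3 * Y * Z * p) * (1 - b2 * b3 * Y * Z * p))"
proof -
  have "p \<noteq> 0" using assms(1) by auto
  then have q: "q = 1 / p" using assms(1) by (simp add: nonzero_eq_divide_eq mult.commute)
  show ?thesis unfolding t q using \<open>p \<noteq> 0\<close>
    by (simp add: field_simps power2_eq_square)
qed

text \<open>\<open>K1\<close>, \<open>K\<close>, \<open>K3\<close>, \<open>K5\<close> stand for the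
  coefficients at (n, m-1), (n, m), (n+1, m), (n-1, m), brought over one denominator D. By
  \<open>pA\<close> the contribution of A merges with that of \<open>K3\<close>, by
  \<open>pC\<close> that of C with that of \<open>K5\<close>; then (1 - X) d0 d2 factors out and
  \<open>core\<close> is left. Opaque names keep the polynomials small.\<close>

lemma aw_combine:
  fixes K1 K K3 K5 :: complex
  assumes e1: "K1 * D * (1 - Z) * X = U * (Z * Bp * (1 - X) * d1 * d2)"
    and e2: "K * D = U * ((1 - t) * d1 * d2)"
    and e3: "K3 * D * (1 - Z) * X = U * (BR * xz * (1 - t) * tq)"
    and e5: "g * K5 * D * d0 = U * (X * w * \<theta> * E * d2)"
    and A: "A * (d1 * d2) = BR * TW" and C: "C * (d0 * d1) = \<theta> * xr * E"
    and y: "y * X = 1 + \<theta> * X^2"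
    and pA: "xz * tq - (1 - Z) * X * TW = (1 - X) * d2"
    and pC: "X * w - xr * (1 - t) = (X - 1) * d0"
    and core: "Z * Bp * d1 + (1 - \<theta> * X) * (1 - t) * d1 * (1 - Z) = (1 - t) * BR - \<theta> * X * (1 - Z) * E"
    and nz: "D \<noteq> 0" "1 - Z \<noteq> 0" "X \<noteq> 0" "d0 \<noteq> 0"
  shows "K1 + y * K = K3 + (1 + \<theta> - A - C) * K + g * K5"
proof -
  have "(K1 + y * K - K3 - (1 + \<theta> - A - C) * K - g * K5) * (D * (1 - Z) * X * d0) =
      (K1 * D * (1 - Z) * X) * d0 + (y * X) * (K * D) * (1 - Z) * d0 - (K3 * D * (1 - Z) * X) * d0
      - (1 + \<theta> - A - C) * (K * D) * (1 - Z) * X * d0 - (g * K5 * D * d0) * (1 - Z) * X"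
    by (simp add: algebra_simps)
  also have "\<dots> = U * (Z * Bp * (1 - X) * d1 * d2 * d0 + (1 + \<theta> * X^2) * (1 - t) * d1 * d2 * (1 - Z) * d0
      - BR * xz * (1 - t) * tq * d0 - (1 + \<theta>) * (1 - t) * d1 * d2 * (1 - Z) * X * d0
      + (A * (d1 * d2)) * (1 - t) * (1 - Z) * X * d0 + (C * (d0 * d1)) * (1 - t) * d2 * (1 - Z) * X
      - X * w * \<theta> * E * d2 * (1 - Z) * X)"
    unfolding e1 e2 e3 e5 y by (simp add: algebra_simps)
  also have "\<dots> = U * (Z * Bp * (1 - X) * d1 * d2 * d0 + (1 - X) * (1 - \<theta> * X) * (1 - t) * d1 * d2 * (1 - Z) * d0
      - BR * (1 - t) * d0 * (xz * tq - (1 - Z) * X * TW) - \<theta> * E * d2 * (1 - Z) * X * (X * w - xr * (1 - t)))"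
    unfolding A C by (simp add: algebra_simps power2_eq_square)
  also have "\<dots> = U * ((1 - X) * d0 * d2 * ((Z * Bp * d1 + (1 - \<theta> * X) * (1 - t) * d1 * (1 - Z))
      - ((1 - t) * BR - \<theta> * X * (1 - Z) * E)))"
    unfolding pA pC by (simp add: algebra_simps)
  also have "\<dots> = 0" unfolding core by simp
  finally have "K1 + y * K - K3 - (1 + \<theta> - A - C) * K - g * K5 = 0"
    using nz by simp
  then show ?thesis by (simp add: algebra_simps)
qed

lemma frac1:
  fixes x :: complex
  assumes "x \<noteq> 0"
  shows "(a * Z) * (P * B) * n / ((r * z) * m * G) = (a * P * n / (r * (m * x))) * (Z * B * x / (z * G))"
  using assms by (simp add: divide_simps)

lemma frac2:
  fixes x y :: complex
  assumes "x \<noteq> 0" "y \<noteq> 0"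
  shows "a * X * P * n / (r * m * G) = (a * P * (n * y) / ((r * x) * m)) * (X * x / (y * G))"
  using assms by (simp add: divide_simps)

context
  fixes q \<theta> b1 b2 b3 T :: complex
  assumes q0: "q \<noteq> 0" and q1: "\<And>k. k > 0 \<Longrightarrow> q ^ k \<noteq> 1"
    and T: "T = \<theta>^2 * b1 * b2 * b3" and Tq: "\<And>k. T * q powi k \<noteq> 1"
begin

lemma qpoch_q_nonzero: "qpoch q q n \<noteq> 0"
  using q1[of "Suc _"] by (auto simp: qpoch_def prod_zero_iff)

lemma powi_add_nat: "q powi (k + int n) = q powi k * q ^ n"
  using q0 by (simp add: power_int_add)

lemma qpoch_T_nonzero: "qpoch (T * q powi k) q n \<noteq> 0"
  using Tq[of "k + int _"] by (auto simp: qpoch_def prod_zero_iff powi_add_nat mult.assoc)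

lemma aw_coeff_diag [simp]: "aw_coeff q \<theta> b1 b2 b3 n n = 1"
  using qpoch_q_nonzero by (simp add: aw_coeff_def)

lemma aw_recurrence_aux:
  fixes m r :: nat
  defines "n \<equiv> m + r"
  shows "(if m = 0 then 0 else aw_coeff q \<theta> b1 b2 b3 n (m - 1)) +
      (inverse q ^ m + \<theta> * q ^ m) * aw_coeff q \<theta> b1 b2 b3 n m =
    aw_coeff q \<theta> b1 b2 b3 (Suc n) m +
    (1 + \<theta> - aw_A q \<theta> b1 b2 b3 n - aw_C q \<theta> b1 b2 b3 n) * aw_coeff q \<theta> b1 b2 b3 n m +
    aw_gamma q \<theta> b1 b2 b3 n * (if r = 0 then 0 else aw_coeff q \<theta> b1 b2 b3 (n - 1) m)"
proof -
  define p where "p = inverse q"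
  have pq: "p * q = 1" using q0 by (simp add: p_def)
  define X where "X = q ^ m"
  define R where "R = q ^ r"
  define Z where "Z = q * R"
  define W where "W = q powi (int n - 1)"
  define t where "t = T * q powi (int n + int m - 2)"
  define P where "P = qpoch (\<theta> * b1 * X) q r * qpoch (\<theta> * b2 * X) q r * qpoch (\<theta> * b3 * X) q r"
  define U where "U = p ^ (m * r) * P * qpoch q q n / (qpoch q q r * qpoch q q m)"
  \<comment> \<open>The denominators in T of the four coefficients are (tq;q)_r, (tq^2;q)_(r+1),
    (t;q)_(r+1) and (t;q)_(r-1), all of them sections of this product.\<close>
  define D where "D = qpoch t q (Suc (Suc (Suc r)))"
  define B where "B v = (1 - \<theta> * b1 * v) * (1 - \<theta> * b2 * v) * (1 - \<theta> * b3 * v)" for v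
  define E where "E v = (1 - \<theta> * b1 * b2 * v) * (1 - \<theta> * b1 * b3 * v) * (1 - \<theta> * b2 * b3 * v)" for v
  define d where "d k = 1 - t * q ^ k" for k
  have X0: "X \<noteq> 0" and XR: "X * R = q ^ n" using q0 by (simp_all add: X_def R_def n_def power_add)
  have pX: "p ^ m * X = 1" using q0 by (simp add: p_def X_def power_mult_distrib[symmetric])
  have W: "W = X * R * p"
  proof -
    have "W * q = q ^ n"
      unfolding W_def using powi_add_nat[of "int n - 1" 1] by simp
    moreover have "W = (W * q) * p" using pq by (simp add: mult_ac)
    ultimately show ?thesis unfolding XR by simp
  qed
  have tq: "t * q ^ k = T * q powi (int n + int m - 2 + int k)" for k
    unfolding t_def powi_add_nat by simp
  have d_nz: "d k \<noteq> 0" for k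
    unfolding d_def tq using Tq by simp
  have tW: "t = T * W * X * p"
  proof -
    have "W * X = q powi (int n + int m - 2 + 1)"
      unfolding W_def X_def powi_add_nat[symmetric] by (simp add: algebra_simps)
    also have "\<dots> = q powi (int n + int m - 2) * q"
      using powi_add_nat[of "int n + int m - 2" 1] by simp
    finally have "T * W * X * p = T * q powi (int n + int m - 2) * (p * q)"
      by (simp add: mult_ac)
    then show ?thesis by (simp only: pq t_def mult_1_right)
  qed
  have D_nz: "D \<noteq> 0"
    unfolding D_def t_def by (rule qpoch_T_nonzero)
  have Z1: "1 - Z \<noteq> 0"
    using q1[of "Suc r"] by (simp add: Z_def R_def)
  have tT: "t * q ^ Suc r = T * q powi (2 * int n - 1)" "t * q ^ Suc (Suc r) = T * q powi (2 * int n)"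
    "t * q ^ r = T * q powi (2 * int n - 2)"
    unfolding tq n_def by (rule arg_cong[where f = "\<lambda>k. T * q powi k"], simp)+
  have coeff: "aw_coeff q \<theta> b1 b2 b3 n m = U / qpoch (t * q) q r"
    using tq[of 1] by (simp add: aw_coeff_def n_def U_def P_def X_def p_def T[symmetric])
  have e2: "aw_coeff q \<theta> b1 b2 b3 n m * D = U * ((1 - t) * d (Suc r) * d (Suc (Suc r)))"
  proof -
    have "qpoch (t * q) q r \<noteq> 0"
      using qpoch_T_nonzero[of "int n + int m - 2 + int 1" r] tq[of 1] by simp
    moreover have "D = (1 - t) * (qpoch (t * q) q r * d (Suc r) * d (Suc (Suc r)))"
      unfolding D_def qpoch_Suc_shift[of t] unfolding qpoch_Suc by (simp add: d_def mult_ac)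
    ultimately show ?thesis unfolding coeff by simp
  qed
  have e3: "aw_coeff q \<theta> b1 b2 b3 (Suc n) m * D * (1 - Z) * X =
      U * (B (X * R) * (1 - X * Z) * (1 - t) * (1 - t * q))"
  proof -
    define G where "G = qpoch (t * q * q) q (Suc r)"
    have tqq: "T * q powi (int (Suc n) + int m - 1) = t * q * q"
      using tq[of 2] by (simp add: power2_eq_square mult.assoc algebra_simps)
    have G: "G \<noteq> 0"
      unfolding G_def tqq[symmetric] by (rule qpoch_T_nonzero)
    have DG: "D = (1 - t) * (1 - t * q) * G"
      unfolding D_def G_def qpoch_Suc_shift[of t] qpoch_Suc_shift[of "t * q"] by (simp add: mult.assoc)
    have "aw_coeff q \<theta> b1 b2 b3 (Suc n) m = p ^ (m * Suc r) * (P * B (X * R)) * (qpoch q q n * (1 - X * Z)) /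
        ((qpoch q q r * (1 - Z)) * qpoch q q m * G)"
      unfolding aw_coeff_def T[symmetric] tqq
      by (simp add: n_def G_def P_def B_def X_def R_def Z_def p_def qpoch_Suc power_add mult_ac)
    also have "\<dots> = U * (p ^ m * (B (X * R) * (1 - X * Z)) / ((1 - Z) * G))"
      by (simp add: U_def power_add field_simps)
    finally have "aw_coeff q \<theta> b1 b2 b3 (Suc n) m * D * (1 - Z) * X =
        U * (B (X * R) * (1 - X * Z) * (1 - t) * (1 - t * q)) * (p ^ m * X)"
      unfolding DG using G Z1 by simp
    then show ?thesis unfolding pX by simp
  qed
  \<comment> \<open>The boundary cases are consistent: for m = 0 the right-hand side contains 1 - X
    = 0, and in \<open>e5\<close> for r = 0 it contains 1 - R = 0.\<close>
  have e1: "(if m = 0 then 0 else aw_coeff q \<theta> b1 b2 b3 n (m - 1)) * D * (1 - Z) * X =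
      U * (Z * B (X * p) * (1 - X) * d (Suc r) * d (Suc (Suc r)))"
  proof (cases m)
    case 0
    then show ?thesis by (simp add: X_def)
  next
    case (Suc m')
    define G where "G = qpoch t q (Suc r)"
    have G: "G \<noteq> 0"
      unfolding G_def t_def by (rule qpoch_T_nonzero)
    have DG: "D = G * d (Suc r) * d (Suc (Suc r))"
      unfolding D_def G_def qpoch_Suc[of t q "Suc _"] by (simp add: d_def)
    have Xp: "X * p = q ^ m'" using pq by (simp add: X_def Suc mult_ac)
    have tm: "T * q powi (int n + int m' - 1) = t"
      unfolding t_def Suc by (rule arg_cong[where f = "\<lambda>k. T * q powi k"]) simp
    have qm: "qpoch q q m = qpoch q q m' * (1 - X)"
      by (simp add: Suc qpoch_Suc X_def)
    have nz: "1 - X \<noteq> 0" using q1[of m] Suc by (simp add: X_def)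
    have n': "n - m' = Suc r" "m' \<le> n" by (simp_all add: n_def Suc)
    have sh: "qpoch (\<theta> * b * q ^ m') q (Suc r) = (1 - \<theta> * b * (X * p)) * qpoch (\<theta> * b * X) q r" for b
      unfolding qpoch_Suc_shift Xp by (simp add: X_def Suc mult_ac)
    have "aw_coeff q \<theta> b1 b2 b3 n m' = p ^ (m' * Suc r) * (P * B (X * p)) * qpoch q q n /
        ((qpoch q q r * (1 - Z)) * qpoch q q m' * G)"
      unfolding aw_coeff_def T[symmetric] tm n'(1) sh using n'(2)
      by (simp add: G_def P_def B_def Z_def R_def p_def qpoch_Suc[of q] mult_ac)
    moreover have "p ^ (m' * Suc r) * X = p ^ (m * r) * Z"
    proof -
      have "p ^ (m' * Suc r) * X = p ^ (m' * r) * (p ^ m' * q ^ m') * q"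
        by (simp add: X_def Suc power_add mult_ac)
      also have "p ^ m' * q ^ m' = p ^ r * q ^ r"
        by (simp add: power_mult_distrib[symmetric] pq)
      also have "p ^ (m' * r) * (p ^ r * q ^ r) * q = p ^ (m * r) * Z"
        by (simp add: Suc power_add Z_def R_def mult_ac)
      finally show ?thesis .
    qed
    ultimately have "aw_coeff q \<theta> b1 b2 b3 n m' * X = (p ^ (m * r) * Z) * (P * B (X * p)) * qpoch q q n /
        ((qpoch q q r * (1 - Z)) * qpoch q q m' * G)"
      by (simp add: mult_ac)
    also have "\<dots> = U * (Z * B (X * p) * (1 - X) / ((1 - Z) * G))"
      unfolding U_def qm by (rule frac1) (use nz in simp)
    finally have "aw_coeff q \<theta> b1 b2 b3 n m' * X * (D * (1 - Z)) =
        U * (Z * B (X * p) * (1 - X) * d (Suc r) * d (Suc (Suc r)))"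
      unfolding DG using G Z1 by simp
    then show ?thesis using Suc by (simp add: mult_ac)
  qed
  have e5: "aw_gamma q \<theta> b1 b2 b3 n * (if r = 0 then 0 else aw_coeff q \<theta> b1 b2 b3 (n - 1) m) * D * d r =
      U * (X * ((1 - R) * (1 - T * W * p)) * \<theta> * E W * d (Suc (Suc r)))"
  proof (cases r)
    case 0
    then show ?thesis by (simp add: R_def)
  next
    case (Suc r')
    define G where "G = qpoch t q r'"
    have G: "G \<noteq> 0"
      unfolding G_def t_def by (rule qpoch_T_nonzero)
    have DG: "D = G * d r' * d r * d (Suc r) * d (Suc (Suc r))"
      unfolding D_def Suc G_def qpoch_Suc[of t] by (simp add: d_def mult_ac)
    have "int n - 1 = int (m + r')" by (simp add: n_def Suc)
    then have "W = q ^ (m + r')"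
      unfolding W_def by (simp only: power_int_of_nat)
    then have Wn: "W = q ^ m * q ^ r'" by (simp add: power_add)
    have n': "n - 1 - m = r'" "m \<le> n - 1" "n = Suc (n - 1)" by (simp_all add: n_def Suc)
    have tm: "T * q powi (int (n - 1) + int m - 1) = t"
      unfolding t_def n_def Suc by (rule arg_cong[where f = "\<lambda>k. T * q powi k"]) simp
    have R1: "1 - R \<noteq> 0" using q1[of r] Suc by (simp add: R_def)
    have XR1: "1 - X * R \<noteq> 0" using q1[of n] Suc by (simp add: XR n_def)
    have tT': "t * q ^ r' = T * q powi (2 * int n - 3)" "T * W * p = T * q powi (int n - 2)"
    proof -
      show "t * q ^ r' = T * q powi (2 * int n - 3)"
        unfolding tq n_def Suc by (rule arg_cong[where f = "\<lambda>k. T * q powi k"]) simp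
      have "W = q powi (int n - 2) * q"
        unfolding W_def using powi_add_nat[of "int n - 2" 1] by simp
      then have "W * p = q powi (int n - 2) * (p * q)" by (simp add: mult_ac)
      then show "T * W * p = T * q powi (int n - 2)" unfolding pq by (simp add: mult.assoc)
    qed
    have PB: "P = qpoch (\<theta> * b1 * X) q r' * qpoch (\<theta> * b2 * X) q r' * qpoch (\<theta> * b3 * X) q r' * B W"
      unfolding P_def Suc qpoch_Suc B_def Wn X_def by (simp add: mult_ac)
    have qr: "qpoch q q r = qpoch q q r' * (1 - R)" and qn: "qpoch q q n = qpoch q q (n - 1) * (1 - X * R)"
      unfolding XR by (simp add: Suc qpoch_Suc R_def, subst n'(3), subst (2) n'(3), simp add: qpoch_Suc)
    \<comment> \<open>The factor \<open>B W\<close> is supplied by \<open>aw_gamma\<close>;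
      multiplying by it, instead of dividing \<open>P\<close> by it, covers the case in which it
      vanishes.\<close>
    have "B W * aw_coeff q \<theta> b1 b2 b3 (n - 1) m = p ^ (m * r') * P * qpoch q q (n - 1) /
        (qpoch q q r' * qpoch q q m * G)"
      unfolding aw_coeff_def T[symmetric] tm n'(1) PB using n'(2) by (simp add: G_def p_def X_def mult_ac)
    also have "p ^ (m * r') = p ^ (m * r') * (p ^ m * X)" unfolding pX by simp
    also have "\<dots> = p ^ (m * r) * X" by (simp add: Suc power_add mult_ac)
    also have "p ^ (m * r) * X * P * qpoch q q (n - 1) / (qpoch q q r' * qpoch q q m * G) =
        U * (X * (1 - R) / ((1 - X * R) * G))"
      unfolding U_def qr qn by (rule frac2[OF R1 XR1])
    finally have BK: "B W * aw_coeff q \<theta> b1 b2 b3 (n - 1) m = U * (X * (1 - R) / ((1 - X * R) * G))" .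
    have g: "aw_gamma q \<theta> b1 b2 b3 n = \<theta> * (1 - X * R) * (1 - T * W * p) * B W * E W / (d r' * d r ^ 2 * d (Suc r))"
      unfolding aw_gamma_def Let_def T[symmetric] W_def[symmetric] tT(1)[symmetric] tT(3)[symmetric]
        tT'(1)[symmetric] tT'(2)[symmetric] XR d_def B_def E_def by simp
    have "aw_gamma q \<theta> b1 b2 b3 n * aw_coeff q \<theta> b1 b2 b3 (n - 1) m * D * d r =
        \<theta> * (1 - X * R) * (1 - T * W * p) * E W / (d r' * d r ^ 2 * d (Suc r)) *
        (B W * aw_coeff q \<theta> b1 b2 b3 (n - 1) m) * D * d r"
      unfolding g by simp
    also have "\<dots> = U * (X * ((1 - R) * (1 - T * W * p)) * \<theta> * E W * d (Suc (Suc r)))"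
      unfolding BK DG using G XR1 d_nz[of r] d_nz[of r'] d_nz[of "Suc r"]
      by (simp add: power2_eq_square)
    finally show ?thesis using Suc by simp
  qed
  have A: "aw_A q \<theta> b1 b2 b3 n * (d (Suc r) * d (Suc (Suc r))) = B (X * R) * (1 - T * W)"
    using d_nz[of "Suc r"] d_nz[of "Suc (Suc r)"]
    unfolding aw_A_def Let_def T[symmetric] tT(1)[symmetric] tT(2)[symmetric] W_def[symmetric] d_def XR B_def
    by simp
  have C: "aw_C q \<theta> b1 b2 b3 n * (d r * d (Suc r)) = \<theta> * (1 - X * R) * E W"
    using d_nz[of "Suc r"] d_nz[of r]
    unfolding aw_C_def Let_def T[symmetric] tT(1)[symmetric] tT(3)[symmetric] W_def[symmetric] d_def XR E_def
    by simp
  have y: "(p ^ m + \<theta> * q ^ m) * X = 1 + \<theta> * X ^ 2"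
    using pX unfolding X_def by (simp add: algebra_simps power2_eq_square)
  have dR: "d r = 1 - t * R" "d (Suc r) = 1 - t * Z" "d (Suc (Suc r)) = 1 - t * Z * q"
    by (simp_all add: d_def R_def Z_def mult_ac)
  have tqW: "t * q = T * W * X" unfolding tW using pq by (simp add: mult_ac)
  have WXR: "W * q = X * R" unfolding W using pq by (simp add: mult_ac)
  have pA: "(1 - X * Z) * (1 - t * q) - (1 - Z) * X * (1 - T * W) = (1 - X) * d (Suc (Suc r))"
  proof -
    have XTW: "X * (T * W) = t * q" unfolding tqW by (simp add: mult_ac)
    have "(1 - X * Z) * (1 - t * q) - (1 - Z) * X * (1 - T * W) =
        1 - t * q - X * Z + X * Z * (t * q) - X + X * (T * W) + Z * X - Z * (X * (T * W))"
      by (simp add: algebra_simps)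
    also have "\<dots> = (1 - X) * (1 - t * Z * q)"
      unfolding XTW by (simp add: algebra_simps)
    finally show ?thesis unfolding dR .
  qed
  have pC: "X * ((1 - R) * (1 - T * W * p)) - (1 - X * R) * (1 - t) = (X - 1) * d r"
    unfolding dR tW by (simp add: algebra_simps)
  have core: "Z * B (X * p) * d (Suc r) + (1 - \<theta> * X) * (1 - t) * d (Suc r) * (1 - Z) =
      (1 - t) * B (X * R) - \<theta> * X * (1 - Z) * E W"
  proof -
    have t: "t = b1 * b2 * b3 * (\<theta> * X * p)^2 * Z * p"
      unfolding tW W T Z_def using pq by (simp add: power2_eq_square mult_ac)
    define Y where "Y = \<theta> * X * p"
    have 1: "\<theta> * X = q * Y" "\<theta> * b * (X * R) = b * Y * Z"
      "\<theta> * b * b' * W = b * b' * Y * Z * p" "\<theta> * b * (X * p) = b * Y" for b b'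
      unfolding W Z_def Y_def using pq by (simp_all add: mult_ac)
    show ?thesis
      using aw_core[OF pq t[folded Y_def]] unfolding B_def E_def dR 1 .
  qed
  show ?thesis
    using aw_combine[OF e1 e2 e3 e5 A C y pA pC core D_nz Z1 X0 d_nz[of r]] unfolding p_def .
qed

theorem aw_recurrence:
  assumes "m \<le> Suc n"
  shows "(if m = 0 then 0 else aw_coeff q \<theta> b1 b2 b3 n (m - 1)) +
      (inverse q ^ m + \<theta> * q ^ m) * aw_coeff q \<theta> b1 b2 b3 n m =
    aw_coeff q \<theta> b1 b2 b3 (Suc n) m +
    (1 + \<theta> - aw_A q \<theta> b1 b2 b3 n - aw_C q \<theta> b1 b2 b3 n) * aw_coeff q \<theta> b1 b2 b3 n m +
    aw_gamma q \<theta> b1 b2 b3 n * (if n = 0 then 0 else aw_coeff q \<theta> b1 b2 b3 (n - 1) m)"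
proof (cases "m = Suc n")
  case True
  have "aw_coeff q \<theta> b1 b2 b3 n (Suc n) = 0" "aw_coeff q \<theta> b1 b2 b3 (n - 1) (Suc n) = 0"
    by (simp_all add: aw_coeff_def)
  then show ?thesis using True by simp
next
  case False
  then obtain r where r: "n = m + r" using assms by (metis le_SucE le_Suc_ex)
  have "(if n = 0 then 0 else aw_coeff q \<theta> b1 b2 b3 (n - 1) m) =
      (if r = 0 then 0 else aw_coeff q \<theta> b1 b2 b3 (n - 1) m)"
    unfolding r by (auto simp: aw_coeff_def)
  then show ?thesis
    using aw_recurrence_aux[of m r] unfolding r by simp
qed

end

subsection \<open>Orthogonality for finitely many variables\<close>

text \<open>The moments, with respect to the products of the x - c_r, of the functional that sends
  the n-th polynomial to 1 for n = 0 and to 0 otherwise.\<close>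

fun tri_solve :: "(nat \<Rightarrow> nat \<Rightarrow> complex) \<Rightarrow> nat \<Rightarrow> complex" where
  "tri_solve K n = (if n = 0 then 1 else 0) - (\<Sum>m<n. K n m * tri_solve K m)"

declare tri_solve.simps [simp del]

lemma det_mat_transpose: "det (mat n n (\<lambda>(i, j). f j i)) = det (mat n n (\<lambda>(i, j). f i j :: 'a :: comm_ring_1))"
proof -
  have "transpose_mat (mat n n (\<lambda>(i, j). f i j)) = mat n n (\<lambda>(i, j). f j i)"
    by (rule eq_matI) auto
  then show ?thesis
    using det_transpose[of "mat n n (\<lambda>(i, j). f i j)" n] by simp
qed

lemma det_mat_perm_sum:
  "det (mat n n (\<lambda>(i, j). f i j)) = (\<Sum>p | p permutes {0..<n}. signof p * (\<Prod>j = 0..<n. f (p j) j :: 'a :: comm_ring_1))"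
proof -
  have "det (mat n n (\<lambda>(i, j). f i j)) = det (mat n n (\<lambda>(i, j). f j i))"
    by (rule det_mat_transpose[symmetric])
  also have "\<dots> = (\<Sum>p | p permutes {0..<n}. signof p * (\<Prod>j = 0..<n. f (p j) j))"
    unfolding det_def'[OF mat_carrier]
    by (intro sum.cong refl arg_cong2[where f = "(*)"] prod.cong) (auto simp: permutes_in_image)
  finally show ?thesis .
qed

text \<open>A zero block with n - i0 rows and i0 + 1 columns meets every permutation, again by the
  pigeonhole principle.\<close>

lemma det_zero_block:
  fixes f :: "nat \<Rightarrow> nat \<Rightarrow> 'a :: comm_ring_1"
  assumes "i0 < n" "\<And>i k. i0 \<le> i \<Longrightarrow> i < n \<Longrightarrow> k \<le> i0 \<Longrightarrow> f i k = 0"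
  shows "det (mat n n (\<lambda>(i, k). f i k)) = 0"
  unfolding det_mat_perm_sum
proof (intro sum.neutral ballI)
  fix p assume "p \<in> {p. p permutes {0..<n}}"
  then have p: "p permutes {0..<n}" by simp
  have "\<exists>k\<le>i0. i0 \<le> p k"
  proof (rule ccontr)
    assume "\<not> (\<exists>k\<le>i0. i0 \<le> p k)"
    then have "p k < i0" if "k \<le> i0" for k
      using that by (meson not_le)
    then have "p ` {..i0} \<subseteq> {..<i0}" by auto
    then have "card (p ` {..i0}) \<le> i0"
      using card_mono[of "{..<i0}" "p ` {..i0}"] by simp
    moreover have "card (p ` {..i0}) = Suc i0"
      using card_image[OF permutes_inj_on[OF p], of "{..i0}"] by simp
    ultimately show False by simp
  qed
  then obtain k where k: "k \<le> i0" "i0 \<le> p k" by blast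
  then have "k \<in> {0..<n}" "p k < n"
    using assms(1) permutes_in_image[OF p, of k] by auto
  then have "(\<Prod>j = 0..<n. f (p j) j) = 0"
    using assms(2)[OF k(2) _ k(1)] by (intro prod_zero bexI[of _ k]) simp_all
  then show "signof p * (\<Prod>j = 0..<n. f (p j) j) = 0" by simp
qed

text \<open>Monic polynomials are given by their coefficients \<open>K\<close> in the basis of the
  products of the x - c_r. Multiplication by x sends the m-th product to the next one plus c_m times
  itself, so \<open>K_rec\<close> is the three-term recurrence read off coefficientwise.\<close>

locale three_term =
  fixes K :: "nat \<Rightarrow> nat \<Rightarrow> complex" and c \<beta> \<gamma> :: "nat \<Rightarrow> complex"
  assumes K_diag [simp]: "K n n = 1"
    and K_zero: "n < m \<Longrightarrow> K n m = 0"
    and K_rec: "m \<le> Suc n \<Longrightarrow> (if m = 0 then 0 else K n (m - 1)) + c m * K n m =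
      K (Suc n) m + \<beta> n * K n m + \<gamma> n * (if n = 0 then 0 else K (n - 1) m)"
begin

definition pol :: "nat \<Rightarrow> complex \<Rightarrow> complex" where
  "pol n x = (\<Sum>m\<le>n. K n m * (\<Prod>r<m. x - c r))"

lemma pol_0 [simp]: "pol 0 x = 1"
  by (simp add: pol_def)

lemma pol_superset: "n \<le> M \<Longrightarrow> pol n x = (\<Sum>m\<le>M. K n m * (\<Prod>r<m. x - c r))"
  unfolding pol_def by (intro sum.mono_neutral_left) (auto simp: K_zero)

lemma pol_rec: "x * pol n x = pol (Suc n) x + \<beta> n * pol n x + \<gamma> n * (if n = 0 then 0 else pol (n - 1) x)"
proof -
  define e where "e m = (\<Prod>r<m. x - c r)" for m
  have xe: "x * e m = e (Suc m) + c m * e m" for m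
    by (simp add: e_def algebra_simps)
  have "x * pol n x = (\<Sum>m\<le>n. K n m * (x * e m))"
    by (simp add: pol_def e_def sum_distrib_left mult_ac)
  also have "\<dots> = (\<Sum>m\<le>n. K n m * e (Suc m)) + (\<Sum>m\<le>n. c m * K n m * e m)"
    by (simp add: xe algebra_simps sum.distrib)
  also have "(\<Sum>m\<le>n. K n m * e (Suc m)) = (\<Sum>m\<le>Suc n. (if m = 0 then 0 else K n (m - 1)) * e m)"
    unfolding sum.atMost_Suc_shift by simp
  also have "(\<Sum>m\<le>n. c m * K n m * e m) = (\<Sum>m\<le>Suc n. c m * K n m * e m)"
    by (simp add: K_zero)
  also have "(\<Sum>m\<le>Suc n. (if m = 0 then 0 else K n (m - 1)) * e m) + (\<Sum>m\<le>Suc n. c m * K n m * e m) =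
      (\<Sum>m\<le>Suc n. (K (Suc n) m + \<beta> n * K n m + \<gamma> n * (if n = 0 then 0 else K (n - 1) m)) * e m)"
    unfolding sum.distrib[symmetric] distrib_right[symmetric] by (intro sum.cong refl) (simp only: K_rec atMost_iff)
  also have "\<dots> = pol (Suc n) x + \<beta> n * pol n x + \<gamma> n * (if n = 0 then 0 else pol (n - 1) x)"
  proof -
    have p1: "pol n x = (\<Sum>m\<le>Suc n. K n m * e m)" "pol (Suc n) x = (\<Sum>m\<le>Suc n. K (Suc n) m * e m)"
      unfolding e_def by (rule pol_superset, simp)+
    have p2: "(if n = 0 then 0 else pol (n - 1) x) = (\<Sum>m\<le>Suc n. (if n = 0 then 0 else K (n - 1) m) * e m)"
    proof (cases n)
      case (Suc n')
      have "pol n' x = (\<Sum>m\<le>Suc n. K n' m * e m)"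
        unfolding e_def by (rule pol_superset) (simp add: Suc)
      then show ?thesis using Suc by simp
    qed simp
    show ?thesis
      unfolding p1 p2 sum_distrib_left sum.distrib[symmetric] by (intro sum.cong refl) (simp only: algebra_simps)
  qed
  finally show ?thesis .
qed

text \<open>Any D + 1 distinct points carry weights with prescribed moments up to degree D: the
  determinant of the linear system is a Vandermonde determinant, and the adjugate matrix solves
  it.\<close>

lemma moment_functional:
  obtains w :: "nat \<Rightarrow> complex"
  where "\<And>n. n \<le> D \<Longrightarrow> (\<Sum>j\<le>D. w j * pol n (of_nat j)) = (if n = 0 then 1 else 0)"
proof -
  define A where "A = mat (Suc D) (Suc D) (\<lambda>(i, j). \<Prod>r<Suc D - 1 - i. (of_nat j :: complex) - c r)"
  \<comment> \<open>Row i of A belongs to the product with D - i factors, hence the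
    reversal.\<close>
  define l where "l i = tri_solve K (D - i)" for i
  define w where "w j = (\<Sum>k\<le>D. adj_mat A $$ (j, k) * l k) / det A" for j
  have A: "A \<in> carrier_mat (Suc D) (Suc D)" by (simp add: A_def)
  have "det A = vdm (Suc D) of_nat"
    unfolding A_def det_factorial_empty
    using det_factorial_empty[of "Suc D" "of_nat :: nat \<Rightarrow> complex" "\<lambda>_. 0"] det_vandermonde[of "Suc D" "of_nat :: nat \<Rightarrow> complex"]
    by simp
  also have "\<dots> \<noteq> 0"
    by (rule vdm_nonzero) simp
  finally have detA: "det A \<noteq> 0" .
  have adj: "(\<Sum>j\<le>D. A $$ (i, j) * adj_mat A $$ (j, k)) = (if i = k then det A else 0)" if "i \<le> D" "k \<le> D" for i k
  proof -
    have "(A * adj_mat A) $$ (i, k) = (det A \<cdot>\<^sub>m 1\<^sub>m (Suc D)) $$ (i, k)"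
      using adj_mat(2)[OF A] by simp
    moreover have "(A * adj_mat A) $$ (i, k) = (\<Sum>j = 0..<Suc D. A $$ (i, j) * adj_mat A $$ (j, k))"
      using that A adj_mat(1)[OF A] by (simp add: scalar_prod_def)
    ultimately show ?thesis
      using that by (simp add: atLeast0LessThan lessThan_Suc_atMost)
  qed
  have w: "(\<Sum>j\<le>D. w j * (\<Prod>r<m. of_nat j - c r)) = tri_solve K m" if "m \<le> D" for m
  proof -
    have "(\<Sum>j\<le>D. w j * (\<Prod>r<m. of_nat j - c r)) = (\<Sum>j\<le>D. A $$ (D - m, j) * w j)"
      using that by (intro sum.cong) (auto simp: A_def)
    also have "\<dots> = (\<Sum>j\<le>D. \<Sum>k\<le>D. A $$ (D - m, j) * adj_mat A $$ (j, k) * l k) / det A"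
      by (simp add: w_def sum_distrib_left sum_divide_distrib mult.assoc)
    also have "(\<Sum>j\<le>D. \<Sum>k\<le>D. A $$ (D - m, j) * adj_mat A $$ (j, k) * l k) =
        (\<Sum>k\<le>D. (\<Sum>j\<le>D. A $$ (D - m, j) * adj_mat A $$ (j, k)) * l k)"
      by (subst sum.swap) (simp add: sum_distrib_right)
    also have "\<dots> = (\<Sum>k\<le>D. if D - m = k then det A * l k else 0)"
      by (intro sum.cong refl) (simp add: adj)
    also have "\<dots> = det A * l (D - m)" by simp
    finally show ?thesis using detA that by (simp add: l_def)
  qed
  show thesis
  proof (rule that)
    fix n assume n: "n \<le> D"
    have "(\<Sum>j\<le>D. w j * pol n (of_nat j)) = (\<Sum>m\<le>n. K n m * (\<Sum>j\<le>D. w j * (\<Prod>r<m. of_nat j - c r)))"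
      unfolding pol_def sum_distrib_left by (subst sum.swap) (simp add: mult_ac)
    also have "\<dots> = (\<Sum>m\<le>n. K n m * tri_solve K m)"
      using n by (intro sum.cong refl) (simp add: w)
    also have "\<dots> = (\<Sum>m<n. K n m * tri_solve K m) + tri_solve K n"
      by (simp add: lessThan_Suc_atMost[symmetric])
    also have "\<dots> = (if n = 0 then 1 else 0)"
      by (subst tri_solve.simps) simp
    finally show "(\<Sum>j\<le>D. w j * pol n (of_nat j)) = (if n = 0 then 1 else 0)" .
  qed
qed

text \<open>Favard's argument: multiplication by x can be moved from one factor to the other, and
  the recurrence applied on either side expresses the pairing through pairings with smaller m. The
  bound on n + m is preserved, since m drops when n grows.\<close>

lemma pol_orthogonal_aux:
  assumes w: "\<And>n. n \<le> D \<Longrightarrow> (\<Sum>j\<le>D. w j * pol n (of_nat j)) = (if n = 0 then 1 else 0)"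
  shows "m \<le> n \<Longrightarrow> n + m \<le> D \<Longrightarrow>
    (\<Sum>j\<le>D. w j * (pol n (of_nat j) * pol m (of_nat j))) = (if n = m then \<Prod>k = 1..n. \<gamma> k else 0)"
proof (induction m arbitrary: n rule: less_induct)
  case (less m)
  define L where "L n m = (\<Sum>j\<le>D. w j * (pol n (of_nat j) * pol m (of_nat j)))" for n m
  show ?case
  proof (cases m)
    case 0
    then show ?thesis using w[of n] less.prems by simp
  next
    case (Suc m')
    have shift: "L (Suc n) m' + \<beta> n * L n m' + \<gamma> n * (if n = 0 then 0 else L (n - 1) m') =
        L n (Suc m') + \<beta> m' * L n m' + \<gamma> m' * (if m' = 0 then 0 else L n (m' - 1))"
    proof -
      have 1: "(\<Sum>j\<le>D. w j * ((of_nat j * pol n (of_nat j)) * pol m' (of_nat j))) =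
          L (Suc n) m' + \<beta> n * L n m' + \<gamma> n * (if n = 0 then 0 else L (n - 1) m')"
        unfolding pol_rec L_def by (simp add: algebra_simps sum.distrib sum_distrib_left)
      have 2: "(\<Sum>j\<le>D. w j * (pol n (of_nat j) * (of_nat j * pol m' (of_nat j)))) =
          L n (Suc m') + \<beta> m' * L n m' + \<gamma> m' * (if m' = 0 then 0 else L n (m' - 1))"
        unfolding pol_rec L_def by (simp add: algebra_simps sum.distrib sum_distrib_left)
      show ?thesis unfolding 1[symmetric] 2[symmetric] by (simp add: mult_ac)
    qed
    have IH: "L a b = (if a = b then \<Prod>k = 1..a. \<gamma> k else 0)" if "b < m" "b \<le> a" "a + b \<le> D" for a b
      using less.IH[OF that] by (simp only: L_def)
    have n: "m' < n" "n \<noteq> 0" using less.prems Suc by auto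
    have "L (Suc n) m' = 0" "L n m' = 0"
      using IH[of m' "Suc n"] IH[of m' n] less.prems Suc by auto
    moreover have "m' \<noteq> 0 \<Longrightarrow> L n (m' - 1) = 0"
      using IH[of "m' - 1" n] less.prems Suc by auto
    moreover have "L (n - 1) m' = (if n - 1 = m' then \<Prod>k = 1..m'. \<gamma> k else 0)"
      using IH[of m' "n - 1"] less.prems Suc by auto
    ultimately have "L n (Suc m') = \<gamma> n * (if n - 1 = m' then \<Prod>k = 1..m'. \<gamma> k else 0)"
      using shift n by (cases "m' = 0") auto
    also have "\<dots> = (if n = m then \<Prod>k = 1..n. \<gamma> k else 0)"
      using n Suc by auto
    finally show ?thesis unfolding L_def Suc .
  qed
qed

lemma pol_orthogonal:
  assumes w: "\<And>n. n \<le> D \<Longrightarrow> (\<Sum>j\<le>D. w j * pol n (of_nat j)) = (if n = 0 then 1 else 0)"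
    and "n + m \<le> D"
  shows "(\<Sum>j\<le>D. w j * (pol n (of_nat j) * pol m (of_nat j))) = (if n = m then \<Prod>k = 1..n. \<gamma> k else 0)"
proof (cases "m \<le> n")
  case True
  then show ?thesis using pol_orthogonal_aux[OF w] assms(2) by simp
next
  case False
  then show ?thesis using pol_orthogonal_aux[OF w, where n = m and m = n] assms(2) by (simp add: mult.commute add.commute)
qed

text \<open>The minor that the Cauchy--Binet formula attaches to \<nu> and \<mu>; its limit is
  \<open>sigma_qR\<close>.\<close>

definition sig :: "nat \<Rightarrow> (nat \<Rightarrow> nat) \<Rightarrow> (nat \<Rightarrow> nat) \<Rightarrow> complex" where
  "sig N \<nu> \<mu> = det (mat N N (\<lambda>(i, k). K (shifted N \<nu> i) (shifted N \<mu> k)))"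

text \<open>The counterpart of \<open>Phi_qR\<close> for N variables, lifted to the algebra of
  symmetric functions.\<close>

definition sympol :: "nat \<Rightarrow> (nat \<Rightarrow> nat) \<Rightarrow> symfun" where
  "sympol N \<nu> = (\<Sum>\<mu>\<in>{\<mu> \<in> partitions. part_subseteq \<mu> \<nu>}. sym_scale (sig N \<nu> \<mu>) (jts (node_coeff N c) \<mu>))"

lemma sig_zero:
  assumes \<mu>: "\<mu> \<in> partitions" "part_length \<mu> \<le> N" and \<nu>: "\<nu> \<in> partitions" and "\<not> part_subseteq \<mu> \<nu>"
  shows "sig N \<nu> \<mu> = 0"
proof -
  obtain i0 where i0: "\<nu> i0 < \<mu> i0"
    using assms(4) by (auto simp: part_subseteq_def not_le)
  then have "i0 < N"
    using part_nonzero_iff[OF \<mu>(1), of i0] \<mu>(2) by linarith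
  then show ?thesis
    unfolding sig_def
  proof (rule det_zero_block)
    fix i k assume ik: "i0 \<le> i" "i < N" "k \<le> i0"
    have "\<nu> i < \<mu> k"
      using partitions_antimono[OF \<nu> ik(1)] partitions_antimono[OF \<mu>(1) ik(3)] i0 by linarith
    then show "K (shifted N \<nu> i) (shifted N \<mu> k) = 0"
      using ik by (intro K_zero) (simp add: shifted_def)
  qed
qed

lemma sig_diag [simp]:
  assumes "\<nu> \<in> partitions"
  shows "sig N \<nu> \<nu> = 1"
proof -
  have "sig N \<nu> \<nu> = (\<Prod>i<N. K (shifted N \<nu> i) (shifted N \<nu> i))"
    unfolding sig_def
    by (subst det_mat_lower_left_zero) (auto intro!: K_zero shifted_strict assms)
  then show ?thesis by simp
qed

text \<open>Cauchy--Binet for the product of the coefficient matrix with the matrix of the products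
  over nodes. The minors of the second are alternants of interpolation polynomials, those of the
  first vanish unless \<mu> is contained in \<nu>.\<close>

lemma sym_eval_sympol:
  assumes \<nu>: "\<nu> \<in> partitions" "part_length \<nu> \<le> N"
  shows "sym_eval N z (sympol N \<nu>) * vdm N z = det (mat N N (\<lambda>(i, j). pol (shifted N \<nu> i) (z j)))"
proof -
  let ?M = "\<nu> 0 + N"
  let ?S = "{\<mu>. \<mu> \<in> partitions \<and> part_length \<mu> \<le> N \<and> shifted N \<mu> ` {..<N} \<subseteq> {..<?M}}"
  let ?d = "\<lambda>\<mu>. det (mat N N (\<lambda>(i, j). \<Prod>r<shifted N \<mu> i. z j - c r))"
  have M: "shifted N \<nu> i < ?M" if "i < N" for i
    using that partitions_antimono[OF \<nu>(1), of 0 i] by (simp add: shifted_def)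
  have fin: "finite ?S"
  proof (rule finite_subset[OF _ finite_partitions_box[of N ?M]], safe)
    fix \<mu> i assume \<mu>: "\<mu> \<in> partitions" "part_length \<mu> \<le> N" "shifted N \<mu> ` {..<N} \<subseteq> {..<?M}"
    show "\<mu> i \<le> ?M"
    proof (cases "i < N")
      case True
      then have "shifted N \<mu> i < ?M" using \<mu>(3) by blast
      then show ?thesis using True by (simp add: shifted_def)
    next
      case False
      then show ?thesis using part_eq_0_iff[OF \<mu>(1), of i] \<mu>(2) by simp
    qed
  qed
  have "mat N N (\<lambda>(i, j). pol (shifted N \<nu> i) (z j)) =
      mat N N (\<lambda>(i, j). \<Sum>m<?M. K (shifted N \<nu> i) m * (\<Prod>r<m. z j - c r))"
  proof (rule eq_matI)
    fix i j assume "i < dim_row (mat N N (\<lambda>(i, j). \<Sum>m<?M. K (shifted N \<nu> i) m * (\<Prod>r<m. z j - c r)))"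
      "j < dim_col (mat N N (\<lambda>(i, j). \<Sum>m<?M. K (shifted N \<nu> i) m * (\<Prod>r<m. z j - c r)))"
    then have ij: "i < N" "j < N" by simp_all
    have "{..?M - 1} = {..<?M}" using M[OF ij(1)] by auto
    then show "mat N N (\<lambda>(i, j). pol (shifted N \<nu> i) (z j)) $$ (i, j) =
        mat N N (\<lambda>(i, j). \<Sum>m<?M. K (shifted N \<nu> i) m * (\<Prod>r<m. z j - c r)) $$ (i, j)"
      using ij pol_superset[of "shifted N \<nu> i" "?M - 1" "z j"] M[OF ij(1)] by simp
  qed auto
  then have "det (mat N N (\<lambda>(i, j). pol (shifted N \<nu> i) (z j))) = (\<Sum>\<mu>\<in>?S. sig N \<nu> \<mu> * ?d \<mu>)"
    using cauchy_binet[of N "\<lambda>i m. K (shifted N \<nu> i) m" "\<lambda>m j. \<Prod>r<m. z j - c r" ?M] by (simp only: sig_def)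
  also have "\<dots> = (\<Sum>\<mu>\<in>{\<mu> \<in> partitions. part_subseteq \<mu> \<nu>}. sig N \<nu> \<mu> * ?d \<mu>)"
  proof (rule sum.mono_neutral_right[OF fin])
    show "{\<mu> \<in> partitions. part_subseteq \<mu> \<nu>} \<subseteq> ?S"
    proof safe
      fix \<mu> assume \<mu>: "\<mu> \<in> partitions" "part_subseteq \<mu> \<nu>"
      then show "part_length \<mu> \<le> N"
        using part_subseteq_length[OF \<mu>(1) \<nu>(1) \<mu>(2)] \<nu>(2) by simp
      fix i assume "i < N"
      then have "shifted N \<mu> i \<le> shifted N \<nu> i"
        using \<mu>(2) by (auto simp: shifted_def part_subseteq_def diff_le_mono)
      then show "shifted N \<mu> i < ?M" using M[OF \<open>i < N\<close>] by simp
    qed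
    show "\<forall>\<mu>\<in>?S - {\<mu> \<in> partitions. part_subseteq \<mu> \<nu>}. sig N \<nu> \<mu> * ?d \<mu> = 0"
      using sig_zero[OF _ _ \<nu>(1)] by auto
  qed
  also have "\<dots> = (\<Sum>\<mu>\<in>{\<mu> \<in> partitions. part_subseteq \<mu> \<nu>}. sig N \<nu> \<mu> * (sym_eval N z (jts (node_coeff N c) \<mu>) * vdm N z))"
  proof (intro sum.cong refl arg_cong2[where f = "(*)"])
    fix \<mu> assume "\<mu> \<in> {\<mu> \<in> partitions. part_subseteq \<mu> \<nu>}"
    then have \<mu>: "\<mu> \<in> partitions" "part_length \<mu> \<le> N"
      using part_subseteq_length[of \<mu> \<nu>] \<nu> by auto
    show "?d \<mu> = sym_eval N z (jts (node_coeff N c) \<mu>) * vdm N z"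
      using sym_eval_jts_full[OF \<mu>, of z c] by (simp add: shifted_def)
  qed
  also have "\<dots> = sym_eval N z (sympol N \<nu>) * vdm N z"
    unfolding sympol_def sym_eval_hom.hom_sum sym_eval_scale sum_distrib_right by (simp add: mult.assoc)
  finally show ?thesis by simp
qed

text \<open>
  The functional sums over all points with coordinates in \<open>{0, \<dots>, D}\<close>, with product weights that
  represent the orthogonality functional of the univariate polynomials up to degree \<open>D\<close>, and with the
  square of the Vandermonde determinant as density.
\<close>

lemma multivariate_functional:
  assumes \<gamma>: "\<And>k. 1 \<le> k \<Longrightarrow> k < N \<Longrightarrow> \<gamma> k \<noteq> 0"
  obtains E :: "symfun \<Rightarrow> complex"
  where "\<And>F G. E (F + G) = E F + E G" "\<And>a F. E (sym_scale a F) = a * E F"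
    "\<And>\<nu> \<mu>. \<nu> \<in> parts_le d \<Longrightarrow> \<mu> \<in> parts_le d \<Longrightarrow> part_length \<nu> \<le> N \<Longrightarrow> part_length \<mu> \<le> N \<Longrightarrow>
      E (sympol N \<nu> * sympol N \<mu>) = (if \<nu> = \<mu> then \<Prod>i<N. \<Prod>k = N - i..<N - i + \<nu> i. \<gamma> k else 0)"
proof -
  \<comment> \<open>Each shifted part is at most d + N, so a product of two polynomials stays within
    degree D.\<close>
  define D where "D = 2 * (d + N)"
  obtain w where w: "\<And>n. n \<le> D \<Longrightarrow> (\<Sum>j\<le>D. w j * pol n (of_nat j)) = (if n = 0 then 1 else 0)"
    using moment_functional[of D] by blast
  define hh where "hh n = (\<Prod>k = 1..n. \<gamma> k)" for n
  \<comment> \<open>\<open>fact N * Z\<close> is the unnormalized value at 1. Dividing by it is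
    where \<gamma> must not vanish, and it cancels all \<gamma>_k in row i with k < N - i.\<close>
  define Z where "Z = (\<Prod>i<N. hh (N - 1 - i))"
  define S where "S = {0..<N} \<rightarrow>\<^sub>E {..D}"
  define z :: "(nat \<Rightarrow> nat) \<Rightarrow> nat \<Rightarrow> complex" where "z f j = of_nat (f j)" for f j
  define E where "E F = (\<Sum>f\<in>S. (\<Prod>j = 0..<N. w (f j)) * (sym_eval N (z f) F * vdm N (z f) ^ 2)) / (fact N * Z)" for F
  have Z: "Z \<noteq> 0"
  proof -
    have "(\<Prod>k = 1..N - 1 - i. \<gamma> k) \<noteq> 0" if "i < N" for i
    proof
      assume "(\<Prod>k = 1..N - 1 - i. \<gamma> k) = 0"
      then obtain k where "k \<in> {1..N - 1 - i}" "\<gamma> k = 0" by (auto simp: prod_zero_iff)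
      moreover from this that have "1 \<le> k" "k < N" by auto
      ultimately show False using \<gamma> by blast
    qed
    then show ?thesis unfolding Z_def hh_def prod_zero_iff[OF finite_lessThan] by blast
  qed
  have orth: "E (sympol N \<nu> * sympol N \<mu>) = (if \<nu> = \<mu> then \<Prod>i<N. \<Prod>k = N - i..<N - i + \<nu> i. \<gamma> k else 0)"
    if \<nu>: "\<nu> \<in> parts_le d" "part_length \<nu> \<le> N" and \<mu>: "\<mu> \<in> parts_le d" "part_length \<mu> \<le> N" for \<nu> \<mu>
  proof -
    let ?T = "{p. p permutes {0..<N}}"
    let ?l = "shifted N \<nu>" and ?l' = "shifted N \<mu>"
    have part: "\<nu> \<in> partitions" "\<mu> \<in> partitions" using \<nu> \<mu> by (auto simp: parts_le_def)
    have deg: "?l i + ?l' k \<le> D" if "i < N" "k < N" for i k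
      using part_size_ge[OF part(1), of i] part_size_ge[OF part(2), of k] \<nu>(1) \<mu>(1) that
      by (auto simp: parts_le_def D_def shifted_def)
    have "(\<Sum>f\<in>S. (\<Prod>j = 0..<N. w (f j)) * (sym_eval N (z f) (sympol N \<nu> * sympol N \<mu>) * vdm N (z f) ^ 2)) =
        (\<Sum>f\<in>S. (\<Prod>j = 0..<N. w (f j)) *
          (det (mat N N (\<lambda>(i, j). pol (?l i) (z f j))) * det (mat N N (\<lambda>(i, j). pol (?l' i) (z f j)))))"
      unfolding sym_eval_sympol[OF part(1) \<nu>(2), symmetric] sym_eval_sympol[OF part(2) \<mu>(2), symmetric]
      by (simp add: sym_eval_hom.hom_mult power2_eq_square mult_ac)
    also have "\<dots> = (\<Sum>f\<in>S. \<Sum>p\<in>?T. \<Sum>p'\<in>?T. signof p * signof p' *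
        (\<Prod>j = 0..<N. w (f j) * (pol (?l (p j)) (z f j) * pol (?l' (p' j)) (z f j))))"
      unfolding det_mat_perm_sum
      unfolding sum_product
      unfolding sum_distrib_left prod.distrib by (intro sum.cong refl) (simp only: mult_ac)
    also have "\<dots> = (\<Sum>p\<in>?T. \<Sum>p'\<in>?T. \<Sum>f\<in>S. signof p * signof p' *
        (\<Prod>j = 0..<N. w (f j) * (pol (?l (p j)) (z f j) * pol (?l' (p' j)) (z f j))))"
      by (rule trans[OF sum.swap]) (intro sum.cong refl sum.swap)
    also have "\<dots> = (\<Sum>p\<in>?T. \<Sum>p'\<in>?T. signof p * signof p' *
        (\<Prod>j = 0..<N. if ?l (p j) = ?l' (p' j) then hh (?l (p j)) else 0))"
    proof (intro sum.cong refl)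
      fix p p' assume "p \<in> ?T" "p' \<in> ?T"
      then have pp: "p j < N" "p' j < N" if "j < N" for j
        using permutes_in_image[of p "{0..<N}" j] permutes_in_image[of p' "{0..<N}" j] that by auto
      have "(\<Sum>f\<in>S. \<Prod>j = 0..<N. w (f j) * (pol (?l (p j)) (z f j) * pol (?l' (p' j)) (z f j))) =
          (\<Prod>j = 0..<N. \<Sum>k\<le>D. w k * (pol (?l (p j)) (of_nat k) * pol (?l' (p' j)) (of_nat k)))"
        unfolding S_def z_def by (rule prod_sum_PiE[symmetric]) auto
      also have "\<dots> = (\<Prod>j = 0..<N. if ?l (p j) = ?l' (p' j) then hh (?l (p j)) else 0)"
        unfolding hh_def by (intro prod.cong refl pol_orthogonal[OF w] deg) (auto intro: pp)
      finally show "(\<Sum>f\<in>S. signof p * signof p' *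
          (\<Prod>j = 0..<N. w (f j) * (pol (?l (p j)) (z f j) * pol (?l' (p' j)) (z f j)))) =
          signof p * signof p' * (\<Prod>j = 0..<N. if ?l (p j) = ?l' (p' j) then hh (?l (p j)) else 0)"
        by (simp only: sum_distrib_left[symmetric])
    qed
    \<comment> \<open>A surviving summand needs equal degrees at every j, hence equal sets of
      shifted parts; this forces \<nu> = \<mu>, and then p = p' by injectivity.\<close>
    also have "\<dots> = (\<Sum>p\<in>?T. \<Sum>p'\<in>?T. if \<nu> = \<mu> \<and> p = p' then (\<Prod>i<N. hh (?l i)) else 0)"
    proof (intro sum.cong refl)
      fix p p' assume p: "p \<in> ?T" "p' \<in> ?T"
      show "signof p * signof p' * (\<Prod>j = 0..<N. if ?l (p j) = ?l' (p' j) then hh (?l (p j)) else 0) =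
          (if \<nu> = \<mu> \<and> p = p' then (\<Prod>i<N. hh (?l i)) else 0)"
      proof (cases "\<nu> = \<mu> \<and> p = p'")
        case True
        have "(signof p :: complex) * signof p = 1"
          by (cases p rule: sign_cases) simp_all
        moreover have "(\<Prod>j = 0..<N. hh (?l (p j))) = (\<Prod>i<N. hh (?l i))"
          using prod.permute[of p "{0..<N}" "\<lambda>i. hh (?l i)"] p by (simp add: o_def lessThan_atLeast0)
        ultimately show ?thesis using True by simp
      next
        case False
        have "\<exists>j<N. ?l (p j) \<noteq> ?l' (p' j)"
        proof (rule ccontr)
          assume "\<not> (\<exists>j<N. ?l (p j) \<noteq> ?l' (p' j))"
          then have eq: "?l (p j) = ?l' (p' j)" if "j < N" for j using that by blast
          have "(\<lambda>j. ?l (p j)) ` {0..<N} = (\<lambda>j. ?l' (p' j)) ` {0..<N}"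
            by (rule image_cong) (use eq in auto)
          then have "?l ` {..<N} = ?l' ` {..<N}"
            using permutes_image[of p "{0..<N}"] permutes_image[of p' "{0..<N}"] p
            by (simp add: image_image[symmetric, of ?l p] image_image[symmetric, of ?l' p'] lessThan_atLeast0)
          then have "\<nu> = \<mu>" using shifted_image_inj part \<nu> \<mu> by blast
          moreover have "p j = p' j" for j
          proof (cases "j < N")
            case True
            then show ?thesis
              using eq[OF True] \<open>\<nu> = \<mu>\<close> inj_onD[OF shifted_inj[OF part(1), of N], of "p j" "p' j"]
                permutes_in_image[of p "{0..<N}" j] permutes_in_image[of p' "{0..<N}" j] p by auto
          next
            case False
            then show ?thesis using p by (simp add: permutes_not_in)
          qed
          ultimately show False using False by blast
        qed
        then obtain j where "j < N" "?l (p j) \<noteq> ?l' (p' j)" by blast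
        then have "(\<Prod>j = 0..<N. if ?l (p j) = ?l' (p' j) then hh (?l (p j)) else 0) = 0"
          by (intro prod_zero bexI[of _ j]) auto
        then show ?thesis using False by (simp only: if_False mult_zero_right)
      qed
    qed
    also have "\<dots> = (if \<nu> = \<mu> then fact N * (\<Prod>i<N. hh (?l i)) else 0)"
      by (simp add: card_permutations[of "{0..<N}" N] finite_permutations)
    finally have "E (sympol N \<nu> * sympol N \<mu>) = (if \<nu> = \<mu> then (\<Prod>i<N. hh (?l i)) / Z else 0)"
      unfolding E_def by simp
    moreover have "(\<Prod>i<N. hh (?l i)) = Z * (\<Prod>i<N. \<Prod>k = N - i..<N - i + \<nu> i. \<gamma> k)"
      unfolding Z_def prod.distrib[symmetric]
    proof (intro prod.cong refl)
      fix i assume "i \<in> {..<N}"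
      then have "{1..?l i} = {1..N - 1 - i} \<union> {N - i..<N - i + \<nu> i}"
        by (auto simp: shifted_def)
      then show "hh (?l i) = hh (N - 1 - i) * (\<Prod>k = N - i..<N - i + \<nu> i. \<gamma> k)"
        unfolding hh_def by (simp only:) (subst prod.union_disjoint, auto)
    qed
    ultimately show ?thesis by (simp only: nonzero_mult_div_cancel_left[OF Z])
  qed
  show thesis
  proof (rule that)
    show "E (F + G) = E F + E G" for F G
      unfolding E_def sym_eval_hom.hom_add by (simp add: algebra_simps sum.distrib add_divide_distrib)
    show "E (sym_scale a F) = a * E F" for a F
      unfolding E_def sym_eval_scale by (simp add: sum_distrib_left mult_ac)
  qed (use orth in auto)
qed

end

subsection \<open>Convergence of the node coefficients\<close>

text \<open>Newton's identities are read off the logarithmic derivative of \<open>\<Prod> (1 - c\<^sub>r X)\<close>.\<close>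

lemma newton_lin_prod:
  fixes c :: "nat \<Rightarrow> complex"
  shows "of_nat (Suc n) * fps_nth (lin_prod m c) (Suc n) =
    - (\<Sum>j=0..n. fps_nth (lin_prod m c) j * (\<Sum>i<m. c i ^ Suc (n - j)))"
proof -
  have deriv: "fps_deriv (lin_prod m c) = - (lin_prod m c * (\<Sum>i<m. fps_const (c i) * geo (c i)))"
  proof (induction m)
    case (Suc m)
    let ?l = "1 - fps_const (c m) * fps_X"
    let ?S = "\<Sum>i<m. fps_const (c i) * geo (c i)"
    have "fps_deriv (lin_prod (Suc m) c) = ?l * fps_deriv (lin_prod m c) - fps_const (c m) * lin_prod m c"
      by (simp add: lin_prod_Suc algebra_simps)
    also have "\<dots> = - (?l * lin_prod m c * ?S) - fps_const (c m) * (?l * geo (c m)) * lin_prod m c"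
      by (simp add: Suc lin_geo mult.assoc)
    also have "\<dots> = - (lin_prod (Suc m) c * (\<Sum>i<Suc m. fps_const (c i) * geo (c i)))"
      by (simp add: lin_prod_Suc algebra_simps)
    finally show ?case .
  qed (simp add: lin_prod_def)
  have "of_nat (Suc n) * fps_nth (lin_prod m c) (Suc n) = fps_nth (fps_deriv (lin_prod m c)) n"
    by simp
  also have "\<dots> = - (\<Sum>j=0..n. fps_nth (lin_prod m c) j * (\<Sum>i<m. c i ^ Suc (n - j)))"
    unfolding deriv fps_neg_nth fps_mult_nth by (simp add: fps_sum_nth geo_def)
  finally show ?thesis .
qed

text \<open>The nodes are sums of terms of two geometric progressions. Their power sums split
  accordingly, up to a small error, while the coefficients do not; hence the detour through Newton's
  identities.\<close>

lemma lin_prod_convergent: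
  fixes c :: "nat \<Rightarrow> nat \<Rightarrow> complex"
  assumes "\<And>k. k \<ge> 1 \<Longrightarrow> convergent (\<lambda>N. \<Sum>i<m N. c N i ^ k)"
  shows "convergent (\<lambda>N. fps_nth (lin_prod (m N) (c N)) a)"
proof (induction a rule: less_induct)
  case (less a)
  show ?case
  proof (cases a)
    case 0
    then show ?thesis by (simp add: convergent_const)
  next
    case (Suc n)
    have eq: "fps_nth (lin_prod (m N) (c N)) a =
        - (\<Sum>j=0..n. fps_nth (lin_prod (m N) (c N)) j * (\<Sum>i<m N. c N i ^ Suc (n - j))) * inverse (of_nat (Suc n))" for N
      unfolding newton_lin_prod[symmetric] Suc by (simp del: of_nat_Suc)
    have "convergent (\<lambda>N. \<Sum>j=0..n. fps_nth (lin_prod (m N) (c N)) j * (\<Sum>i<m N. c N i ^ Suc (n - j)))"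
      using Suc by (intro convergent_sum convergent_mult less.IH assms) auto
    then show ?thesis
      unfolding eq by (intro convergent_mult convergent_const) (simp add: convergent_minus_iff[symmetric])
  qed
qed

text \<open>In the application a b = q^(N-1), so the mixed terms vanish in the limit.\<close>

lemma power_sum_cross_bound:
  fixes M :: real
  assumes "k \<ge> 1" "M \<ge> 0"
  obtains C where "C \<ge> 0" "\<And>a b :: complex. norm a \<le> M \<Longrightarrow> norm b \<le> M \<Longrightarrow>
    norm ((a + b) ^ k - a ^ k - b ^ k) \<le> C * norm (a * b)"
proof -
  have "\<exists>C\<ge>0. \<forall>a b :: complex. norm a \<le> M \<longrightarrow> norm b \<le> M \<longrightarrow>
    norm ((a + b) ^ k - a ^ k - b ^ k) \<le> C * norm (a * b)"
    using assms(1)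
  proof (induction k rule: nat_induct_at_least)
    case base
    show ?case by (intro exI[of _ 0]) simp
  next
    case (Suc k)
    then obtain C where C: "C \<ge> 0" "\<And>a b :: complex. norm a \<le> M \<Longrightarrow> norm b \<le> M \<Longrightarrow>
      norm ((a + b) ^ k - a ^ k - b ^ k) \<le> C * norm (a * b)" by blast
    have "norm ((a + b) ^ Suc k - a ^ Suc k - b ^ Suc k) \<le> (2 * M * C + 2 * M ^ (k - 1)) * norm (a * b)"
      if ab: "norm a \<le> M" "norm b \<le> M" for a b :: complex
    proof -
      have k: "a ^ k = a * a ^ (k - 1)" "b ^ k = b * b ^ (k - 1)"
        using Suc.hyps by (simp_all flip: power_Suc)
      have "(a + b) ^ Suc k - a ^ Suc k - b ^ Suc k =
          (a + b) * ((a + b) ^ k - a ^ k - b ^ k) + (a * b) * (a ^ (k - 1) + b ^ (k - 1))"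
        using k by (simp add: algebra_simps)
      also have "norm \<dots> \<le> norm (a + b) * norm ((a + b) ^ k - a ^ k - b ^ k) + norm (a * b) * norm (a ^ (k - 1) + b ^ (k - 1))"
        by (intro norm_triangle_le) (simp add: norm_mult)
      also have "\<dots> \<le> (2 * M) * (C * norm (a * b)) + norm (a * b) * (2 * M ^ (k - 1))"
      proof (intro add_mono mult_mono)
        show "norm (a + b) \<le> 2 * M" using norm_triangle_ineq[of a b] ab by simp
        have "norm (a ^ (k - 1)) \<le> M ^ (k - 1)" "norm (b ^ (k - 1)) \<le> M ^ (k - 1)"
          unfolding norm_power using ab by (auto intro: power_mono)
        then show "norm (a ^ (k - 1) + b ^ (k - 1)) \<le> 2 * M ^ (k - 1)"
          using norm_triangle_ineq[of "a ^ (k - 1)" "b ^ (k - 1)"] by linarith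
      qed (use assms(2) C ab in auto)
      finally show ?thesis by (simp add: algebra_simps)
    qed
    then show ?case using C(1) assms(2) by (intro exI[of _ "2 * M * C + 2 * M ^ (k - 1)"]) simp
  qed
  then show thesis using that by blast
qed

lemma nat_shift_at_top: "filterlim (\<lambda>N. nat (t + int N - 1)) at_top sequentially"
  unfolding filterlim_at_top
proof
  fix Z
  show "\<forall>\<^sub>F N in sequentially. Z \<le> nat (t + int N - 1)"
    using eventually_ge_at_top[of "nat (int Z + 1 - t)"] by eventually_elim linarith
qed

lemma geometric_convergent:
  assumes "norm (x :: complex) < 1"
  shows "convergent (\<lambda>N. \<Sum>i<nat (t + int N - 1). x ^ i)"
proof -
  have "(\<lambda>n. \<Sum>i<n. x ^ i) \<longlonglongrightarrow> 1 / (1 - x)"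
    using geometric_sums[OF assms] by (simp add: sums_def)
  from filterlim_compose[OF this nat_shift_at_top[of t]] show ?thesis
    by (auto simp: convergent_def)
qed

lemma node_power_sum_convergent:
  fixes q :: real and s :: complex
  assumes q: "0 < q" "q < 1" and s: "s \<noteq> 0" and k: "k \<ge> 1"
  shows "convergent (\<lambda>N. \<Sum>i<nat (t + int N - 1).
    (s * of_real q ^ i + inverse s * of_real q powi (int N - int i - 1)) ^ k)"
proof -
  let ?Q = "complex_of_real q"
  let ?m = "\<lambda>N. nat (t + int N - 1)"
  define a where "a i = s * ?Q ^ i" for i
  define b where "b N i = inverse s * ?Q powi (int N - int i - 1)" for N i
  \<comment> \<open>For i < t + N - 1 the exponent in \<open>b N i\<close> is at least 1 - t, which
    bounds it uniformly in N.\<close>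
  define M where "M = max (norm s) (norm (inverse s) * q powi (1 - t))"
  have Q0: "?Q \<noteq> 0" using q by simp
  have M: "M \<ge> 0" by (simp add: M_def le_max_iff_disj)
  obtain C where C: "C \<ge> 0" "\<And>a b :: complex. norm a \<le> M \<Longrightarrow> norm b \<le> M \<Longrightarrow>
    norm ((a + b) ^ k - a ^ k - b ^ k) \<le> C * norm (a * b)"
    using power_sum_cross_bound[OF k M] by blast
  have na: "norm (a i) \<le> M" for i
  proof -
    have "norm (a i) = norm s * q ^ i" using q by (simp add: a_def norm_mult norm_power)
    also have "\<dots> \<le> norm s" using q by (simp add: mult_left_le power_le_one)
    finally show ?thesis by (simp add: M_def)
  qed
  have nb: "norm (b N i) \<le> M" if "i < ?m N" for N i
  proof -
    have "norm (b N i) = norm (inverse s) * q powi (int N - int i - 1)"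
      using q by (simp add: b_def norm_mult norm_power_int)
    also have "q powi (int N - int i - 1) \<le> q powi (1 - t)"
      using q that by (intro power_int_decreasing) auto
    finally show ?thesis by (simp add: M_def mult_left_mono)
  qed
  \<comment> \<open>The exponents i and N - i - 1 add up to N - 1 for every i, so the cross terms
    are small uniformly in i and their sum is of order N q^N.\<close>
  have ab: "norm (a i * b N i) = q powi (int N - 1)" for N i
  proof -
    have "a i * b N i = ?Q ^ i * ?Q powi (int N - int i - 1)"
      using s by (simp add: a_def b_def)
    also have "\<dots> = ?Q powi (int i + (int N - int i - 1))"
      using Q0 by (subst power_int_add) simp_all
    finally show ?thesis using q by (simp add: norm_power_int)
  qed
  have small: "(\<lambda>N. real (?m N) * C * q powi (int N - 1)) \<longlonglongrightarrow> 0"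
  proof (rule tendsto_sandwich[OF always_eventually always_eventually tendsto_const])
    show "\<forall>N. 0 \<le> real (?m N) * C * q powi (int N - 1)"
      using q C by simp
    show "\<forall>N. real (?m N) * C * q powi (int N - 1) \<le> (real N * q ^ N + \<bar>real_of_int t\<bar> * q ^ N) * (C / q)"
    proof
      fix N
      have "real (?m N) \<le> real N + \<bar>real_of_int t\<bar>" by linarith
      moreover have "q powi (int N - 1) = q ^ N / q"
        using q by (simp add: power_int_diff)
      ultimately have "real (?m N) * C * q powi (int N - 1) \<le> (real N + \<bar>real_of_int t\<bar>) * (C * (q ^ N / q))"
        using q C mult_right_mono[of "real (?m N)" "real N + \<bar>real_of_int t\<bar>" "C * (q ^ N / q)"]
        by (simp only: mult.assoc) simp
      also have "\<dots> = (real N * q ^ N + \<bar>real_of_int t\<bar> * q ^ N) * (C / q)"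
        by (simp add: algebra_simps add_divide_distrib)
      finally show "real (?m N) * C * q powi (int N - 1) \<le> (real N * q ^ N + \<bar>real_of_int t\<bar> * q ^ N) * (C / q)" .
    qed
    have 1: "(\<lambda>N. real N * q ^ N) \<longlonglongrightarrow> 0"
      using powser_times_n_limit_0[of q] q by simp
    have 2: "(\<lambda>N. q ^ N) \<longlonglongrightarrow> 0" using q by (intro LIMSEQ_realpow_zero) auto
    show "(\<lambda>N. (real N * q ^ N + \<bar>real_of_int t\<bar> * q ^ N) * (C / q)) \<longlonglongrightarrow> 0"
      by (rule tendsto_eq_intros 1 2 refl)+ simp
  qed
  have cross: "(\<lambda>N. \<Sum>i<?m N. (a i + b N i) ^ k - a i ^ k - b N i ^ k) \<longlonglongrightarrow> 0"
  proof (rule tendsto_norm_zero_cancel, rule tendsto_sandwich[OF always_eventually always_eventually tendsto_const small])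
    show "\<forall>N. norm (\<Sum>i<?m N. (a i + b N i) ^ k - a i ^ k - b N i ^ k) \<le> real (?m N) * C * q powi (int N - 1)"
    proof
      fix N
      have "norm (\<Sum>i<?m N. (a i + b N i) ^ k - a i ^ k - b N i ^ k) \<le> (\<Sum>i<?m N. C * q powi (int N - 1))"
      proof (rule sum_norm_le)
        fix i assume "i \<in> {..<?m N}"
        then show "norm ((a i + b N i) ^ k - a i ^ k - b N i ^ k) \<le> C * q powi (int N - 1)"
          using C(2)[OF na[of i] nb[of i N]] unfolding ab by blast
      qed
      then show "norm (\<Sum>i<?m N. (a i + b N i) ^ k - a i ^ k - b N i ^ k) \<le> real (?m N) * C * q powi (int N - 1)"
        by simp
    qed
  qed simp
  have Qk: "norm (?Q ^ k) < 1"
    using q k by (simp add: norm_power power_less_one_iff)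
  have A: "convergent (\<lambda>N. \<Sum>i<?m N. a i ^ k)"
  proof -
    have "(\<Sum>i<?m N. a i ^ k) = s ^ k * (\<Sum>i<?m N. (?Q ^ k) ^ i)" for N
      by (simp add: a_def power_mult_distrib sum_distrib_left power_mult[symmetric] mult.commute)
    then show ?thesis
      using geometric_convergent[OF Qk, of t] by (simp add: convergent_mult convergent_const)
  qed
  have B: "convergent (\<lambda>N. \<Sum>i<?m N. b N i ^ k)"
  proof -
    \<comment> \<open>Summed from the other end, these terms form a geometric progression that
      starts at the exponent 1 - t for every N.\<close>
    have eq: "(\<Sum>i<?m N. b N i ^ k) = inverse s ^ k * (?Q powi (1 - t)) ^ k * (\<Sum>i<?m N. (?Q ^ k) ^ i)" for N
    proof -
      have "(\<Sum>i<?m N. b N i ^ k) = (\<Sum>r<?m N. b N (?m N - 1 - r) ^ k)"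
        by (rule sum.reindex_bij_witness[where i = "\<lambda>r. ?m N - 1 - r" and j = "\<lambda>r. ?m N - 1 - r"]) auto
      also have "\<dots> = (\<Sum>r<?m N. inverse s ^ k * (?Q powi (1 - t)) ^ k * (?Q ^ k) ^ r)"
      proof (rule sum.cong[OF refl])
        fix r assume "r \<in> {..<?m N}"
        then have "int N - int (?m N - 1 - r) - 1 = (1 - t) + int r" by auto
        then have "b N (?m N - 1 - r) = inverse s * (?Q powi (1 - t) * ?Q ^ r)"
          unfolding b_def using power_int_add[of ?Q "1 - t" "int r"] Q0
          by (simp only: power_int_of_nat simp_thms)
        then show "b N (?m N - 1 - r) ^ k = inverse s ^ k * (?Q powi (1 - t)) ^ k * (?Q ^ k) ^ r"
          by (simp add: power_mult_distrib power_mult[symmetric] mult.commute[of k r] mult.assoc)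
      qed
      finally show ?thesis by (simp add: sum_distrib_left)
    qed
    show ?thesis
      unfolding eq by (intro convergent_mult convergent_const geometric_convergent Qk)
  qed
  have "convergent (\<lambda>N. (\<Sum>i<?m N. (a i + b N i) ^ k - a i ^ k - b N i ^ k) + (\<Sum>i<?m N. a i ^ k) + (\<Sum>i<?m N. b N i ^ k))"
    using cross A B by (intro convergent_add) (auto simp: convergent_def)
  moreover have "(\<Sum>i<?m N. (a i + b N i) ^ k - a i ^ k - b N i ^ k) + (\<Sum>i<?m N. a i ^ k) + (\<Sum>i<?m N. b N i ^ k) =
      (\<Sum>i<?m N. (a i + b N i) ^ k)" for N
    by (simp add: sum_subtractf)
  ultimately show ?thesis by (simp add: a_def b_def)
qed

lemma interp_BC_limit:
  fixes q :: real and s :: complex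
  assumes q: "0 < q" "q < 1" and s: "s \<noteq> 0"
  obtains \<epsilon> where "\<And>t. \<epsilon> t 0 = 1"
    "\<And>\<mu>. \<mu> \<in> partitions \<Longrightarrow> interp_BC \<mu> (of_real q) s = jts \<epsilon> \<mu>"
    "\<And>\<mu>. sym_tendsto (\<lambda>N. jts (node_coeff N (\<lambda>i. s * of_real q ^ i + inverse s * of_real q powi (int N - int i - 1))) \<mu>)
      (jts \<epsilon> \<mu>)"
proof -
  let ?c = "\<lambda>N i. s * complex_of_real q ^ i + inverse s * of_real q powi (int N - int i - 1)"
  have "convergent (\<lambda>N. node_coeff N (?c N) t a)" for t a
    unfolding node_coeff_def by (rule lin_prod_convergent) (rule node_power_sum_convergent[OF q s])
  moreover define \<epsilon> where "\<epsilon> t a = lim (\<lambda>N. node_coeff N (?c N) t a)" for t a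
  ultimately have \<epsilon>: "(\<lambda>N. node_coeff N (?c N) t a) \<longlonglongrightarrow> \<epsilon> t a" for t a
    by (simp only: convergent_LIMSEQ_iff)
  show thesis
  proof (rule that)
    show "\<epsilon> t 0 = 1" for t
      using LIMSEQ_unique[OF \<epsilon>[of t 0]] by simp
    show "interp_BC \<mu> (of_real q) s = jts \<epsilon> \<mu>" if "\<mu> \<in> partitions" for \<mu>
      by (rule interp_BC_eq[OF that \<epsilon>])
    show "sym_tendsto (\<lambda>N. jts (node_coeff N (?c N)) \<mu>) (jts \<epsilon> \<mu>)" for \<mu>
      by (rule sym_tendsto_jts) (rule \<epsilon>)
  qed
qed

subsection \<open>Convergence of the structure constants\<close>

lemma tendsto_det_mat:
  assumes "\<And>i k. i < n \<Longrightarrow> k < n \<Longrightarrow> (\<lambda>N. f N i k) \<longlonglongrightarrow> (g i k :: complex)"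
  shows "(\<lambda>N. det (mat n n (\<lambda>(i, k). f N i k))) \<longlonglongrightarrow> det (mat n n (\<lambda>(i, k). g i k))"
  unfolding det_mat_perm_sum
  by (intro tendsto_sum tendsto_mult tendsto_const tendsto_prod assms) (auto simp: permutes_in_image)

text \<open>
  The values at the points of the interpolation grid determine the structure constants of the basis of
  interpolation functions, and in the limit they only depend on the limits of the nodes of index near \<open>N\<close>.
\<close>

lemma structure_constants_limit:
  fixes c :: "nat \<Rightarrow> nat \<Rightarrow> complex" and \<tau> :: "nat \<Rightarrow> complex"
  assumes top: "\<And>r. (\<lambda>N. c N (N - d + r)) \<longlonglongrightarrow> \<tau> r"
    and inj: "\<And>i j. i < j \<Longrightarrow> \<tau> i \<noteq> \<tau> j"
    and \<alpha>: "\<alpha> \<in> parts_le d" and \<beta>: "\<beta> \<in> parts_le d"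
    and C: "\<And>N. jts (node_coeff N (c N)) \<alpha> * jts (node_coeff N (c N)) \<beta> =
      (\<Sum>\<rho>\<in>parts_le d. sym_scale (C N \<rho>) (jts (node_coeff N (c N)) \<rho>))"
  defines "v \<equiv> \<lambda>\<nu> \<rho>. interp_det d \<tau> \<nu> \<rho> / vdm d (\<lambda>j. \<tau> (shifted d \<nu> j))"
  obtains C0 where "\<And>\<rho>. \<rho> \<in> parts_le d \<Longrightarrow> (\<lambda>N. C N \<rho>) \<longlonglongrightarrow> C0 \<rho>"
    "\<And>\<nu>. \<nu> \<in> parts_le d \<Longrightarrow> (\<Sum>\<rho>\<in>parts_le d. v \<nu> \<rho> * C0 \<rho>) = v \<nu> \<alpha> * v \<nu> \<beta>"
    "\<And>\<nu> \<rho>. \<nu> \<in> parts_le d \<Longrightarrow> \<rho> \<in> parts_le d \<Longrightarrow> \<not> part_subseteq \<rho> \<nu> \<Longrightarrow> v \<nu> \<rho> = 0"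
    "\<And>\<nu>. \<nu> \<in> parts_le d \<Longrightarrow> v \<nu> \<nu> \<noteq> 0"
proof -
  \<comment> \<open>Values at the grid points of partitions in \<open>parts_le d\<close> only
    involve nodes from index N - d on.\<close>
  define cc where "cc N r = c N (N - d + r)" for N r
  define w where "w N \<nu> \<rho> = interp_det d (cc N) \<nu> \<rho> / vdm d (\<lambda>j. cc N (shifted d \<nu> j))" for N \<nu> \<rho>
  have len: "\<mu> \<in> partitions" "part_length \<mu> \<le> d" if "\<mu> \<in> parts_le d" for \<mu>
    using that part_length_le_size[of \<mu>] by (auto simp: parts_le_def)
  have vnz: "vdm d (\<lambda>j. \<tau> (shifted d \<nu> j)) \<noteq> 0" if "\<nu> \<in> parts_le d" for \<nu>
    by (rule vdm_nonzero) (metis inj shifted_strict[OF len(1)[OF that]])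
  have vlim: "(\<lambda>N. vdm d (\<lambda>j. cc N (shifted d \<nu> j))) \<longlonglongrightarrow> vdm d (\<lambda>j. \<tau> (shifted d \<nu> j))" for \<nu>
    unfolding vdm_def cc_def by (intro tendsto_prod tendsto_diff top)
  have lim: "(\<lambda>N. w N \<nu> \<rho>) \<longlonglongrightarrow> v \<nu> \<rho>" if "\<nu> \<in> parts_le d" for \<nu> \<rho>
    unfolding w_def v_def interp_det_def
    by (intro tendsto_divide vlim vnz[OF that] tendsto_det_mat tendsto_prod tendsto_diff)
      (simp_all add: cc_def top)
  have tri: "w N \<nu> \<rho> = 0" if "\<nu> \<in> parts_le d" "\<rho> \<in> parts_le d" "\<not> part_subseteq \<rho> \<nu>" for N \<nu> \<rho>
    using interp_det_vanish[OF len[OF that(2)] len(1)[OF that(1)] that(3)] by (simp add: w_def)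
  have tri0: "v \<nu> \<rho> = 0" if "\<nu> \<in> parts_le d" "\<rho> \<in> parts_le d" "\<not> part_subseteq \<rho> \<nu>" for \<nu> \<rho>
    using interp_det_vanish[OF len[OF that(2)] len(1)[OF that(1)] that(3)] by (simp add: v_def)
  have diag: "v \<nu> \<nu> \<noteq> 0" if "\<nu> \<in> parts_le d" for \<nu>
    using interp_det_diag_nonzero[OF len(1)[OF that] inj] vnz[OF that] by (simp add: v_def)
  have sys: "\<forall>\<^sub>F N in sequentially. (\<Sum>\<rho>\<in>parts_le d. w N \<nu> \<rho> * C N \<rho>) = w N \<nu> \<alpha> * w N \<nu> \<beta>"
    if \<nu>: "\<nu> \<in> parts_le d" for \<nu>
    using tendsto_imp_eventually_ne[OF vlim vnz[OF \<nu>]] eventually_ge_at_top[of d]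
  proof eventually_elim
    case (elim N)
    \<comment> \<open>The grid point of \<nu>. Since \<nu> vanishes from index d on, the remaining
      coordinates are the lowest nodes, as \<open>sym_eval_jts_top\<close> requires.\<close>
    let ?z = "\<lambda>j. c N (shifted N \<nu> j)"
    have z: "?z j = cc N (shifted d \<nu> j)" if "j < d" for j
      using that elim(2) by (simp add: shifted_def cc_def) (rule arg_cong[where f = "c N"], simp)
    have vz: "vdm d ?z = vdm d (\<lambda>j. cc N (shifted d \<nu> j))"
      unfolding vdm_def by (intro prod.cong refl) (simp add: z)
    have val: "sym_eval N ?z (jts (node_coeff N (c N)) \<rho>) = w N \<nu> \<rho>" if "\<rho> \<in> parts_le d" for \<rho>
    proof -
      have "sym_eval N ?z (jts (node_coeff N (c N)) \<rho>) * vdm d ?z =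
          det (mat d d (\<lambda>(i, j). \<Prod>r<\<rho> i + d - 1 - i. ?z j - c N (N - d + r)))"
      proof (rule sym_eval_jts_top[OF len[OF that] elim(2)])
        fix j assume "d \<le> j" "j < N"
        then show "?z j = c N (N - 1 - j)"
          using part_eq_0_iff[OF len(1)[OF \<nu>], of j] len(2)[OF \<nu>] by (simp add: shifted_def)
      qed
      also have "\<dots> = interp_det d (cc N) \<nu> \<rho>"
        unfolding interp_det_def
        by (intro arg_cong[where f = det] eq_matI) (simp_all add: z shifted_def[of d \<rho>] cc_def[symmetric])
      finally show ?thesis
        unfolding vz w_def using elim(1) by (simp add: nonzero_eq_divide_eq)
    qed
    have "w N \<nu> \<alpha> * w N \<nu> \<beta> = sym_eval N ?z (jts (node_coeff N (c N)) \<alpha> * jts (node_coeff N (c N)) \<beta>)"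
      by (simp add: sym_eval_hom.hom_mult val \<alpha> \<beta>)
    also have "\<dots> = (\<Sum>\<rho>\<in>parts_le d. w N \<nu> \<rho> * C N \<rho>)"
      unfolding C sym_eval_hom.hom_sum sym_eval_scale by (intro sum.cong refl) (simp add: val)
    finally show ?case by simp
  qed
  have "convergent (\<lambda>N. C N \<rho>)" if "\<rho> \<in> parts_le d" for \<rho>
    by (rule triangular_convergent[OF tri sys lim tendsto_mult[OF lim lim] diag that])
  then have C0: "(\<lambda>N. C N \<rho>) \<longlonglongrightarrow> lim (\<lambda>N. C N \<rho>)" if "\<rho> \<in> parts_le d" for \<rho>
    using that by (simp add: convergent_LIMSEQ_iff)
  show thesis
  proof (rule that[of "\<lambda>\<rho>. lim (\<lambda>N. C N \<rho>)"])
    fix \<nu> assume \<nu>: "\<nu> \<in> parts_le d"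
    have "(\<lambda>N. \<Sum>\<rho>\<in>parts_le d. w N \<nu> \<rho> * C N \<rho>) \<longlonglongrightarrow> (\<Sum>\<rho>\<in>parts_le d. v \<nu> \<rho> * lim (\<lambda>N. C N \<rho>))"
      by (intro tendsto_sum tendsto_mult lim C0 \<nu>)
    moreover have "(\<lambda>N. \<Sum>\<rho>\<in>parts_le d. w N \<nu> \<rho> * C N \<rho>) \<longlonglongrightarrow> v \<nu> \<alpha> * v \<nu> \<beta>"
      by (rule Lim_transform_eventually[OF tendsto_mult[OF lim[OF \<nu>] lim[OF \<nu>]]])
        (use sys[OF \<nu>] in \<open>auto elim: eventually_mono\<close>)
    ultimately show "(\<Sum>\<rho>\<in>parts_le d. v \<nu> \<rho> * lim (\<lambda>N. C N \<rho>)) = v \<nu> \<alpha> * v \<nu> \<beta>"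
      by (rule LIMSEQ_unique)
  qed (use C0 tri0 diag in auto)
qed

subsection \<open>The \<open>q\<close>-Racah polynomials in \<open>N\<close> variables\<close>

text \<open>
  The parameters of the Askey--Wilson polynomials are \<open>\<surd>-1 s\<^sub>i q\<^bsup>(1-N)/2\<^esup>\<close>, and the variable is
  rescaled by \<open>(\<surd>-1 q\<^bsup>(1-N)/2\<^esup>)\<inverse>\<close>. The resulting nodes differ from those of the
  interpolation functions by the sign of the term \<open>s\<^sub>0 q\<^sup>i\<close>.
\<close>

definition qr_theta :: "complex \<Rightarrow> complex \<Rightarrow> nat \<Rightarrow> complex" where
  "qr_theta q s0 N = - (s0^2 * q powi (1 - int N))"

definition qr_scale :: "complex \<Rightarrow> complex \<Rightarrow> nat \<Rightarrow> complex" where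
  "qr_scale q s0 N = inverse s0 * q powi (int N - 1)"

definition qr_node :: "complex \<Rightarrow> complex \<Rightarrow> nat \<Rightarrow> nat \<Rightarrow> complex" where
  "qr_node q s0 N i = inverse s0 * q powi (int N - int i - 1) - s0 * q ^ i"

definition qr_coeff :: "complex \<Rightarrow> complex \<Rightarrow> complex \<Rightarrow> complex \<Rightarrow> complex \<Rightarrow> nat \<Rightarrow> nat \<Rightarrow> nat \<Rightarrow> complex" where
  "qr_coeff q s0 s1 s2 s3 N n m =
     qr_scale q s0 N ^ (n - m) * aw_coeff q (qr_theta q s0 N) (s1 / s0) (s2 / s0) (s3 / s0) n m"

definition qr_beta :: "complex \<Rightarrow> complex \<Rightarrow> complex \<Rightarrow> complex \<Rightarrow> complex \<Rightarrow> nat \<Rightarrow> nat \<Rightarrow> complex" where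
  "qr_beta q s0 s1 s2 s3 N n = qr_scale q s0 N * (1 + qr_theta q s0 N -
     aw_A q (qr_theta q s0 N) (s1 / s0) (s2 / s0) (s3 / s0) n -
     aw_C q (qr_theta q s0 N) (s1 / s0) (s2 / s0) (s3 / s0) n)"

definition qr_gamma :: "complex \<Rightarrow> complex \<Rightarrow> complex \<Rightarrow> complex \<Rightarrow> complex \<Rightarrow> nat \<Rightarrow> nat \<Rightarrow> complex" where
  "qr_gamma q s0 s1 s2 s3 N n = qr_scale q s0 N ^ 2 * aw_gamma q (qr_theta q s0 N) (s1 / s0) (s2 / s0) (s3 / s0) n"

lemma qpoch_add: "qpoch x q (m + r) = qpoch x q m * qpoch (x * q ^ m) q r"
  by (induction r) (simp_all add: qpoch_Suc power_add mult_ac)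

lemma tendsto_qpoch [tendsto_intros]:
  "(f \<longlongrightarrow> x) F \<Longrightarrow> ((\<lambda>n. qpoch (f n) q r) \<longlongrightarrow> qpoch x q r) F"
  unfolding qpoch_def by (intro tendsto_prod tendsto_diff tendsto_mult tendsto_const)

text \<open>The limit of the recurrence coefficient of index N + t, and the factor that a box of
  content t contributes to the norm.\<close>

definition gamma_lim :: "complex \<Rightarrow> complex \<Rightarrow> complex \<Rightarrow> complex \<Rightarrow> complex \<Rightarrow> complex \<Rightarrow> int \<Rightarrow> complex" where
  "gamma_lim q s0 S s1 s2 s3 t = S * q powi (t - 1) *
    ((1 + s0 * s1 * q powi t) * (1 + s0 * s2 * q powi t) * (1 + s0 * s3 * q powi t)) *
    ((1 + s1 * s2 * q powi t) * (1 + s1 * s3 * q powi t) * (1 + s2 * s3 * q powi t)) /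
    ((1 - S * q powi (2 * t - 1)) * (1 - S * q powi (2 * t)) ^ 2 * (1 - S * q powi (2 * t + 1)))"

text \<open>\<open>S\<close> has a name of its own because the other parameters will vary with N
  while their product with s0 stays fixed.\<close>

context
  fixes q s0 S :: complex
  assumes q0: "q \<noteq> 0" and q1: "\<And>k. k > 0 \<Longrightarrow> q ^ k \<noteq> 1" and s0: "s0 \<noteq> 0"
    and S: "\<And>k. S * q powi k \<noteq> 1"
begin

lemma powi_mult: "q powi a * q powi b = q powi (a + b)"
  using q0 by (simp add: power_int_add)

lemma qr_T:
  assumes "s0 * s1 * s2 * s3 = S"
  shows "(qr_theta q s0 N)^2 * (s1 / s0) * (s2 / s0) * (s3 / s0) = S * q powi (2 - 2 * int N)"
proof -
  have "(qr_theta q s0 N)^2 = s0 ^ 4 * (q powi (1 - int N) * q powi (1 - int N))"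
    by (simp add: qr_theta_def power2_eq_square power4_eq_xxxx)
  also have "q powi (1 - int N) * q powi (1 - int N) = q powi (2 - 2 * int N)"
    unfolding powi_mult by simp
  finally show ?thesis
    unfolding assms[symmetric] using s0 by (simp add: power4_eq_xxxx field_simps)
qed

lemma qr_T_powi:
  "S * q powi (2 - 2 * int N) * q powi k = S * q powi (2 - 2 * int N + k)"
  unfolding mult.assoc powi_mult ..

lemma qr_three_term:
  assumes ss: "s0 * s1 * s2 * s3 = S"
  shows "three_term (qr_coeff q s0 s1 s2 s3 N) (qr_node q s0 N) (qr_beta q s0 s1 s2 s3 N) (qr_gamma q s0 s1 s2 s3 N)"
proof
  let ?\<theta> = "qr_theta q s0 N" and ?\<kappa> = "qr_scale q s0 N"
  let ?a = "aw_coeff q ?\<theta> (s1 / s0) (s2 / s0) (s3 / s0)"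
  define T where "T = ?\<theta>^2 * (s1 / s0) * (s2 / s0) * (s3 / s0)"
  have T: "T * q powi k \<noteq> 1" for k
    unfolding T_def qr_T[OF ss] qr_T_powi by (rule S)
  note diag = aw_coeff_diag[OF q0 q1 T_def T]
  show "qr_coeff q s0 s1 s2 s3 N n n = 1" for n
    by (simp add: qr_coeff_def diag)
  have zero: "?a n m = 0" if "n < m" for n m
    using that by (simp add: aw_coeff_def)
  then show "qr_coeff q s0 s1 s2 s3 N n m = 0" if "n < m" for n m
    using that by (simp add: qr_coeff_def)
  fix n m :: nat assume m: "m \<le> Suc n"
  have node: "qr_node q s0 N m = ?\<kappa> * (inverse q ^ m + ?\<theta> * q ^ m)"
  proof -
    have "?\<kappa> * ?\<theta> = - s0 * (q powi (int N - 1) * q powi (1 - int N))"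
      using s0 by (simp add: qr_scale_def qr_theta_def power2_eq_square)
    then have "?\<kappa> * ?\<theta> = - s0" unfolding powi_mult by simp
    moreover have "q powi (int N - 1) * inverse q ^ m = q powi (int N - int m - 1)"
      using powi_mult[of "int N - 1" "- int m"] by (simp add: power_int_minus power_inverse algebra_simps)
    ultimately show ?thesis
      by (simp add: qr_node_def qr_scale_def distrib_left mult.assoc[symmetric])
  qed
  show "(if m = 0 then 0 else qr_coeff q s0 s1 s2 s3 N n (m - 1)) + qr_node q s0 N m * qr_coeff q s0 s1 s2 s3 N n m =
      qr_coeff q s0 s1 s2 s3 N (Suc n) m + qr_beta q s0 s1 s2 s3 N n * qr_coeff q s0 s1 s2 s3 N n m +
      qr_gamma q s0 s1 s2 s3 N n * (if n = 0 then 0 else qr_coeff q s0 s1 s2 s3 N (n - 1) m)"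
  \<comment> \<open>For m = n + 1 the exponent n - m of the scale is truncated; otherwise the whole
    recurrence is homogeneous of weight n + 1 - m in the scale.\<close>
  proof (cases "m = Suc n")
    case True
    then show ?thesis by (simp add: qr_coeff_def zero diag)
  next
    case False
    then have mn: "m \<le> n" using m by simp
    have 1: "(if m = 0 then 0 else qr_coeff q s0 s1 s2 s3 N n (m - 1)) =
        ?\<kappa> ^ Suc (n - m) * (if m = 0 then 0 else ?a n (m - 1))"
    proof (cases m)
      case (Suc m')
      then have "n - m' = Suc (n - m)" using mn by simp
      then show ?thesis using Suc by (simp add: qr_coeff_def)
    qed simp
    have 2: "qr_gamma q s0 s1 s2 s3 N n * (if n = 0 then 0 else qr_coeff q s0 s1 s2 s3 N (n - 1) m) =
        ?\<kappa> ^ Suc (n - m) * (aw_gamma q ?\<theta> (s1 / s0) (s2 / s0) (s3 / s0) n * (if n = 0 then 0 else ?a (n - 1) m))"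
    proof (cases "m = n")
      case True
      then show ?thesis using zero[of "n - 1" n] by (simp add: qr_coeff_def)
    next
      case False
      then have "n - m = Suc (n - 1 - m)" using mn by simp
      then show ?thesis by (simp add: qr_gamma_def qr_coeff_def power2_eq_square)
    qed
    show ?thesis
      unfolding 1 2 node
      using arg_cong[OF aw_recurrence[OF q0 q1 T_def T m], of "\<lambda>x. ?\<kappa> ^ Suc (n - m) * x"] mn
      by (simp add: qr_coeff_def qr_beta_def Suc_diff_le algebra_simps)
  qed
qed

text \<open>In terms of t = k - N, only q^(N-1) and q^k still depend on N for fixed t. The factor -
  q^(N-1) that comes from the scale is multiplied into 1 - S q^(k-2N), because separately the first
  may tend to zero while the second grows.\<close>

lemma qr_gamma_eq:
  fixes N k :: nat
  assumes ss: "s0 * s1 * s2 * s3 = S"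
  defines "t \<equiv> int k - int N"
  shows "qr_gamma q s0 s1 s2 s3 N k = (S * q powi (t - 1) - q powi (int N - 1)) * (1 - q ^ k) *
    ((1 + s0 * s1 * q powi t) * (1 + s0 * s2 * q powi t) * (1 + s0 * s3 * q powi t)) *
    ((1 + s1 * s2 * q powi t) * (1 + s1 * s3 * q powi t) * (1 + s2 * s3 * q powi t)) /
    ((1 - S * q powi (2 * t - 1)) * (1 - S * q powi (2 * t)) ^ 2 * (1 - S * q powi (2 * t + 1)))"
proof -
  let ?\<theta> = "qr_theta q s0 N" and ?\<kappa> = "qr_scale q s0 N" and ?W = "q powi (int k - 1)"
  have gW: "q powi (1 - int N) * ?W = q powi t"
    unfolding powi_mult t_def by (rule arg_cong[where f = "power_int q"]) simp
  have b: "?\<theta> * (x / s0) * ?W = - (s0 * x * q powi t)" for x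
    unfolding gW[symmetric] qr_theta_def using s0 by (simp add: power2_eq_square)
  have bb: "?\<theta> * (x / s0) * (y / s0) * ?W = - (x * y * q powi t)" for x y
    unfolding gW[symmetric] qr_theta_def using s0 by (simp add: power2_eq_square)
  have e: "2 - 2 * int N + (2 * int k - 3) = 2 * t - 1" "2 - 2 * int N + (2 * int k - 2) = 2 * t"
    "2 - 2 * int N + (2 * int k - 1) = 2 * t + 1" "2 - 2 * int N + (int k - 2) = int k - 2 * int N"
    by (simp_all add: t_def)
  have "?\<kappa>^2 * ?\<theta> * (1 - S * q powi (int k - 2 * int N)) = S * q powi (t - 1) - q powi (int N - 1)"
  proof -
    have "?\<kappa>^2 * ?\<theta> = - (q powi (int N - 1) * (q powi (int N - 1) * q powi (1 - int N)))"
      using s0 by (simp add: qr_scale_def qr_theta_def power2_eq_square field_simps)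
    then have "?\<kappa>^2 * ?\<theta> = - (q powi (int N - 1))" unfolding powi_mult by simp
    moreover have "q powi (int N - 1) * q powi (int k - 2 * int N) = q powi (t - 1)"
      unfolding powi_mult t_def by (rule arg_cong[where f = "power_int q"]) simp
    ultimately show ?thesis by (simp add: algebra_simps)
  qed
  note lead = this
  have "qr_gamma q s0 s1 s2 s3 N k = (?\<kappa>^2 * ?\<theta> * (1 - S * q powi (int k - 2 * int N))) * (1 - q ^ k) *
    ((1 + s0 * s1 * q powi t) * (1 + s0 * s2 * q powi t) * (1 + s0 * s3 * q powi t)) *
    ((1 + s1 * s2 * q powi t) * (1 + s1 * s3 * q powi t) * (1 + s2 * s3 * q powi t)) /
    ((1 - S * q powi (2 * t - 1)) * (1 - S * q powi (2 * t)) ^ 2 * (1 - S * q powi (2 * t + 1)))"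
    unfolding qr_gamma_def aw_gamma_def Let_def qr_T[OF ss] qr_T_powi e b bb by (simp add: mult_ac)
  then show ?thesis unfolding lead .
qed

context
  fixes r1 r2 r3 :: "nat \<Rightarrow> complex" and s1 s2 s3 :: complex
  assumes r: "r1 \<longlonglongrightarrow> s1" "r2 \<longlonglongrightarrow> s2" "r3 \<longlonglongrightarrow> s3" and rS: "\<And>N. s0 * r1 N * r2 N * r3 N = S"
    and qlt: "norm q < 1"
begin

lemma nat_add_at_top: "filterlim (\<lambda>N. nat (int N + t)) at_top sequentially"
  using nat_shift_at_top[of "t + 1"] by (simp add: algebra_simps)

lemma power_shift_tendsto: "(\<lambda>N. q ^ nat (int N + t)) \<longlonglongrightarrow> 0"
  using filterlim_compose[OF LIMSEQ_power_zero[OF qlt] nat_add_at_top] .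

lemma powi_shift_tendsto: "(\<lambda>N. q powi (int N + t)) \<longlonglongrightarrow> 0"
proof (rule Lim_transform_eventually[OF power_shift_tendsto[of t]])
  show "\<forall>\<^sub>F N in sequentially. q ^ nat (int N + t) = q powi (int N + t)"
    using eventually_ge_at_top[of "nat (- t)"] by eventually_elim (simp add: power_int_def)
qed

lemma qr_gamma_limit:
  "(\<lambda>N. qr_gamma q s0 (r1 N) (r2 N) (r3 N) N (nat (int N + t))) \<longlonglongrightarrow> gamma_lim q s0 S s1 s2 s3 t"
proof -
  let ?f = "\<lambda>N. (S * q powi (t - 1) - q powi (int N + - 1)) * (1 - q ^ nat (int N + t)) *
    ((1 + s0 * r1 N * q powi t) * (1 + s0 * r2 N * q powi t) * (1 + s0 * r3 N * q powi t)) *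
    ((1 + r1 N * r2 N * q powi t) * (1 + r1 N * r3 N * q powi t) * (1 + r2 N * r3 N * q powi t)) /
    ((1 - S * q powi (2 * t - 1)) * (1 - S * q powi (2 * t)) ^ 2 * (1 - S * q powi (2 * t + 1)))"
  have "?f \<longlonglongrightarrow> (S * q powi (t - 1) - 0) * (1 - 0) *
    ((1 + s0 * s1 * q powi t) * (1 + s0 * s2 * q powi t) * (1 + s0 * s3 * q powi t)) *
    ((1 + s1 * s2 * q powi t) * (1 + s1 * s3 * q powi t) * (1 + s2 * s3 * q powi t)) /
    ((1 - S * q powi (2 * t - 1)) * (1 - S * q powi (2 * t)) ^ 2 * (1 - S * q powi (2 * t + 1)))"
    by (intro tendsto_divide tendsto_mult tendsto_diff tendsto_add tendsto_const r powi_shift_tendsto power_shift_tendsto)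
      (use S in \<open>simp add: eq_commute[of 1]\<close>)
  moreover have "\<forall>\<^sub>F N in sequentially. ?f N = qr_gamma q s0 (r1 N) (r2 N) (r3 N) N (nat (int N + t))"
    using eventually_ge_at_top[of "nat (- t)"]
  proof eventually_elim
    case (elim N)
    then have "int (nat (int N + t)) - int N = t" by simp
    then show ?case unfolding qr_gamma_eq[OF rS] by simp
  qed
  moreover have "(S * q powi (t - 1) - 0) * (1 - 0) *
    ((1 + s0 * s1 * q powi t) * (1 + s0 * s2 * q powi t) * (1 + s0 * s3 * q powi t)) *
    ((1 + s1 * s2 * q powi t) * (1 + s1 * s3 * q powi t) * (1 + s2 * s3 * q powi t)) /
    ((1 - S * q powi (2 * t - 1)) * (1 - S * q powi (2 * t)) ^ 2 * (1 - S * q powi (2 * t + 1))) = gamma_lim q s0 S s1 s2 s3 t"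
    unfolding gamma_lim_def by (simp only: diff_zero mult_1_right)
  ultimately show ?thesis
    by (simp only: Lim_transform_eventually[of ?f])
qed

text \<open>Besides the parameters, only (q;q)_(m+n) / (q;q)_m depends on N, where m is the second
  index; it equals (q^(m+1);q)_n and tends to 1. The powers of q from the scale and from
  \<open>aw_coeff\<close> cancel up to q^(-e n).\<close>

lemma qr_coeff_limit:
  fixes l e :: int
  assumes "e \<le> l"
  defines "n \<equiv> nat (l - e)"
  shows "(\<lambda>N. qr_coeff q s0 (r1 N) (r2 N) (r3 N) N (nat (int N - 1 + l)) (nat (int N - 1 + e))) \<longlonglongrightarrow>
    (inverse s0) ^ n * (qpoch (- s0 * s1 * q powi e) q n * qpoch (- s0 * s2 * q powi e) q n *
      qpoch (- s0 * s3 * q powi e) q n /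
      (q powi (e * (l - e)) * qpoch q q n * qpoch (S * q powi (e + l - 1)) q n))"
proof -
  let ?m = "\<lambda>N. nat (int N + (e - 1))"
  let ?f = "\<lambda>N. (inverse s0) ^ n * ((qpoch (- s0 * r1 N * q powi e) q n * qpoch (- s0 * r2 N * q powi e) q n *
      qpoch (- s0 * r3 N * q powi e) q n) * qpoch (q * q ^ ?m N) q n /
      (q powi (e * (l - e)) * qpoch q q n * qpoch (S * q powi (e + l - 1)) q n))"
  have q_nz: "qpoch q q k \<noteq> 0" for k
    using q1[of "Suc _"] by (auto simp: qpoch_def prod_zero_iff)
  have S_nz: "qpoch (S * q powi j) q k \<noteq> 0" for j k
  proof -
    have "S * q powi j * q ^ i \<noteq> 1" for i
      using S[of "j + int i"] q0 by (simp add: power_int_add mult.assoc)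
    then show ?thesis by (auto simp: qpoch_def prod_zero_iff eq_commute[of 1])
  qed
  have "?f \<longlonglongrightarrow> (inverse s0) ^ n * ((qpoch (- s0 * s1 * q powi e) q n * qpoch (- s0 * s2 * q powi e) q n *
      qpoch (- s0 * s3 * q powi e) q n) * qpoch (q * 0) q n /
      (q powi (e * (l - e)) * qpoch q q n * qpoch (S * q powi (e + l - 1)) q n))"
    by (intro tendsto_divide tendsto_mult tendsto_const tendsto_qpoch r power_shift_tendsto)
      (use q_nz S_nz q0 in simp)
  moreover have "\<forall>\<^sub>F N in sequentially. ?f N =
      qr_coeff q s0 (r1 N) (r2 N) (r3 N) N (nat (int N - 1 + l)) (nat (int N - 1 + e))"
    using eventually_ge_at_top[of "nat (1 - e)"]
  proof eventually_elim
    case (elim N)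
    define m where "m = ?m N"
    have m: "int m = int N - 1 + e" "nat (int N - 1 + e) = m" "nat (int N - 1 + l) = m + n"
      using elim assms(1) by (auto simp: m_def n_def)
    have th: "qr_theta q s0 N * (x / s0) * q ^ m = - s0 * x * q powi e" for x
    proof -
      have "q powi (1 - int N) * q ^ m = q powi e"
        unfolding power_int_of_nat[of q m, symmetric] powi_mult m(1) by simp
      from this[symmetric] show ?thesis using s0 by (simp add: qr_theta_def power2_eq_square)
    qed
    have Tp: "2 - 2 * int N + (int (m + n) + int m - 1) = e + l - 1"
      using m(1) assms(1) by (simp add: n_def)
    have sc: "qr_scale q s0 N ^ n * inverse q ^ (m * n) = (inverse s0) ^ n * inverse (q powi (e * (l - e)))"
    proof -
      have "qr_scale q s0 N * inverse q ^ m = inverse s0 * q powi (- e)"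
      proof -
        have "inverse q ^ m = q powi (- int m)"
          by (simp add: power_int_minus power_inverse)
        then show ?thesis
          unfolding qr_scale_def by (simp only: mult.assoc powi_mult m(1)) simp
      qed
      then have "(qr_scale q s0 N * inverse q ^ m) ^ n = (inverse s0 * q powi (- e)) ^ n" by simp
      moreover have "(q powi (- e)) ^ n = inverse (q powi (e * (l - e)))"
      proof -
        have "(q powi (- e)) ^ n = q powi (- e * int n)"
          by (simp only: power_int_mult power_int_of_nat)
        also have "- e * int n = - (e * (l - e))" using assms(1) by (simp add: n_def)
        finally show ?thesis by (simp add: power_int_minus)
      qed
      ultimately show ?thesis by (simp add: power_mult_distrib power_mult[symmetric])
    qed
    have "qr_coeff q s0 (r1 N) (r2 N) (r3 N) N (m + n) m =
      (qr_scale q s0 N ^ n * inverse q ^ (m * n)) * ((qpoch (- s0 * r1 N * q powi e) q n * qpoch (- s0 * r2 N * q powi e) q n *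
      qpoch (- s0 * r3 N * q powi e) q n) * (qpoch q q m * qpoch (q * q ^ m) q n) /
      (qpoch q q n * qpoch q q m * qpoch (S * q powi (e + l - 1)) q n))"
      unfolding qr_coeff_def aw_coeff_def qr_T[OF rS] qr_T_powi th Tp qpoch_add by simp
    also have "\<dots> = ?f N"
      unfolding sc m_def[symmetric] using q_nz[of m] q0 by (simp add: field_simps)
    finally show ?case unfolding m by simp
  qed
  ultimately have "(\<lambda>N. qr_coeff q s0 (r1 N) (r2 N) (r3 N) N (nat (int N - 1 + l)) (nat (int N - 1 + e))) \<longlonglongrightarrow>
      (inverse s0) ^ n * ((qpoch (- s0 * s1 * q powi e) q n * qpoch (- s0 * s2 * q powi e) q n *
      qpoch (- s0 * s3 * q powi e) q n) * qpoch (q * 0) q n /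
      (q powi (e * (l - e)) * qpoch q q n * qpoch (S * q powi (e + l - 1)) q n))"
    by (rule Lim_transform_eventually)
  then show ?thesis by (simp add: qpoch_def[of 0])
qed

text \<open>From row \<open>part_length \<nu>\<close> on, the matrix of \<open>sig\<close> is zero
  left of the diagonal and 1 on it, so the size is fixed before the limit is taken. The powers of s0
  in the entries split into row and column factors, which give the prefactor of
  \<open>sigma_qR\<close>.\<close>

lemma sig_limit:
  assumes \<nu>: "\<nu> \<in> partitions" and \<mu>: "\<mu> \<in> partitions" "part_subseteq \<mu> \<nu>" and SS: "s0 * s1 * s2 * s3 = S"
  shows "(\<lambda>N. three_term.sig (qr_coeff q s0 (r1 N) (r2 N) (r3 N) N) N \<nu> \<mu>) \<longlonglongrightarrow> sigma_qR \<nu> \<mu> q s0 s1 s2 s3"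
proof -
  let ?L = "part_length \<nu>"
  let ?K = "\<lambda>N. qr_coeff q s0 (r1 N) (r2 N) (r3 N) N"
  let ?l = "\<lambda>i. int (\<nu> i) - int i" and ?e = "\<lambda>k. int (\<mu> k) - int k"
  let ?entry = "\<lambda>j k. (s0 powi (- ?l j)) * (s0 powi (?e k)) * sigma_entry \<nu> \<mu> q s0 s1 s2 s3 j k"
  have len: "part_length \<mu> \<le> ?L" by (rule part_subseteq_length[OF \<mu>(1) \<nu> \<mu>(2)])
  have idx: "shifted N \<kappa> i = nat (int N - 1 + (int (\<kappa> i) - int i))" if "i < N" for N i and \<kappa> :: "nat \<Rightarrow> nat"
    using that by (simp add: shifted_def)
  have entry: "(\<lambda>N. ?K N (nat (int N - 1 + ?l i)) (nat (int N - 1 + ?e k))) \<longlonglongrightarrow> ?entry i k" for i k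
  proof (cases "?e k \<le> ?l i")
    case True
    have d: "int (\<nu> i) - int i - int (\<mu> k) + int k = ?l i - ?e k" by simp
    have x: "int (\<nu> i) + int (\<mu> k) - 1 - int i - int k = ?e k + ?l i - 1" by simp
    have "s0 powi (- ?l i) * s0 powi (?e k) = s0 powi (- int (nat (?l i - ?e k)))"
    proof -
      have "- int (nat (?l i - ?e k)) = - ?l i + ?e k" using True by simp
      then show ?thesis using power_int_add[of s0 "- ?l i" "?e k"] s0 by (simp only: simp_thms)
    qed
    then have p: "s0 powi (- ?l i) * s0 powi (?e k) = inverse s0 ^ nat (?l i - ?e k)"
      by (simp only: power_int_minus power_int_of_nat power_inverse)
    show ?thesis
      using qr_coeff_limit[OF True] True
      unfolding sigma_entry_def Let_def d x p SS by simp
  next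
    case False
    \<comment> \<open>N has to be so large that \<open>nat\<close> truncates neither index.\<close>
    have ev: "\<forall>\<^sub>F N in sequentially. ?K N (nat (int N - 1 + ?l i)) (nat (int N - 1 + ?e k)) = 0"
      using eventually_ge_at_top[of "nat (1 - ?l i)"] eventually_ge_at_top[of "nat (1 - ?e k)"]
      by eventually_elim (use False in \<open>simp add: qr_coeff_def aw_coeff_def\<close>)
    have z: "?entry i k = 0"
      using False by (simp add: sigma_entry_def Let_def)
    show ?thesis
      unfolding z by (rule tendsto_eventually[OF ev])
  qed
  have "(\<lambda>N. det (mat ?L ?L (\<lambda>(i, k). ?K N (nat (int N - 1 + ?l i)) (nat (int N - 1 + ?e k))))) \<longlonglongrightarrow>
      det (mat ?L ?L (\<lambda>(i, k). ?entry i k))"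
    by (rule tendsto_det_mat) (rule entry)
  moreover have "det (mat ?L ?L (\<lambda>(i, k). ?entry i k)) = sigma_qR \<nu> \<mu> q s0 s1 s2 s3"
  proof -
    have "(\<Prod>i<?L. s0 powi (- ?l i)) * (\<Prod>k<?L. s0 powi (?e k)) = (\<Prod>i<?L. s0 powi (int (\<mu> i) - int (\<nu> i)))"
      unfolding prod.distrib[symmetric] using s0 by (simp add: power_int_add[symmetric])
    also have "\<dots> = s0 powi (\<Sum>i<?L. int (\<mu> i) - int (\<nu> i))"
    proof -
      have "(\<Prod>i\<in>A. s0 powi (f i)) = s0 powi (\<Sum>i\<in>A. f i)" if "finite A" for f and A :: "nat set"
        using that s0 by (induction A rule: finite_induct) (simp_all add: power_int_add)
      then show ?thesis by simp
    qed
    also have "(\<Sum>i<?L. int (\<mu> i) - int (\<nu> i)) = int (part_size \<mu>) - int (part_size \<nu>)"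
      unfolding part_size_eq[OF \<mu>(1) len] part_size_eq[OF \<nu> order_refl] by (simp add: sum_subtractf)
    finally show ?thesis
      unfolding det_mat_scale sigma_qR_def by simp
  qed
  moreover have "\<forall>\<^sub>F N in sequentially. det (mat ?L ?L (\<lambda>(i, k). ?K N (nat (int N - 1 + ?l i)) (nat (int N - 1 + ?e k)))) =
      three_term.sig (?K N) N \<nu> \<mu>"
    using eventually_ge_at_top[of ?L]
  proof eventually_elim
    case (elim N)
    interpret three_term "?K N" "qr_node q s0 N" "qr_beta q s0 (r1 N) (r2 N) (r3 N) N" "qr_gamma q s0 (r1 N) (r2 N) (r3 N) N"
      by (rule qr_three_term[OF rS])
    have "sig N \<nu> \<mu> = det (mat ?L ?L (\<lambda>(i, k). ?K N (shifted N \<nu> i) (shifted N \<mu> k)))"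
      unfolding sig_def
    proof (rule det_mat_trailing_unit[OF elim])
      fix i assume i: "?L \<le> i" "i < N"
      then have \<nu>i: "\<nu> i = 0" "\<mu> i = 0"
        using part_eq_0_iff[OF \<nu>, of i] part_eq_0_iff[OF \<mu>(1), of i] len by auto
      then have "shifted N \<nu> i = shifted N \<mu> i" by (simp add: shifted_def)
      then show "(case (i, i) of (i, k) \<Rightarrow> ?K N (shifted N \<nu> i) (shifted N \<mu> k)) = 1" by simp
      fix k assume "k < i"
      then have "shifted N \<nu> i < shifted N \<mu> k" using i \<nu>i by (simp add: shifted_def)
      then show "(case (i, k) of (i, k) \<Rightarrow> ?K N (shifted N \<nu> i) (shifted N \<mu> k)) = 0" by (simp add: K_zero)
    qed
    also have "\<dots> = det (mat ?L ?L (\<lambda>(i, k). ?K N (nat (int N - 1 + ?l i)) (nat (int N - 1 + ?e k))))"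
      by (intro arg_cong[where f = det] eq_matI) (use elim in \<open>auto simp: idx\<close>)
    finally show ?case by simp
  qed
  ultimately show ?thesis
    using Lim_transform_eventually by simp
qed

text \<open>The index N - i + j is N plus the content j - i of the box (i, j), and the set of boxes
  does not depend on N.\<close>

lemma gamma_product_limit:
  assumes \<nu>: "\<nu> \<in> partitions"
  shows "(\<lambda>N. \<Prod>i<N. \<Prod>k = N - i..<N - i + \<nu> i. qr_gamma q s0 (r1 N) (r2 N) (r3 N) N k) \<longlonglongrightarrow>
    (\<Prod>i<part_length \<nu>. \<Prod>j<\<nu> i. gamma_lim q s0 S s1 s2 s3 (int j - int i))"
proof -
  let ?L = "part_length \<nu>"
  let ?g = "\<lambda>N k. qr_gamma q s0 (r1 N) (r2 N) (r3 N) N k"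
  have "(\<lambda>N. \<Prod>i<?L. \<Prod>j<\<nu> i. ?g N (nat (int N + (int j - int i)))) \<longlonglongrightarrow>
      (\<Prod>i<?L. \<Prod>j<\<nu> i. gamma_lim q s0 S s1 s2 s3 (int j - int i))"
    by (intro tendsto_prod qr_gamma_limit)
  moreover have "\<forall>\<^sub>F N in sequentially. (\<Prod>i<?L. \<Prod>j<\<nu> i. ?g N (nat (int N + (int j - int i)))) =
      (\<Prod>i<N. \<Prod>k = N - i..<N - i + \<nu> i. ?g N k)"
    using eventually_ge_at_top[of ?L]
  proof eventually_elim
    case (elim N)
    have "(\<Prod>i<N. \<Prod>k = N - i..<N - i + \<nu> i. ?g N k) = (\<Prod>i<?L. \<Prod>k = N - i..<N - i + \<nu> i. ?g N k)"
    proof (intro prod.mono_neutral_right ballI)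
      fix i assume "i \<in> {..<N} - {..<?L}"
      then have "\<nu> i = 0" using part_eq_0_iff[OF \<nu>, of i] by auto
      then show "(\<Prod>k = N - i..<N - i + \<nu> i. ?g N k) = 1" by simp
    qed (use elim in auto)
    also have "\<dots> = (\<Prod>i<?L. \<Prod>j<\<nu> i. ?g N (nat (int N + (int j - int i))))"
    proof (rule prod.cong[OF refl])
      fix i assume "i \<in> {..<?L}"
      then have "i < N" using elim by simp
      then show "(\<Prod>k = N - i..<N - i + \<nu> i. ?g N k) = (\<Prod>j<\<nu> i. ?g N (nat (int N + (int j - int i))))"
        by (intro prod.reindex_bij_witness[where i = "\<lambda>j. N - i + j" and j = "\<lambda>k. k - (N - i)"])
          (auto intro!: arg_cong[where f = "?g N"])
    qed
    finally show ?case by simp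
  qed
  ultimately show ?thesis by (rule Lim_transform_eventually)
qed

end

end

subsection \<open>The norm as a product over boxes\<close>

lemma qpoch_part_boxes:
  assumes "q \<noteq> 0"
  shows "qpoch_part x q \<nu> = (\<Prod>i<part_length \<nu>. \<Prod>j<\<nu> i. 1 - x * q powi (int j - int i))"
proof -
  have "q powi (- int i) * q ^ j = q powi (int j - int i)" for i j
    using power_int_add[of q "- int i" "int j"] assms by (simp add: algebra_simps)
  then show ?thesis
    unfolding qpoch_part_def qpoch_def mult.assoc by (simp only:)
qed

lemma prod_lessThan_double: "(\<Prod>k<2 * n. f k) = (\<Prod>i<n. f (2 * i) * f (Suc (2 * i)) :: 'a :: comm_monoid_mult)"
  by (induction n) (simp_all add: mult.assoc)

lemma part_double_length:
  assumes "\<nu> \<in> partitions"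
  shows "part_length (part_double \<nu>) = 2 * part_length \<nu>"
proof -
  have "{i. part_double \<nu> i \<noteq> 0} = {..<2 * part_length \<nu>}"
  proof (rule Set.set_eqI)
    fix i
    have "i div 2 < part_length \<nu> \<longleftrightarrow> i < 2 * part_length \<nu>" by auto
    then show "i \<in> {i. part_double \<nu> i \<noteq> 0} \<longleftrightarrow> i \<in> {..<2 * part_length \<nu>}"
      unfolding mem_Collect_eq lessThan_iff using part_nonzero_iff[OF assms, of "i div 2"] by (simp only: part_double_def mult_eq_0_iff numeral_neq_zero simp_thms)
  qed
  then show ?thesis by (simp add: part_length_def)
qed

text \<open>Each box of content t becomes a block of four boxes, of contents 2t - 1, 2t, 2t and 2t +
  1; these give the denominator of \<open>gamma_lim\<close>.\<close>

lemma qpoch_part_double: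
  assumes "\<nu> \<in> partitions" "q \<noteq> 0"
  shows "qpoch_part x q (part_double \<nu>) = (\<Prod>i<part_length \<nu>. \<Prod>j<\<nu> i.
    (1 - x * q powi (2 * (int j - int i) - 1)) * (1 - x * q powi (2 * (int j - int i))) ^ 2 *
    (1 - x * q powi (2 * (int j - int i) + 1)))"
proof -
  have "qpoch_part x q (part_double \<nu>) = (\<Prod>i<part_length \<nu>.
      (\<Prod>j<2 * \<nu> i. 1 - x * q powi (int j - int (2 * i))) * (\<Prod>j<2 * \<nu> i. 1 - x * q powi (int j - int (Suc (2 * i)))))"
    unfolding qpoch_part_boxes[OF assms(2)] part_double_length[OF assms(1)] prod_lessThan_double[of _ "part_length \<nu>"]
    by (simp add: part_double_def)
  also have "\<dots> = (\<Prod>i<part_length \<nu>. \<Prod>j<\<nu> i.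
    (1 - x * q powi (2 * (int j - int i) - 1)) * (1 - x * q powi (2 * (int j - int i))) ^ 2 *
    (1 - x * q powi (2 * (int j - int i) + 1)))"
    unfolding prod_lessThan_double prod.distrib[symmetric]
  proof (intro prod.cong refl)
    fix i j
    have e: "int (2 * j) - int (2 * i) = 2 * (int j - int i)" "int (Suc (2 * j)) - int (2 * i) = 2 * (int j - int i) + 1"
      "int (2 * j) - int (Suc (2 * i)) = 2 * (int j - int i) - 1" "int (Suc (2 * j)) - int (Suc (2 * i)) = 2 * (int j - int i)"
      by simp_all
    show "(1 - x * q powi (int (2 * j) - int (2 * i))) * (1 - x * q powi (int (Suc (2 * j)) - int (2 * i))) *
        ((1 - x * q powi (int (2 * j) - int (Suc (2 * i)))) * (1 - x * q powi (int (Suc (2 * j)) - int (Suc (2 * i))))) =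
        (1 - x * q powi (2 * (int j - int i) - 1)) * (1 - x * q powi (2 * (int j - int i))) ^ 2 *
        (1 - x * q powi (2 * (int j - int i) + 1))"
      unfolding e by (simp add: power2_eq_square mult_ac)
  qed
  finally show ?thesis .
qed

lemma sum_contents:
  assumes "\<nu> \<in> partitions"
  shows "(\<Sum>i<part_length \<nu>. \<Sum>j<\<nu> i. int j - int i) = int (part_n (part_transpose \<nu>)) - int (part_n \<nu>)"
proof -
  let ?L = "part_length \<nu>"
  have "{j. part_transpose \<nu> j \<noteq> 0} = {..<\<nu> 0}"
    using part_transpose_iff[OF assms, of _ 0] by auto
  then have len: "part_length (part_transpose \<nu>) = \<nu> 0"
    by (simp add: part_length_def)
  have tr: "part_transpose \<nu> j = (\<Sum>i<?L. if j < \<nu> i then 1 else 0)" for j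
  proof -
    have "{i. j < \<nu> i} = {..<?L} \<inter> {i. j < \<nu> i}"
      using part_nonzero_iff[OF assms] by fastforce
    then show ?thesis
      unfolding part_transpose_def by (subst sum.If_cases) simp_all
  qed
  have "part_n (part_transpose \<nu>) = (\<Sum>j<\<nu> 0. \<Sum>i<?L. if j < \<nu> i then j else 0)"
    unfolding part_n_def len tr sum_distrib_left by (intro sum.cong refl) simp
  also have "\<dots> = (\<Sum>i<?L. \<Sum>j<\<nu> 0. if j < \<nu> i then j else 0)"
    by (rule sum.swap)
  also have "\<dots> = (\<Sum>i<?L. \<Sum>j<\<nu> i. j)"
    using partitions_antimono[OF assms, of 0] by (intro sum.cong refl sum.mono_neutral_cong_right) (auto intro: less_le_trans)
  finally show ?thesis
    by (simp add: part_n_def sum_subtractf mult.commute)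
qed

text \<open>Every ingredient of the norm is a product over boxes of a function of the content; for
  the power of q this is \<open>sum_contents\<close>.\<close>

lemma h_qR_boxes:
  assumes \<nu>: "\<nu> \<in> partitions" and q0: "q \<noteq> 0" and S: "S = s0 * s1 * s2 * s3"
  shows "h_qR \<nu> q s0 s1 s2 s3 = (\<Prod>i<part_length \<nu>. \<Prod>j<\<nu> i. gamma_lim q s0 S s1 s2 s3 (int j - int i))"
proof -
  let ?L = "part_length \<nu>"
  let ?P = "\<lambda>f. \<Prod>i<?L. \<Prod>j<\<nu> i. f (int j - int i)"
  have pairs: "(\<Prod>j<4. \<Prod>i<j. qpoch_part (- ([s0, s1, s2, s3] ! i) * ([s0, s1, s2, s3] ! j)) q \<nu>) =
      ?P (\<lambda>t. ((1 + s0 * s1 * q powi t) * (1 + s0 * s2 * q powi t) * (1 + s0 * s3 * q powi t)) *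
        ((1 + s1 * s2 * q powi t) * (1 + s1 * s3 * q powi t) * (1 + s2 * s3 * q powi t)))"
    unfolding qpoch_part_boxes[OF q0] by (simp add: eval_nat_numeral prod.lessThan_Suc prod.distrib mult_ac)
  have lead: "q powi (int (part_n (part_transpose \<nu>)) - int (part_n \<nu>)) * (S / q) ^ part_size \<nu> = ?P (\<lambda>t. S * q powi (t - 1))"
  proof -
    have pw: "(\<Prod>i\<in>A. q powi (f i)) = q powi (\<Sum>i\<in>A. f i)" if "finite A" for f and A :: "nat set"
      using that q0 by (induction A rule: finite_induct) (simp_all add: power_int_add)
    have "?P (\<lambda>t. S * q powi (t - 1)) = ?P (\<lambda>t. (S / q) * q powi t)"
    proof -
      have e: "S * q powi (t - 1) = (S / q) * q powi t" for t
        using q0 by (simp add: power_int_diff)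
      show ?thesis unfolding e ..
    qed
    also have "\<dots> = (S / q) ^ part_size \<nu> * ?P (\<lambda>t. q powi t)"
      by (simp only: prod.distrib prod_constant card_lessThan part_size_def power_sum)
    also have "?P (\<lambda>t. q powi t) = q powi (int (part_n (part_transpose \<nu>)) - int (part_n \<nu>))"
      by (simp only: pw finite_lessThan sum_contents[OF \<nu>])
    finally show ?thesis by (simp add: mult.commute)
  qed
  have "h_qR \<nu> q s0 s1 s2 s3 = (q powi (int (part_n (part_transpose \<nu>)) - int (part_n \<nu>)) * (S / q) ^ part_size \<nu>) *
      (\<Prod>j<4. \<Prod>i<j. qpoch_part (- ([s0, s1, s2, s3] ! i) * ([s0, s1, s2, s3] ! j)) q \<nu>) /
      qpoch_part S q (part_double \<nu>)"
    by (simp add: h_qR_def S)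
  also have "\<dots> = (\<Prod>i<?L. \<Prod>j<\<nu> i. gamma_lim q s0 S s1 s2 s3 (int j - int i))"
    unfolding lead pairs qpoch_part_double[OF \<nu> q0] prod_dividef[symmetric] prod.distrib[symmetric]
    by (simp only: gamma_lim_def mult.assoc)
  finally show ?thesis .
qed

subsection \<open>Perturbation of the parameters\<close>

text \<open>
  The functional for \<open>N\<close> variables needs nonvanishing univariate norms, but some \<open>- s\<^sub>i s\<^sub>j\<close> may be a
  power of \<open>q\<close>. Replacing \<open>(s\<^sub>1, s\<^sub>2, s\<^sub>3)\<close> with \<open>(\<zeta> s\<^sub>1, \<zeta> s\<^sub>2, \<zeta>\<^sup>-\<^sup>2 s\<^sub>3)\<close>
  moves all these products and preserves \<open>s\<^sub>0 s\<^sub>1 s\<^sub>2 s\<^sub>3\<close>.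
\<close>

lemma qr_gamma_perturbation:
  fixes q s0 s1 s2 s3 :: complex
  assumes q0: "q \<noteq> 0" and q1: "\<And>k. k > 0 \<Longrightarrow> q ^ k \<noteq> 1" and s0: "s0 \<noteq> 0"
    and S: "\<And>k. s0 * s1 * s2 * s3 * q powi k \<noteq> 1"
  obtains \<zeta> :: real where "1 < \<zeta>" "\<zeta> < 1 + 1 / real (Suc N)"
    "\<And>k. 1 \<le> k \<Longrightarrow> k < N \<Longrightarrow> qr_gamma q s0 (of_real \<zeta> * s1) (of_real \<zeta> * s2) (s3 / of_real \<zeta> ^ 2) N k \<noteq> 0"
proof -
  \<comment> \<open>The six factors 1 + s_i s_j w of the perturbed parameters as polynomials in
    \<zeta>, cleared of denominators. Each has a coefficient 1, hence finitely many roots.\<close>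
  define P where "P w = {[:1, s0 * s1 * w:], [:1, s0 * s2 * w:], [:s0 * s3 * w, 0, 1:],
    [:1, 0, s1 * s2 * w:], [:s1 * s3 * w, 1:], [:s2 * s3 * w, 1:]}" for w
  define bad where "bad = (\<Union>k<N. \<Union>p\<in>P (q powi (int k - int N)). {x. poly p x = 0})"
  have "finite bad"
    unfolding bad_def by (intro finite_UN_I) (auto simp: P_def intro!: poly_roots_finite)
  moreover have "infinite (complex_of_real ` {1<..<1 + 1 / real (Suc N)})"
    using infinite_Ioo[of 1 "1 + 1 / real (Suc N)"] by (subst finite_image_iff) (auto intro: inj_onI)
  ultimately obtain x where "x \<in> complex_of_real ` {1<..<1 + 1 / real (Suc N)}" "x \<notin> bad"
    by (metis finite_subset subsetI)
  then obtain \<zeta> :: real where \<zeta>: "1 < \<zeta>" "\<zeta> < 1 + 1 / real (Suc N)" "complex_of_real \<zeta> \<notin> bad" by auto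
  let ?z = "complex_of_real \<zeta>"
  have z0: "?z \<noteq> 0" using \<zeta>(1) by simp
  have prod_eq: "s0 * (?z * s1) * (?z * s2) * (s3 / ?z ^ 2) = s0 * s1 * s2 * s3"
    using z0 by (simp add: power2_eq_square)
  show thesis
  proof (rule that[OF \<zeta>(1,2)])
    fix k assume k: "1 \<le> k" "k < N"
    let ?t = "int k - int N"
    let ?w = "q powi ?t"
    have roots: "poly p ?z \<noteq> 0" if "p \<in> P ?w" for p
      using \<zeta>(3) k(2) that by (auto simp: bad_def)
    have n1: "1 + s0 * (?z * s1) * ?w \<noteq> 0" "1 + s0 * (?z * s2) * ?w \<noteq> 0" "1 + (?z * s1) * (?z * s2) * ?w \<noteq> 0"
      using roots[of "[:1, s0 * s1 * ?w:]"] roots[of "[:1, s0 * s2 * ?w:]"] roots[of "[:1, 0, s1 * s2 * ?w:]"]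
      by (simp_all add: P_def mult_ac)
    have n2: "1 + s0 * (s3 / ?z ^ 2) * ?w \<noteq> 0"
    proof -
      have "1 + s0 * (s3 / ?z ^ 2) * ?w = poly [:s0 * s3 * ?w, 0, 1:] ?z / ?z ^ 2"
        using z0 by (simp add: field_simps power2_eq_square)
      then show ?thesis using roots[of "[:s0 * s3 * ?w, 0, 1:]"] z0 by (simp add: P_def)
    qed
    have n3: "1 + (?z * s) * (s3 / ?z ^ 2) * ?w = poly [:s * s3 * ?w, 1:] ?z / ?z" for s
      using z0 by (simp add: field_simps power2_eq_square)
    have n4: "1 + (?z * s1) * (s3 / ?z ^ 2) * ?w \<noteq> 0" "1 + (?z * s2) * (s3 / ?z ^ 2) * ?w \<noteq> 0"
      unfolding n3 using roots[of "[:s1 * s3 * ?w, 1:]"] roots[of "[:s2 * s3 * ?w, 1:]"] z0 by (simp_all add: P_def)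
    \<comment> \<open>This factor is not moved by \<zeta>, but its vanishing would make the product
      of the four parameters a power of q.\<close>
    have n5: "s0 * s1 * s2 * s3 * q powi (?t - 1) - q powi (int N - 1) \<noteq> 0"
    proof
      assume "s0 * s1 * s2 * s3 * q powi (?t - 1) - q powi (int N - 1) = 0"
      then have "s0 * s1 * s2 * s3 * q powi (?t - 1) * q powi (1 - int N) = q powi (int N - 1) * q powi (1 - int N)"
        by simp
      moreover have "q powi (int N - 1) * q powi (1 - int N) = 1"
        using power_int_add[of q "int N - 1" "1 - int N"] q0 by simp
      moreover have "q powi (?t - 1) * q powi (1 - int N) = q powi (?t - int N)"
        using power_int_add[of q "?t - 1" "1 - int N"] q0 by simp
      ultimately show False using S[of "?t - int N"] by (simp add: mult.assoc)
    qed
    have n6: "1 - q ^ k \<noteq> 0" using q1[of k] k by simp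
    have n7: "1 - s0 * s1 * s2 * s3 * q powi j \<noteq> 0" for j
      using S[of j] by simp
    show "qr_gamma q s0 (?z * s1) (?z * s2) (s3 / ?z ^ 2) N k \<noteq> 0"
      by (subst qr_gamma_eq[OF q0 q1 s0 S prod_eq])
        (simp_all only: divide_eq_0_iff mult_eq_0_iff power_eq_0_iff n1 n2 n4 n5 n6 n7 simp_thms)
  qed
qed

subsection \<open>The \<open>q\<close>-Racah symmetric functions\<close>

lemma sigma_qR_diag:
  assumes "\<nu> \<in> partitions" "s0 \<noteq> 0"
  shows "sigma_qR \<nu> \<nu> q s0 s1 s2 s3 = 1"
proof -
  have "det (mat (part_length \<nu>) (part_length \<nu>) (\<lambda>(j, k). sigma_entry \<nu> \<nu> q s0 s1 s2 s3 j k)) =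
      (\<Prod>i<part_length \<nu>. sigma_entry \<nu> \<nu> q s0 s1 s2 s3 i i)"
  proof (subst det_mat_lower_left_zero)
    fix j k assume "j < part_length \<nu>" "k < j"
    then show "(case (j, k) of (j, k) \<Rightarrow> sigma_entry \<nu> \<nu> q s0 s1 s2 s3 j k) = 0"
      using partitions_antimono[OF assms(1), of k j] by (simp add: sigma_entry_def Let_def)
  qed simp
  also have "\<dots> = 1" by (simp add: sigma_entry_def Let_def)
  finally show ?thesis by (simp add: sigma_qR_def)
qed

text \<open>The diagonal term has the right leading part, and partitions properly contained in \<nu>
  contribute lower degree.\<close>

lemma schur_like_unitriangular:
  assumes \<epsilon>: "\<And>t. \<epsilon> t 0 = 1" and \<sigma>: "\<And>\<nu>. \<nu> \<in> partitions \<Longrightarrow> \<sigma> \<nu> \<nu> = 1"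
  shows "schur_like (\<lambda>\<nu>. \<Sum>\<mu>\<in>{\<mu> \<in> partitions. part_subseteq \<mu> \<nu>}. sym_scale (\<sigma> \<nu> \<mu>) (jts \<epsilon> \<mu>))"
  unfolding schur_like_def
proof
  fix \<nu> assume \<nu>: "\<nu> \<in> partitions"
  let ?A = "{\<mu> \<in> partitions. part_subseteq \<mu> \<nu>}"
  let ?s = "jts (\<lambda>t a. if a = 0 then 1 else 0) \<nu>"
  have "(\<Sum>\<mu>\<in>?A. sym_scale (\<sigma> \<nu> \<mu>) (jts \<epsilon> \<mu>)) =
      sym_scale (\<sigma> \<nu> \<nu>) (jts \<epsilon> \<nu>) + (\<Sum>\<mu>\<in>?A - {\<nu>}. sym_scale (\<sigma> \<nu> \<mu>) (jts \<epsilon> \<mu>))"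
    using \<nu> by (intro sum.remove) auto
  then have eq: "(\<Sum>\<mu>\<in>?A. sym_scale (\<sigma> \<nu> \<mu>) (jts \<epsilon> \<mu>)) - ?s =
      (\<Sum>\<mu>\<in>?A - {\<nu>}. sym_scale (\<sigma> \<nu> \<mu>) (jts \<epsilon> \<mu>)) + (jts \<epsilon> \<nu> - ?s)"
    using \<sigma>[OF \<nu>] by simp
  show "(\<Sum>\<mu>\<in>?A. sym_scale (\<sigma> \<nu> \<mu>) (jts \<epsilon> \<mu>)) - ?s \<in> sym_filt (int (part_size \<nu>) - 1)"
    unfolding eq
  proof (intro sym_filt_add sym_filt_sum sym_filt_scale)
    show "jts \<epsilon> \<nu> - ?s \<in> sym_filt (int (part_size \<nu>) - 1)"
      by (rule jts_diff_filt[OF \<nu>]) (simp_all add: \<epsilon>)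
    fix \<mu> assume \<mu>: "\<mu> \<in> ?A - {\<nu>}"
    have "part_size \<mu> < part_size \<nu>"
      using part_subseteq_size_eq[of \<mu> \<nu>] \<mu> \<nu> by (cases "part_size \<mu> < part_size \<nu>") auto
    then have "sym_filt (int (part_size \<mu>)) \<subseteq> sym_filt (int (part_size \<nu>) - 1)"
      by (intro sym_filt_mono) simp
    then show "jts \<epsilon> \<mu> \<in> sym_filt (int (part_size \<nu>) - 1)"
      using jts_filt[of \<mu> \<epsilon>] \<mu> by blast
  qed
qed

lemma structure_constants_expansion:
  assumes "\<alpha> \<in> partitions" "\<beta> \<in> partitions" "part_size \<alpha> + part_size \<beta> \<le> d"
  obtains C where "\<And>N. jts (node_coeff N (c N)) \<alpha> * jts (node_coeff N (c N)) \<beta> =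
    (\<Sum>\<rho>\<in>parts_le d. sym_scale (C N \<rho>) (jts (node_coeff N (c N)) \<rho>))"
proof -
  have "\<forall>N. \<exists>D. jts (node_coeff N (c N)) \<alpha> * jts (node_coeff N (c N)) \<beta> =
    (\<Sum>\<rho>\<in>parts_le d. sym_scale (D \<rho>) (jts (node_coeff N (c N)) \<rho>))"
  proof
    fix N
    have "jts (node_coeff N (c N)) \<alpha> * jts (node_coeff N (c N)) \<beta> \<in> sym_filt (int (part_size \<alpha>) + int (part_size \<beta>))"
      by (intro sym_filt_mult jts_filt assms)
    moreover have "sym_filt (int (part_size \<alpha>) + int (part_size \<beta>)) \<subseteq> sym_deg_le d"
      unfolding sym_filt_nat[symmetric] using assms(3) by (intro sym_filt_mono) linarith
    ultimately have "jts (node_coeff N (c N)) \<alpha> * jts (node_coeff N (c N)) \<beta> \<in> sym_deg_le d" by blast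
    moreover have "schur_like (jts (node_coeff N (c N)))" by (rule schur_like_jts) simp
    ultimately obtain D where "jts (node_coeff N (c N)) \<alpha> * jts (node_coeff N (c N)) \<beta> =
        (\<Sum>\<rho>\<in>parts_le d. sym_scale (D \<rho>) (jts (node_coeff N (c N)) \<rho>))"
      using schur_like_expansion by blast
    then show "\<exists>D. jts (node_coeff N (c N)) \<alpha> * jts (node_coeff N (c N)) \<beta> =
        (\<Sum>\<rho>\<in>parts_le d. sym_scale (D \<rho>) (jts (node_coeff N (c N)) \<rho>))" by blast
  qed
  from choice[OF this] obtain C where "\<And>N. jts (node_coeff N (c N)) \<alpha> * jts (node_coeff N (c N)) \<beta> =
      (\<Sum>\<rho>\<in>parts_le d. sym_scale (C N \<rho>) (jts (node_coeff N (c N)) \<rho>))"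
    by blast
  then show thesis by (rule that)
qed

lemma structure_constants_agree:
  fixes q :: real and s :: complex
  assumes q: "0 < q" "q < 1" and s: "s \<noteq> 0"
    and \<epsilon>: "\<And>\<mu>. sym_tendsto (\<lambda>N. jts (node_coeff N (\<lambda>i. s * of_real q ^ i + inverse s * of_real q powi (int N - int i - 1))) \<mu>)
      (jts \<epsilon> \<mu>)"
    and \<alpha>: "\<alpha> \<in> partitions" and \<beta>: "\<beta> \<in> partitions" and d: "part_size \<alpha> + part_size \<beta> \<le> d"
  obtains C0 C where "jts \<epsilon> \<alpha> * jts \<epsilon> \<beta> = (\<Sum>\<rho>\<in>parts_le d. sym_scale (C0 \<rho>) (jts \<epsilon> \<rho>))"
    "\<And>N. jts (node_coeff N (qr_node (of_real q) s N)) \<alpha> * jts (node_coeff N (qr_node (of_real q) s N)) \<beta> =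
      (\<Sum>\<rho>\<in>parts_le d. sym_scale (C N \<rho>) (jts (node_coeff N (qr_node (of_real q) s N)) \<rho>))"
    "\<And>\<rho>. \<rho> \<in> parts_le d \<Longrightarrow> (\<lambda>N. C N \<rho>) \<longlonglongrightarrow> C0 \<rho>"
proof -
  let ?Q = "complex_of_real q"
  let ?cp = "\<lambda>N i. s * ?Q ^ i + inverse s * ?Q powi (int N - int i - 1)"
  let ?cm = "qr_node ?Q s"
  \<comment> \<open>The common limit of both families of nodes at index N - d + r: the term with s
    q^i tends to zero, and the other one is constant in N from d on.\<close>
  define \<tau> where "\<tau> r = inverse s * ?Q powi (int d - int r - 1)" for r
  have Q0: "?Q \<noteq> 0" using q by simp
  have small: "(\<lambda>N. s * ?Q ^ (N - d + r)) \<longlonglongrightarrow> 0" for r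
  proof -
    have "filterlim (\<lambda>N. N - d + r) at_top sequentially"
      unfolding filterlim_at_top
    proof
      fix Z
      show "\<forall>\<^sub>F N in sequentially. Z \<le> N - d + r"
        using eventually_ge_at_top[of "Z + d"] by eventually_elim simp
    qed
    moreover have "(\<lambda>n. ?Q ^ n) \<longlonglongrightarrow> 0"
      using q by (intro LIMSEQ_power_zero) simp
    ultimately show ?thesis
      using tendsto_mult_right_zero filterlim_compose by blast
  qed
  have ev: "\<forall>\<^sub>F N in sequentially. inverse s * ?Q powi (int N - int (N - d + r) - 1) = \<tau> r" for r
    using eventually_ge_at_top[of d]
    by eventually_elim (auto simp: \<tau>_def intro!: arg_cong[where f = "power_int ?Q"])
  have lim: "(\<lambda>N. inverse s * ?Q powi (int N - int (N - d + r) - 1)) \<longlonglongrightarrow> \<tau> r" for r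
    by (rule tendsto_eventually[OF ev])
  have top_p: "(\<lambda>N. ?cp N (N - d + r)) \<longlonglongrightarrow> \<tau> r" for r
    using tendsto_add[OF small lim, of r r] by simp
  have top_m: "(\<lambda>N. ?cm N (N - d + r)) \<longlonglongrightarrow> \<tau> r" for r
    using tendsto_diff[OF lim small, of r r] by (simp add: qr_node_def)
  have inj: "\<tau> i \<noteq> \<tau> j" if "i < j" for i j
  proof
    assume "\<tau> i = \<tau> j"
    then have "?Q powi (int d - int i - 1) = ?Q powi (int d - int j - 1)" using s by (simp add: \<tau>_def)
    also have "?Q powi (int d - int i - 1) = ?Q powi (int d - int j - 1) * ?Q ^ (j - i)"
    proof -
      have e: "int d - int i - 1 = (int d - int j - 1) + int (j - i)" using that by simp
      show ?thesis unfolding e by (subst power_int_add) (use Q0 in simp_all)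
    qed
    finally have "?Q ^ (j - i) = 1" using Q0 by simp
    then have "q ^ (j - i) = 1" by (metis of_real_eq_1_iff of_real_power)
    then show False using q that power_less_one_iff[of q "j - i"] by simp
  qed
  have len: "\<alpha> \<in> parts_le d" "\<beta> \<in> parts_le d" using \<alpha> \<beta> d by (auto simp: parts_le_def)
  obtain Cp where Cp: "\<And>N. jts (node_coeff N (?cp N)) \<alpha> * jts (node_coeff N (?cp N)) \<beta> =
      (\<Sum>\<rho>\<in>parts_le d. sym_scale (Cp N \<rho>) (jts (node_coeff N (?cp N)) \<rho>))"
    using structure_constants_expansion[OF \<alpha> \<beta> d, of ?cp] by blast
  obtain Cm where Cm: "\<And>N. jts (node_coeff N (?cm N)) \<alpha> * jts (node_coeff N (?cm N)) \<beta> =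
      (\<Sum>\<rho>\<in>parts_le d. sym_scale (Cm N \<rho>) (jts (node_coeff N (?cm N)) \<rho>))"
    using structure_constants_expansion[OF \<alpha> \<beta> d, of ?cm] by blast
  define v where "v \<nu> \<rho> = interp_det d \<tau> \<nu> \<rho> / vdm d (\<lambda>j. \<tau> (shifted d \<nu> j))" for \<nu> \<rho>
  obtain D where D: "\<And>\<rho>. \<rho> \<in> parts_le d \<Longrightarrow> (\<lambda>N. Cp N \<rho>) \<longlonglongrightarrow> D \<rho>"
    "\<And>\<nu>. \<nu> \<in> parts_le d \<Longrightarrow> (\<Sum>\<rho>\<in>parts_le d. v \<nu> \<rho> * D \<rho>) = v \<nu> \<alpha> * v \<nu> \<beta>"
    "\<And>\<nu> \<rho>. \<nu> \<in> parts_le d \<Longrightarrow> \<rho> \<in> parts_le d \<Longrightarrow> \<not> part_subseteq \<rho> \<nu> \<Longrightarrow> v \<nu> \<rho> = 0"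
    "\<And>\<nu>. \<nu> \<in> parts_le d \<Longrightarrow> v \<nu> \<nu> \<noteq> 0"
    by (rule structure_constants_limit[OF top_p inj len Cp, folded v_def]) (assumption | rule that)+
  obtain D' where D': "\<And>\<rho>. \<rho> \<in> parts_le d \<Longrightarrow> (\<lambda>N. Cm N \<rho>) \<longlonglongrightarrow> D' \<rho>"
    "\<And>\<nu>. \<nu> \<in> parts_le d \<Longrightarrow> (\<Sum>\<rho>\<in>parts_le d. v \<nu> \<rho> * D' \<rho>) = v \<nu> \<alpha> * v \<nu> \<beta>"
    by (rule structure_constants_limit[OF top_m inj len Cm, folded v_def]) (assumption | rule that)+
  \<comment> \<open>Both limits solve the same triangular system, since the values \<open>v\<close>
    only depend on \<tau>.\<close>
  have eq: "D \<rho> = D' \<rho>" if "\<rho> \<in> parts_le d" for \<rho>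
  proof (rule triangular_unique[OF D(3) D(4) _ that])
    show "(\<Sum>\<rho>\<in>parts_le d. v \<nu> \<rho> * D \<rho>) = (\<Sum>\<rho>\<in>parts_le d. v \<nu> \<rho> * D' \<rho>)" if "\<nu> \<in> parts_le d" for \<nu>
      using D(2)[OF that] D'(2)[OF that] by simp
  qed
  have "jts \<epsilon> \<alpha> * jts \<epsilon> \<beta> = (\<Sum>\<rho>\<in>parts_le d. sym_scale (D \<rho>) (jts \<epsilon> \<rho>))"
  proof (rule sym_tendsto_unique)
    show "sym_tendsto (\<lambda>N. jts (node_coeff N (?cp N)) \<alpha> * jts (node_coeff N (?cp N)) \<beta>) (jts \<epsilon> \<alpha> * jts \<epsilon> \<beta>)"
      by (rule sym_tendsto_mult[OF \<epsilon> \<epsilon>])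
    show "sym_tendsto (\<lambda>N. jts (node_coeff N (?cp N)) \<alpha> * jts (node_coeff N (?cp N)) \<beta>)
        (\<Sum>\<rho>\<in>parts_le d. sym_scale (D \<rho>) (jts \<epsilon> \<rho>))"
      unfolding Cp by (intro sym_tendsto_sum sym_tendsto_scale D(1) \<epsilon>)
  qed
  from that[OF this Cm] show thesis using D'(1) eq by simp
qed

lemma qR_orthogonality:
  fixes q :: real and s0 s1 s2 s3 :: complex
  assumes q: "0 < q" "q < 1" and s0: "s0 \<noteq> 0"
    and S: "\<And>k. s0 * s1 * s2 * s3 * complex_of_real q powi k \<noteq> 1"
    and \<epsilon>: "\<And>\<mu>. sym_tendsto (\<lambda>N. jts (node_coeff N (\<lambda>i. s0 * of_real q ^ i + inverse s0 * of_real q powi (int N - int i - 1))) \<mu>)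
      (jts \<epsilon> \<mu>)"
    and \<Phi>: "\<And>\<nu>. \<nu> \<in> partitions \<Longrightarrow> \<Phi> \<nu> = (\<Sum>\<mu>\<in>{\<mu> \<in> partitions. part_subseteq \<mu> \<nu>}.
      sym_scale (sigma_qR \<nu> \<mu> (of_real q) s0 s1 s2 s3) (jts \<epsilon> \<mu>))"
    and E_add: "\<And>F G. E (F + G) = E F + E G" and E_scale: "\<And>a F. E (sym_scale a F) = a * E F"
    and E: "\<And>\<nu>. \<nu> \<in> partitions \<Longrightarrow> E (\<Phi> \<nu>) = (if \<nu> = empty_part then 1 else 0)"
    and \<nu>: "\<nu> \<in> partitions" and \<mu>: "\<mu> \<in> partitions"
  shows "E (\<Phi> \<nu> * \<Phi> \<mu>) = (if \<nu> = \<mu> then h_qR \<nu> (of_real q) s0 s1 s2 s3 else 0)"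
proof -
  let ?Q = "complex_of_real q"
  define S where "S = s0 * s1 * s2 * s3"
  \<comment> \<open>Large enough for the products of all interpolation functions in the two
    expansions.\<close>
  define d where "d = part_size \<nu> + part_size \<mu>"
  let ?sub = "\<lambda>\<nu>. {\<mu> \<in> partitions. part_subseteq \<mu> \<nu>}"
  let ?\<sigma> = "\<lambda>\<nu> \<mu>. sigma_qR \<nu> \<mu> ?Q s0 s1 s2 s3"
  have Q0: "?Q \<noteq> 0" using q by simp
  have Q1: "?Q ^ k \<noteq> 1" if "k > 0" for k
  proof
    assume "?Q ^ k = 1"
    then have "q ^ k = 1" by (metis of_real_eq_1_iff of_real_power)
    then show False using q that power_less_one_iff[of q k] by simp
  qed
  have Qlt: "norm ?Q < 1" using q by simp
  have SQ: "S * ?Q powi k \<noteq> 1" for k unfolding S_def by (rule S)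
  \<comment> \<open>The perturbation depends on N: only finitely many coefficients must be nonzero
    for each N, and the bound 1/(N+1) makes it disappear in the limit.\<close>
  have "\<forall>N. \<exists>\<zeta>. 1 < \<zeta> \<and> \<zeta> < 1 + 1 / real (Suc N) \<and> (\<forall>k. 1 \<le> k \<longrightarrow> k < N \<longrightarrow>
      qr_gamma ?Q s0 (of_real \<zeta> * s1) (of_real \<zeta> * s2) (s3 / of_real \<zeta> ^ 2) N k \<noteq> 0)"
  proof
    fix N
    obtain \<zeta> :: real where "1 < \<zeta>" "\<zeta> < 1 + 1 / real (Suc N)"
      "\<And>k. 1 \<le> k \<Longrightarrow> k < N \<Longrightarrow>
        qr_gamma ?Q s0 (of_real \<zeta> * s1) (of_real \<zeta> * s2) (s3 / of_real \<zeta> ^ 2) N k \<noteq> 0"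
      by (rule qr_gamma_perturbation[OF Q0 Q1 s0 S, of N]) (assumption | rule that)+
    then show "\<exists>\<zeta>. 1 < \<zeta> \<and> \<zeta> < 1 + 1 / real (Suc N) \<and> (\<forall>k. 1 \<le> k \<longrightarrow> k < N \<longrightarrow>
        qr_gamma ?Q s0 (of_real \<zeta> * s1) (of_real \<zeta> * s2) (s3 / of_real \<zeta> ^ 2) N k \<noteq> 0)"
      by blast
  qed
  from choice[OF this] obtain \<zeta> where \<zeta>: "\<And>N. 1 < \<zeta> N" "\<And>N. \<zeta> N < 1 + 1 / real (Suc N)"
    "\<And>N k. 1 \<le> k \<Longrightarrow> k < N \<Longrightarrow>
      qr_gamma ?Q s0 (of_real (\<zeta> N) * s1) (of_real (\<zeta> N) * s2) (s3 / of_real (\<zeta> N) ^ 2) N k \<noteq> 0"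
    by blast
  define r1 where "r1 N = of_real (\<zeta> N) * s1" for N
  define r2 where "r2 N = of_real (\<zeta> N) * s2" for N
  define r3 where "r3 N = s3 / of_real (\<zeta> N) ^ 2" for N
  have "(\<lambda>N. 1 + 1 / real (Suc N)) \<longlonglongrightarrow> 1 + 0"
    by (intro tendsto_add tendsto_const LIMSEQ_inverse_real_of_nat[unfolded inverse_eq_divide])
  then have "\<zeta> \<longlonglongrightarrow> 1"
    using tendsto_sandwich[of "\<lambda>_. 1" \<zeta> sequentially "\<lambda>N. 1 + 1 / real (Suc N)" 1] \<zeta>(1,2) by (simp add: less_imp_le)
  then have "(\<lambda>N. complex_of_real (\<zeta> N)) \<longlonglongrightarrow> of_real 1" by (rule tendsto_of_real)
  then have \<zeta>lim: "(\<lambda>N. complex_of_real (\<zeta> N)) \<longlonglongrightarrow> 1" by simp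
  have r: "r1 \<longlonglongrightarrow> s1" "r2 \<longlonglongrightarrow> s2" "r3 \<longlonglongrightarrow> s3"
  proof -
    show "r1 \<longlonglongrightarrow> s1" unfolding r1_def using tendsto_mult[OF \<zeta>lim tendsto_const, of s1] by simp
    show "r2 \<longlonglongrightarrow> s2" unfolding r2_def using tendsto_mult[OF \<zeta>lim tendsto_const, of s2] by simp
    show "r3 \<longlonglongrightarrow> s3"
      unfolding r3_def using tendsto_divide[OF tendsto_const tendsto_power[OF \<zeta>lim, of 2], of s3] by simp
  qed
  have rS: "s0 * r1 N * r2 N * r3 N = S" for N
  proof -
    have "complex_of_real (\<zeta> N) \<noteq> 0" using \<zeta>(1)[of N] by simp
    then show ?thesis by (simp add: r1_def r2_def r3_def S_def power2_eq_square)
  qed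
  let ?K = "\<lambda>N. qr_coeff ?Q s0 (r1 N) (r2 N) (r3 N) N"
  let ?g = "\<lambda>N. qr_gamma ?Q s0 (r1 N) (r2 N) (r3 N) N"
  let ?c = "qr_node ?Q s0"
  let ?J = "\<lambda>N. jts (node_coeff N (?c N))"
  let ?sig = "\<lambda>N. three_term.sig (?K N) N"
  let ?sp = "\<lambda>N. three_term.sympol (?K N) (?c N) N"
  have tt: "three_term (?K N) (?c N) (qr_beta ?Q s0 (r1 N) (r2 N) (r3 N) N) (?g N)" for N
    by (rule qr_three_term[OF Q0 Q1 s0 SQ rS])
  have sp: "?sp N \<kappa> = (\<Sum>\<mu>\<in>?sub \<kappa>. sym_scale (?sig N \<kappa> \<mu>) (?J N \<mu>))" for N \<kappa>
    by (rule three_term.sympol_def[OF tt])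
  have siglim: "(\<lambda>N. ?sig N \<kappa> \<rho>) \<longlonglongrightarrow> ?\<sigma> \<kappa> \<rho>" if "\<kappa> \<in> partitions" "\<rho> \<in> ?sub \<kappa>" for \<kappa> \<rho>
    using that by (intro sig_limit[OF Q0 Q1 s0 SQ r rS Qlt]) (auto simp: S_def)
  have "\<forall>N. \<exists>F. (\<forall>G H. F (G + H) = F G + F H) \<and> (\<forall>a G. F (sym_scale a G) = a * F G) \<and>
      (\<forall>\<kappa> \<rho>. \<kappa> \<in> parts_le d \<longrightarrow> \<rho> \<in> parts_le d \<longrightarrow> part_length \<kappa> \<le> N \<longrightarrow> part_length \<rho> \<le> N \<longrightarrow>
        F (?sp N \<kappa> * ?sp N \<rho>) = (if \<kappa> = \<rho> then \<Prod>i<N. \<Prod>k = N - i..<N - i + \<kappa> i. ?g N k else 0))"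
  proof
    fix N
    show "\<exists>F. (\<forall>G H. F (G + H) = F G + F H) \<and> (\<forall>a G. F (sym_scale a G) = a * F G) \<and>
      (\<forall>\<kappa> \<rho>. \<kappa> \<in> parts_le d \<longrightarrow> \<rho> \<in> parts_le d \<longrightarrow> part_length \<kappa> \<le> N \<longrightarrow> part_length \<rho> \<le> N \<longrightarrow>
        F (?sp N \<kappa> * ?sp N \<rho>) = (if \<kappa> = \<rho> then \<Prod>i<N. \<Prod>k = N - i..<N - i + \<kappa> i. ?g N k else 0))"
    proof -
      have g: "?g N k \<noteq> 0" if "1 \<le> k" "k < N" for k
        unfolding r1_def r2_def r3_def by (rule \<zeta>(3)[OF that])
      obtain F :: "symfun \<Rightarrow> complex" where F: "\<And>G H. F (G + H) = F G + F H" "\<And>a G. F (sym_scale a G) = a * F G"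
        "\<And>\<kappa> \<rho>. \<kappa> \<in> parts_le d \<Longrightarrow> \<rho> \<in> parts_le d \<Longrightarrow> part_length \<kappa> \<le> N \<Longrightarrow> part_length \<rho> \<le> N \<Longrightarrow>
          F (?sp N \<kappa> * ?sp N \<rho>) = (if \<kappa> = \<rho> then \<Prod>i<N. \<Prod>k = N - i..<N - i + \<kappa> i. ?g N k else 0)"
        by (rule three_term.multivariate_functional[OF tt g]) (assumption | rule that)+
      show ?thesis by (intro exI[of _ F] conjI allI impI F)
    qed
  qed
  from choice[OF this] obtain F where F_add: "\<And>N G H. F N (G + H) = F N G + F N H"
    and F_scale: "\<And>N a G. F N (sym_scale a G) = a * F N G"
    and F_orth: "\<And>N \<kappa> \<rho>. \<kappa> \<in> parts_le d \<Longrightarrow> \<rho> \<in> parts_le d \<Longrightarrow> part_length \<kappa> \<le> N \<Longrightarrow> part_length \<rho> \<le> N \<Longrightarrow>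
      F N (?sp N \<kappa> * ?sp N \<rho>) = (if \<kappa> = \<rho> then \<Prod>i<N. \<Prod>k = N - i..<N - i + \<kappa> i. ?g N k else 0)"
    by blast
  have lin_sum: "G (\<Sum>x\<in>A. f x) = (\<Sum>x\<in>A. G (f x))"
    if "\<And>H H'. G (H + H') = G H + G H'" "\<And>a H. G (sym_scale a H) = a * G H" for G :: "symfun \<Rightarrow> complex" and f and A :: "'b set"
  proof -
    have "G 0 = 0" using that(2)[of 0 0] by simp
    then show ?thesis by (induction A rule: infinite_finite_induct) (simp_all add: that(1))
  qed
  note E_sum = lin_sum[of E, OF E_add E_scale] and F_sum = lin_sum[of "F _", OF F_add F_scale]
  have len: "part_length \<kappa> \<le> d" "\<kappa> \<in> partitions" if "\<kappa> \<in> parts_le d" for \<kappa>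
    using that part_length_le_size[of \<kappa>] by (auto simp: parts_le_def)
  have emp: "empty_part \<in> parts_le d" by (simp add: parts_le_def)
  have sub_le: "?sub \<kappa> \<subseteq> parts_le d" if "\<kappa> \<in> parts_le d" for \<kappa>
    using that part_subseteq_size[of _ \<kappa>] by (auto simp: parts_le_def) (meson le_trans)
  \<comment> \<open>Orthogonality to the empty partition thus gives the value of \<open>F N\<close>
    at every single \<open>?sp N \<kappa>\<close>.\<close>
  have sp_emp: "?sp N empty_part = 1" for N
  proof -
    have "?sub empty_part = {empty_part}"
      by (auto simp: part_subseteq_def empty_part_def partitions_def antimono_def)
    then show ?thesis
      unfolding sp by (simp add: three_term.sig_diag[OF tt])
  qed
  \<comment> \<open>The right-hand side \<open>b\<close> of the triangular system is the same for
    all N and for E, so only the coefficients have to converge.\<close>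
  have Jlim: "(\<lambda>N. F N (?J N \<rho>)) \<longlonglongrightarrow> E (jts \<epsilon> \<rho>)" if \<rho>: "\<rho> \<in> parts_le d" for \<rho>
  proof -
    define v where "v N \<kappa> \<rho> = (if part_subseteq \<rho> \<kappa> then ?sig N \<kappa> \<rho> else 0)" for N \<kappa> \<rho>
    define v0 where "v0 \<kappa> \<rho> = (if part_subseteq \<rho> \<kappa> then ?\<sigma> \<kappa> \<rho> else 0)" for \<kappa> \<rho>
    define b :: "(nat \<Rightarrow> nat) \<Rightarrow> complex" where "b \<kappa> = (if \<kappa> = empty_part then 1 else 0)" for \<kappa>
    have restr: "(\<Sum>\<rho>\<in>parts_le d. (if part_subseteq \<rho> \<kappa> then f \<rho> else 0) * e \<rho>) = (\<Sum>\<rho>\<in>?sub \<kappa>. f \<rho> * e \<rho>)"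
      if "\<kappa> \<in> parts_le d" for \<kappa> and f e :: "(nat \<Rightarrow> nat) \<Rightarrow> complex"
      using sub_le[OF that] by (intro sum.mono_neutral_cong_right finite_parts_le) (auto simp: parts_le_def)
    have lim: "(\<lambda>N. v N \<kappa> \<rho>) \<longlonglongrightarrow> v0 \<kappa> \<rho>" if "\<kappa> \<in> parts_le d" "\<rho> \<in> parts_le d" for \<kappa> \<rho>
    proof (cases "part_subseteq \<rho> \<kappa>")
      case True
      then show ?thesis
        using siglim[of \<kappa> \<rho>] len(2)[OF that(1)] len(2)[OF that(2)] by (simp add: v_def v0_def)
    qed (simp add: v_def v0_def)
    have sys: "\<forall>\<^sub>F N in sequentially. (\<Sum>\<rho>\<in>parts_le d. v N \<kappa> \<rho> * F N (?J N \<rho>)) = b \<kappa>" if \<kappa>: "\<kappa> \<in> parts_le d" for \<kappa>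
      using eventually_ge_at_top[of d]
    proof eventually_elim
      case (elim N)
      have "(\<Sum>\<rho>\<in>parts_le d. v N \<kappa> \<rho> * F N (?J N \<rho>)) = F N (?sp N \<kappa> * ?sp N empty_part)"
        unfolding sp_emp mult_1_right unfolding v_def restr[OF \<kappa>] sp F_sum F_scale ..
      also have "\<dots> = b \<kappa>"
      proof -
        have "(\<Prod>i<N. \<Prod>k = N - i..<N - i + empty_part i. ?g N k) = 1" by (simp add: empty_part_def)
        then show ?thesis
          using F_orth[OF \<kappa> emp, of N] len(1)[OF \<kappa>] len(1)[OF emp] elim by (auto simp: b_def)
      qed
      finally show ?case .
    qed
    have diag: "v0 \<kappa> \<kappa> \<noteq> 0" if "\<kappa> \<in> parts_le d" for \<kappa>
      using sigma_qR_diag[OF len(2)[OF that] s0] by (simp add: v0_def)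
    have tri: "v N \<kappa> \<rho> = 0" "v0 \<kappa> \<rho> = 0" if "\<kappa> \<in> parts_le d" "\<rho> \<in> parts_le d" "\<not> part_subseteq \<rho> \<kappa>" for N \<kappa> \<rho>
      using that by (simp_all add: v_def v0_def)
    have "convergent (\<lambda>N. F N (?J N \<rho>))" if "\<rho> \<in> parts_le d" for \<rho>
      by (rule triangular_convergent[OF tri(1) sys lim tendsto_const diag that])
    then have conv: "(\<lambda>N. F N (?J N \<rho>)) \<longlonglongrightarrow> lim (\<lambda>N. F N (?J N \<rho>))" if "\<rho> \<in> parts_le d" for \<rho>
      using that by (simp add: convergent_LIMSEQ_iff)
    have "lim (\<lambda>N. F N (?J N \<rho>)) = E (jts \<epsilon> \<rho>)"
    proof (rule triangular_unique[OF tri(2) diag _ \<rho>])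
      fix \<kappa> assume \<kappa>: "\<kappa> \<in> parts_le d"
      have "(\<lambda>N. \<Sum>\<rho>\<in>parts_le d. v N \<kappa> \<rho> * F N (?J N \<rho>)) \<longlonglongrightarrow> (\<Sum>\<rho>\<in>parts_le d. v0 \<kappa> \<rho> * lim (\<lambda>N. F N (?J N \<rho>)))"
        by (intro tendsto_sum tendsto_mult lim conv \<kappa>)
      moreover have "(\<lambda>N. \<Sum>\<rho>\<in>parts_le d. v N \<kappa> \<rho> * F N (?J N \<rho>)) \<longlonglongrightarrow> b \<kappa>"
        by (rule tendsto_eventually[OF sys[OF \<kappa>]])
      ultimately have "(\<Sum>\<rho>\<in>parts_le d. v0 \<kappa> \<rho> * lim (\<lambda>N. F N (?J N \<rho>))) = b \<kappa>"
        by (rule LIMSEQ_unique)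
      also have "b \<kappa> = E (\<Phi> \<kappa>)" using E[OF len(2)[OF \<kappa>]] by (simp add: b_def)
      also have "\<dots> = (\<Sum>\<rho>\<in>parts_le d. v0 \<kappa> \<rho> * E (jts \<epsilon> \<rho>))"
        unfolding v0_def restr[OF \<kappa>] \<Phi>[OF len(2)[OF \<kappa>]] E_sum E_scale ..
      finally show "(\<Sum>\<rho>\<in>parts_le d. v0 \<kappa> \<rho> * lim (\<lambda>N. F N (?J N \<rho>))) = (\<Sum>\<rho>\<in>parts_le d. v0 \<kappa> \<rho> * E (jts \<epsilon> \<rho>))" .
    qed
    then show ?thesis using conv[OF \<rho>] by simp
  qed
  \<comment> \<open>Convergence of \<open>F N\<close> is known only along the
    \<open>?J N \<rho>\<close>, so the products are expanded first; here the limits for the two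
    families of nodes must agree.\<close>
  have prod_lim: "(\<lambda>N. F N (?J N \<alpha> * ?J N \<beta>)) \<longlonglongrightarrow> E (jts \<epsilon> \<alpha> * jts \<epsilon> \<beta>)"
    if \<alpha>: "\<alpha> \<in> ?sub \<nu>" and \<beta>: "\<beta> \<in> ?sub \<mu>" for \<alpha> \<beta>
  proof -
    have part: "\<alpha> \<in> partitions" "\<beta> \<in> partitions" using \<alpha> \<beta> by auto
    have dd: "part_size \<alpha> + part_size \<beta> \<le> d"
      unfolding d_def using \<alpha> \<beta> \<nu> \<mu> by (intro add_mono part_subseteq_size) auto
    obtain C0 C where C: "jts \<epsilon> \<alpha> * jts \<epsilon> \<beta> = (\<Sum>\<rho>\<in>parts_le d. sym_scale (C0 \<rho>) (jts \<epsilon> \<rho>))"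
      "\<And>N. ?J N \<alpha> * ?J N \<beta> = (\<Sum>\<rho>\<in>parts_le d. sym_scale (C N \<rho>) (?J N \<rho>))"
      "\<And>\<rho>. \<rho> \<in> parts_le d \<Longrightarrow> (\<lambda>N. C N \<rho>) \<longlonglongrightarrow> C0 \<rho>"
      by (rule structure_constants_agree[OF q s0 \<epsilon> part dd]) blast
    show ?thesis
      unfolding C(1,2) E_sum F_sum E_scale F_scale by (intro tendsto_sum tendsto_mult C(3) Jlim)
  qed
  have expand_F: "F N (?sp N \<nu> * ?sp N \<mu>) =
      (\<Sum>\<alpha>\<in>?sub \<nu>. \<Sum>\<beta>\<in>?sub \<mu>. ?sig N \<mu> \<beta> * (?sig N \<nu> \<alpha> * F N (?J N \<alpha> * ?J N \<beta>)))" for N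
    unfolding sp sum_product sym_scale_mult sym_scale_mult_right F_sum F_scale ..
  have expand_E: "E (\<Phi> \<nu> * \<Phi> \<mu>) =
      (\<Sum>\<alpha>\<in>?sub \<nu>. \<Sum>\<beta>\<in>?sub \<mu>. ?\<sigma> \<mu> \<beta> * (?\<sigma> \<nu> \<alpha> * E (jts \<epsilon> \<alpha> * jts \<epsilon> \<beta>)))"
    unfolding \<Phi>[OF \<nu>] \<Phi>[OF \<mu>] sum_product sym_scale_mult sym_scale_mult_right E_sum E_scale ..
  have "(\<lambda>N. F N (?sp N \<nu> * ?sp N \<mu>)) \<longlonglongrightarrow> E (\<Phi> \<nu> * \<Phi> \<mu>)"
    unfolding expand_F expand_E by (intro tendsto_sum tendsto_mult siglim prod_lim \<nu> \<mu>)
  \<comment> \<open>From N = d on the sequence is known exactly, and only the product of the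
    \<gamma>_k is taken to the limit.\<close>
  moreover have "(\<lambda>N. F N (?sp N \<nu> * ?sp N \<mu>)) \<longlonglongrightarrow> (if \<nu> = \<mu> then h_qR \<nu> ?Q s0 s1 s2 s3 else 0)"
  proof (rule Lim_transform_eventually)
    have "(\<lambda>N. \<Prod>i<N. \<Prod>k = N - i..<N - i + \<nu> i. ?g N k) \<longlonglongrightarrow> h_qR \<nu> ?Q s0 s1 s2 s3"
      unfolding h_qR_boxes[OF \<nu> Q0 S_def] by (rule gamma_product_limit[OF Q0 Q1 s0 SQ r rS Qlt \<nu>])
    then show "(\<lambda>N. if \<nu> = \<mu> then \<Prod>i<N. \<Prod>k = N - i..<N - i + \<nu> i. ?g N k else 0) \<longlonglongrightarrow>
        (if \<nu> = \<mu> then h_qR \<nu> ?Q s0 s1 s2 s3 else 0)"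
      by (cases "\<nu> = \<mu>") (simp_all only: simp_thms if_True if_False tendsto_const)
    have "\<nu> \<in> parts_le d" "\<mu> \<in> parts_le d" using \<nu> \<mu> by (auto simp: parts_le_def d_def)
    note F_nm = F_orth[OF this] and l = len(1)[OF this(1)] len(1)[OF this(2)]
    show "\<forall>\<^sub>F N in sequentially. (if \<nu> = \<mu> then \<Prod>i<N. \<Prod>k = N - i..<N - i + \<nu> i. ?g N k else 0) = F N (?sp N \<nu> * ?sp N \<mu>)"
      using eventually_ge_at_top[of d]
    proof eventually_elim
      case (elim N)
      show ?case by (rule F_nm[symmetric]) (use l elim in linarith)+
    qed
  qed
  ultimately show ?thesis by (rule LIMSEQ_unique)
qed

theorem theorem3p16:
  fixes q :: real and s0 s1 s2 s3 :: complex and \<Phi> :: "(nat \<Rightarrow> nat) \<Rightarrow> symfun"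
  assumes "0 < q" and "q < 1" and "s0 \<noteq> 0"
    and "\<forall>k :: int. s0 * s1 * s2 * s3 \<noteq> complex_of_real q powi k"
    and "\<And>\<nu>. \<Phi> \<nu> = Phi_qR \<nu> (complex_of_real q) s0 s1 s2 s3"
  shows "inj_on \<Phi> partitions \<and> sym.independent (\<Phi> ` partitions) \<and> sym.span (\<Phi> ` partitions) = UNIV \<and>
    (\<forall>E :: symfun \<Rightarrow> complex.
       Vector_Spaces.linear sym_scale (*) E \<longrightarrow>
       (\<forall>\<nu>\<in>partitions. E (\<Phi> \<nu>) = (if \<nu> = empty_part then 1 else 0)) \<longrightarrow>
       (\<forall>\<nu>\<in>partitions. \<forall>\<mu>\<in>partitions.
          E (\<Phi> \<nu> * \<Phi> \<mu>) =
            (if \<nu> = \<mu> then h_qR \<nu> (complex_of_real q) s0 s1 s2 s3 else 0)))"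
proof -
  let ?Q = "complex_of_real q"
  let ?f = "\<lambda>\<epsilon> \<nu>. \<Sum>\<mu>\<in>{\<mu> \<in> partitions. part_subseteq \<mu> \<nu>}. sym_scale (sigma_qR \<nu> \<mu> ?Q s0 s1 s2 s3) (jts \<epsilon> \<mu>)"
  have S: "s0 * s1 * s2 * s3 * ?Q powi k \<noteq> 1" for k
  proof
    assume *: "s0 * s1 * s2 * s3 * ?Q powi k = 1"
    have "?Q powi k * ?Q powi (- k) = 1"
      using assms(1) by (simp add: power_int_minus)
    then have "s0 * s1 * s2 * s3 = s0 * s1 * s2 * s3 * (?Q powi k * ?Q powi (- k))" by simp
    also have "\<dots> = ?Q powi (- k)" using * by (simp add: mult.assoc[symmetric])
    finally show False using assms(4) by blast
  qed
  obtain \<epsilon> where \<epsilon>: "\<And>t. \<epsilon> t 0 = 1"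
    "\<And>\<mu>. \<mu> \<in> partitions \<Longrightarrow> interp_BC \<mu> ?Q s0 = jts \<epsilon> \<mu>"
    "\<And>\<mu>. sym_tendsto (\<lambda>N. jts (node_coeff N (\<lambda>i. s0 * ?Q ^ i + inverse s0 * ?Q powi (int N - int i - 1))) \<mu>) (jts \<epsilon> \<mu>)"
    using interp_BC_limit[OF assms(1-3)] by blast
  have \<Phi>: "\<Phi> = ?f \<epsilon>"
    unfolding assms(5) Phi_qR_def by (intro ext sum.cong refl) (simp add: \<epsilon>(2))
  have "schur_like \<Phi>"
    unfolding \<Phi> by (rule schur_like_unitriangular) (simp_all add: \<epsilon>(1) sigma_qR_diag assms(3))
  note basis = schur_like_basis[OF this]
  have "E (\<Phi> \<nu> * \<Phi> \<mu>) = (if \<nu> = \<mu> then h_qR \<nu> ?Q s0 s1 s2 s3 else 0)"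
    if E: "Vector_Spaces.linear sym_scale (*) E" "\<forall>\<nu>\<in>partitions. E (\<Phi> \<nu>) = (if \<nu> = empty_part then 1 else 0)"
      and \<nu>: "\<nu> \<in> partitions" and \<mu>: "\<mu> \<in> partitions" for E :: "symfun \<Rightarrow> complex" and \<nu> \<mu>
  proof -
    interpret E: Vector_Spaces.linear sym_scale "(*)" E by (rule E(1))
    show ?thesis
      using E(2) fun_cong[OF \<Phi>]
      by (intro qR_orthogonality[OF assms(1-3) S \<epsilon>(3) _ E.add E.scale _ \<nu> \<mu>]) auto
  qed
  then show ?thesis using basis by blast
qed

end
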